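(* For every sufficiently large $n$ the group isomorphism $(\mathrm{id}\oplus\mu): H^2(R,T/T_n)\to H^2(R,T/T_{n+d})$ induces a $1$-$1$ correspondence between the orbits of $H^2(R,T/T_n)$ under the action of $\mathrm{Comp}(R,T/T_n)$ and the orbits of $H^2(R,T/T_{n+d})$ under the action of $\mathrm{Comp}(R,T/T_{n+d})$.
   Context: Setting. Let $p$ be a prime and $\mathbb{Z}_p$ the $p$-adic integers. For a finite $p$-group $G$ of order $p^n$ and nilpotency class $c$ put $\mathrm{cc}\,G:=n-c$ (the coclass). An infinite pro-$p$-group $S$ with lower central series $S=S_1\ge S_2\ge\cdots$ has coclass $r$ if every $S/S_i$ is finite and $\lim \mathrm{cc}(S/S_i)=r$. Fix such an $S$ of coclass $r$. Let $t(S)$ be the minimal natural number $t$ such that $S/S_t$ is not isomorphic to a quotient of an infinite pro-$p$-group of coclass $r$ not isomorphic to $S$. A finite $p$-group $H$ of coclass $r$ is a descendant of a finite $p$-group $G$ of coclass $r$ if $H/N\cong G$ for some normal subgroup $N$ of $H$. The coclass tree $\mathcal{T}(S)$ consists of the isomorphism classes of the descendants of $S/S_{t(S)}$. For fixed $k\in\mathbb{N}$, the shaved coclass tree $\mathcal{T}_k(S)$ consists of those $G\in\mathcal{T}(S)$ having a normal subgroup $N$ of order at most $p^k$ with $G/N\cong S/S_i$ for some $i\ge t(S)$. Uniserial action: for a finite $p$-group $G$ acting on a $\mathbb{Z}_p$-module $N$ of finite rank (image of $n$ under $g$ written $n.g$), put $N_0:=N$, $N_{i+1}:=[G,N_i]=\langle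 n.g-n\mid n\in N_i, g\in G\rangle$; $G$ acts uniserially on $N$ if $[N_i:N_{i+1}]=p$ whenever $N_i\ne 0$. Let $l=l(k,S)$ be a natural number (such a number exists) such that (i) $R:=S/S_l$ lies in $\mathcal{T}_k(S)$, and $T:=S_l$ is a free $\mathbb{Z}_p$-module of finite rank $d$ on which $R$ acts uniserially, with lower $R$-central series $T=T_0>T_1>\cdots$; (ii) every descendant $G\in\mathcal{T}_k(S)$ of $R$ is isomorphic to a group extension of the $R$-module $T/T_n$ by $R$, where $|G|=|R|\cdot p^n$. One has $T_{n+d}=pT_n$. Write $A_n:=T/T_n$. Compatible pairs. For an $R$-module $V$ let $\overline{g}\in\mathrm{Aut}\,V$ be the automorphism induced by $g\in R$. Then $\mathrm{Comp}(R,V):=\{(\beta,\epsilon)\in\mathrm{Aut}\,R\times\mathrm{Aut}\,V\mid \overline{g^{\beta}}=\overline{g}^{\,\epsilon}\text{ for all }g\in R\}$, i.e. $\epsilon(v.g)=\epsilon(v).g^\beta$ for all $v\in V$, $g\in R$. It acts on $Z^2(R,V)$ by $\gamma^{(\beta,\epsilon)}(g,h):=\epsilon(\gamma(g^{\beta^{-1}},h^{\beta^{-1}}))$, and this induces an action on $H^2(R,V)$. The map $\mathrm{id}\oplus\mu$. Multiplication by $p$, $T_n\to T_{n+d}$, induces an isomorphism $\mu:H^3(R,T_n)\to H^3(R,T_{n+d})$. Put $a:=\max\{\exp H^2(R,T),\exp H^3(R,T_n)\}$ (this depends on $n$ only modulo $d$). There is a natural number $m=m(l,S)$ such that for all $n\ge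 m$ there is a canonical isomorphism $H^2(R,A_n)\cong H^2(R,T)\oplus H^3(R,T_n)$: the summand $H^2(R,T)$ is embedded by the map induced by $T\to A_n$; the summand $H^3(R,T_n)$ corresponds to the image of $H^2(R,a^{-1}T_n/T_n)\to H^2(R,A_n)$ (where $a^{-1}T_n\le T$), identified with $H^3(R,T_n)$ by the connecting homomorphism $H^2(R,A_n)\to H^3(R,T_n)$. For $n\ge m$, $(\mathrm{id}\oplus\mu):H^2(R,A_n)\to H^2(R,A_{n+d})$ is the group isomorphism given via these identifications by $(\alpha,\beta)\mapsto(\alpha,\mu(\beta))$. In terms of cochains: if a class is represented by the reduction modulo $T_n$ of $\gamma+\delta$ with $\gamma\in Z^2(R,T)$ and $\delta$ a $2$-cochain with values in $a^{-1}T_n$ and coboundary in $T_n$, its image is the class of the reduction of $\gamma+p\delta$ modulo $T_{n+d}$. *)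

theory Defs
  imports "HOL-Analysis.Analysis" "HOL-Algebra.Group_Action" "HOL-Algebra.Generated_Groups"
    "HOL-Algebra.Module"
begin

section \<open>Pro-p-groups and coclass\<close>

definition topological_group :: "'a monoid \<Rightarrow> 'a topology \<Rightarrow> bool" where
  "topological_group G \<tau> \<longleftrightarrow>
     group G \<and> topspace \<tau> = carrier G \<and>
     continuous_map (prod_topology \<tau> \<tau>) \<tau> (\<lambda>(x, y). x \<otimes>\<^bsub>G\<^esub> y) \<and>
     continuous_map \<tau> \<tau> (\<lambda>x. inv\<^bsub>G\<^esub> x)"

definition pro_p_group :: "nat \<Rightarrow> 'a monoid \<Rightarrow> 'a topology \<Rightarrow> bool" where
  "pro_p_group p G \<tau> \<longleftrightarrow>
     topological_group G \<tau> \<and> compact_space \<tau> \<and> Hausdorff_space \<tau> \<and>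
     (\<forall>U. openin \<tau> U \<and> \<one>\<^bsub>G\<^esub> \<in> U \<longrightarrow> (\<exists>H. subgroup H G \<and> openin \<tau> H \<and> H \<subseteq> U)) \<and>
     (\<forall>N. N \<lhd> G \<and> openin \<tau> N \<longrightarrow> (\<exists>n. order (G Mod N) = p ^ n))"

definition commutator_subgroup :: "'a monoid \<Rightarrow> 'a set \<Rightarrow> 'a set \<Rightarrow> 'a set" where
  "commutator_subgroup G H K =
     generate G {inv\<^bsub>G\<^esub> h \<otimes>\<^bsub>G\<^esub> inv\<^bsub>G\<^esub> k \<otimes>\<^bsub>G\<^esub> h \<otimes>\<^bsub>G\<^esub> k | h k. h \<in> H \<and> k \<in> K}"

text \<open>As usual for pro-p-groups, the terms of the lower central series are closed subgroups. For
  an abstract group take the discrete topology. The series starts at index 1; its value at index 0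
  is a dummy.\<close>

fun lower_central :: "'a monoid \<Rightarrow> 'a topology \<Rightarrow> nat \<Rightarrow> 'a set" where
  "lower_central G \<tau> 0 = carrier G"
| "lower_central G \<tau> (Suc 0) = carrier G"
| "lower_central G \<tau> (Suc (Suc i)) =
     \<tau> closure_of commutator_subgroup G (carrier G) (lower_central G \<tau> (Suc i))"

definition nilpotency_class :: "'a monoid \<Rightarrow> nat" where
  "nilpotency_class G =
     (LEAST c. lower_central G (discrete_topology (carrier G)) (Suc c) = {\<one>\<^bsub>G\<^esub>})"

definition finite_p_group :: "nat \<Rightarrow> 'a monoid \<Rightarrow> bool" where
  "finite_p_group p G \<longleftrightarrow> group G \<and> (\<exists>n. order G = p ^ n)"

text \<open>The class of a group of order \<open>p ^ n\<close> is at most \<open>n\<close>, so the subtraction does not truncate.\<close>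

definition coclass :: "nat \<Rightarrow> 'a monoid \<Rightarrow> nat" where
  "coclass p G = multiplicity p (order G) - nilpotency_class G"

definition p_group_of_coclass :: "nat \<Rightarrow> nat \<Rightarrow> 'a monoid \<Rightarrow> bool" where
  "p_group_of_coclass p r G \<longleftrightarrow> finite_p_group p G \<and> coclass p G = r"

definition infinite_pro_p_of_coclass :: "nat \<Rightarrow> nat \<Rightarrow> 'a monoid \<Rightarrow> 'a topology \<Rightarrow> bool" where
  "infinite_pro_p_of_coclass p r S \<tau> \<longleftrightarrow>
     pro_p_group p S \<tau> \<and> infinite (carrier S) \<and>
     (\<forall>i. finite (carrier (S Mod lower_central S \<tau> i))) \<and>
     (\<lambda>i. coclass p (S Mod lower_central S \<tau> i)) \<longlonglongrightarrow> r"


section \<open>Coclass trees\<close>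

definition topologically_isomorphic ::
    "'a monoid \<Rightarrow> 'a topology \<Rightarrow> 'b monoid \<Rightarrow> 'b topology \<Rightarrow> bool" where
  "topologically_isomorphic G \<tau> H \<sigma> \<longleftrightarrow> (\<exists>f. f \<in> iso G H \<and> homeomorphic_map \<tau> \<sigma> f)"

text \<open>The comparison groups \<open>Q\<close> live on the same type as \<open>S\<close>. This is no restriction: an infinite
  pro-p-group of finite coclass is finitely generated, hence its carrier has the cardinality of the
  continuum, so each such group has an isomorphic copy on a subset of the carrier type of \<open>S\<close>.

  The requirement that \<open>S/S\<^sub>t\<close> has coclass \<open>r\<close> makes explicit that \<open>S/S\<^sub>t\<close> is the root of a tree of
  groups of coclass \<open>r\<close>, as is presupposed when one speaks of its descendants. It matters only if
  the second condition already holds for some quotient of smaller coclass, for example if \<open>r = 1\<close>,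
  where \<open>S\<close> is the only infinite pro-p-group of coclass \<open>r\<close> and the trivial group \<open>S/S\<^sub>1\<close> satisfies
  the second condition.\<close>

definition tree_root_index :: "nat \<Rightarrow> nat \<Rightarrow> 'a monoid \<Rightarrow> 'a topology \<Rightarrow> nat" where
  "tree_root_index p r S \<tau> =
     (LEAST t. 1 \<le> t \<and> coclass p (S Mod lower_central S \<tau> t) = r \<and>
        \<not> (\<exists>(Q :: 'a monoid) \<sigma> N.
             infinite_pro_p_of_coclass p r Q \<sigma> \<and> \<not> topologically_isomorphic S \<tau> Q \<sigma> \<and>
             N \<lhd> Q \<and> closedin \<sigma> N \<and> S Mod lower_central S \<tau> t \<cong> Q Mod N))"

definition descendant :: "nat \<Rightarrow> nat \<Rightarrow> 'b monoid \<Rightarrow> 'c monoid \<Rightarrow> bool" where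
  "descendant p r H G \<longleftrightarrow>
     p_group_of_coclass p r H \<and> p_group_of_coclass p r G \<and> (\<exists>N. N \<lhd> H \<and> H Mod N \<cong> G)"

text \<open>The trees are represented by isomorphism-invariant predicates on groups.\<close>

definition coclass_tree :: "nat \<Rightarrow> nat \<Rightarrow> 'a monoid \<Rightarrow> 'a topology \<Rightarrow> 'b monoid \<Rightarrow> bool" where
  "coclass_tree p r S \<tau> G \<longleftrightarrow>
     descendant p r G (S Mod lower_central S \<tau> (tree_root_index p r S \<tau>))"

definition shaved_coclass_tree ::
    "nat \<Rightarrow> nat \<Rightarrow> nat \<Rightarrow> 'a monoid \<Rightarrow> 'a topology \<Rightarrow> 'b monoid \<Rightarrow> bool" where
  "shaved_coclass_tree p r k S \<tau> G \<longleftrightarrow>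
     coclass_tree p r S \<tau> G \<and>
     (\<exists>N i. N \<lhd> G \<and> card N \<le> p ^ k \<and> tree_root_index p r S \<tau> \<le> i \<and>
            G Mod N \<cong> S Mod lower_central S \<tau> i)"


section \<open>Free modules over the p-adic integers\<close>

text \<open>\<open>\<int>\<^sub>p\<close> as the inverse limit of the rings \<open>\<int>/p\<^sup>n\<close>; \<open>z n\<close> is the least non-negative residue of
  \<open>z\<close> modulo \<open>p ^ n\<close>.\<close>

definition padic_integers :: "nat \<Rightarrow> (nat \<Rightarrow> int) ring" where
  "padic_integers p =
     \<lparr>carrier = {z. \<forall>n. 0 \<le> z n \<and> z n < int p ^ n \<and> z (Suc n) mod int p ^ n = z n},
      mult = (\<lambda>x y n. (x n * y n) mod int p ^ n),
      one = (\<lambda>n. 1 mod int p ^ n),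
      zero = (\<lambda>n. 0),
      add = (\<lambda>x y n. (x n + y n) mod int p ^ n)\<rparr>"

text \<open>The canonical \<open>\<int>\<^sub>p\<close>-module on an abelian closed subgroup \<open>T\<close> of a pro-p-group with topology
  \<open>\<tau>\<close>: the action of \<open>z\<close> sends \<open>x\<close> to the limit of the powers \<open>x [^] z n\<close>. The ring multiplication
  and unit of the record are irrelevant for modules.\<close>

definition padic_module :: "'a topology \<Rightarrow> 'a monoid \<Rightarrow> (nat \<Rightarrow> int, 'a) module" where
  "padic_module \<tau> T =
     \<lparr>carrier = carrier T, mult = undefined, one = undefined,
      zero = \<one>\<^bsub>T\<^esub>, add = mult T,
      smult = (\<lambda>z x. THE y. limitin \<tau> (\<lambda>n. x [^]\<^bsub>T\<^esub> z n) y sequentially)\<rparr>"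

definition free_module_of_rank ::
    "('r, 'm) ring_scheme \<Rightarrow> ('r, 'a, 'n) module_scheme \<Rightarrow> nat \<Rightarrow> bool" where
  "free_module_of_rank A M d \<longleftrightarrow>
     Module.module A M \<and>
     (\<exists>e \<in> {..<d} \<rightarrow> carrier M. \<forall>x \<in> carrier M.
        \<exists>!c. c \<in> {..<d} \<rightarrow>\<^sub>E carrier A \<and> x = (\<Oplus>\<^bsub>M\<^esub>i\<in>{..<d}. c i \<odot>\<^bsub>M\<^esub> e i))"


section \<open>Modules for a group\<close>

text \<open>A right \<open>R\<close>-module is given by an abelian group \<open>V\<close>, written multiplicatively, and a function
  \<open>act\<close> where \<open>act v g\<close> is the image of \<open>v\<close> under \<open>g\<close>.\<close>

fun action_series :: "'g monoid \<Rightarrow> 'v monoid \<Rightarrow> ('v \<Rightarrow> 'g \<Rightarrow> 'v) \<Rightarrow> nat \<Rightarrow> 'v set" where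
  "action_series R V act 0 = carrier V"
| "action_series R V act (Suc i) =
     generate V {act v g \<otimes>\<^bsub>V\<^esub> inv\<^bsub>V\<^esub> v | v g. v \<in> action_series R V act i \<and> g \<in> carrier R}"

definition uniserial :: "nat \<Rightarrow> 'g monoid \<Rightarrow> 'v monoid \<Rightarrow> ('v \<Rightarrow> 'g \<Rightarrow> 'v) \<Rightarrow> bool" where
  "uniserial p R V act \<longleftrightarrow>
     (\<forall>i. action_series R V act i \<noteq> {\<one>\<^bsub>V\<^esub>} \<longrightarrow>
        order (V\<lparr>carrier := action_series R V act i\<rparr> Mod action_series R V act (Suc i)) = p)"

text \<open>The action of the quotient \<open>S/T\<close> on an abelian normal subgroup \<open>T\<close> by conjugation; \<open>g\<close> is a
  coset of \<open>T\<close> and the choice of its representative does not matter.\<close>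

definition conj_act :: "'a monoid \<Rightarrow> 'a \<Rightarrow> 'a set \<Rightarrow> 'a" where
  "conj_act S t g = (let s = (SOME s. s \<in> g) in inv\<^bsub>S\<^esub> s \<otimes>\<^bsub>S\<^esub> t \<otimes>\<^bsub>S\<^esub> s)"

definition quot_act :: "('v \<Rightarrow> 'g \<Rightarrow> 'v) \<Rightarrow> 'v set \<Rightarrow> 'g \<Rightarrow> 'v set" where
  "quot_act act v g = (\<lambda>t. act t g) ` v"

definition is_extension ::
    "'e monoid \<Rightarrow> 'g monoid \<Rightarrow> 'v monoid \<Rightarrow> ('v \<Rightarrow> 'g \<Rightarrow> 'v) \<Rightarrow> bool" where
  "is_extension E R V act \<longleftrightarrow>
     (\<exists>\<iota> \<pi>. \<iota> \<in> mon V E \<and> \<pi> \<in> epi E R \<and> kernel E R \<pi> = \<iota> ` carrier V \<and>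
        (\<forall>v \<in> carrier V. \<forall>e \<in> carrier E. inv\<^bsub>E\<^esub> e \<otimes>\<^bsub>E\<^esub> \<iota> v \<otimes>\<^bsub>E\<^esub> e = \<iota> (act v (\<pi> e))))"


section \<open>Cohomology\<close>

definition tuples :: "'g monoid \<Rightarrow> nat \<Rightarrow> 'g list set" where
  "tuples R n = {gs. length gs = n \<and> set gs \<subseteq> carrier R}"

definition cochains :: "'g monoid \<Rightarrow> 'v monoid \<Rightarrow> nat \<Rightarrow> ('g list \<Rightarrow> 'v) monoid" where
  "cochains R V n =
     \<lparr>carrier = tuples R n \<rightarrow>\<^sub>E carrier V,
      mult = (\<lambda>f h. \<lambda>gs\<in>tuples R n. f gs \<otimes>\<^bsub>V\<^esub> h gs),
      one = (\<lambda>gs\<in>tuples R n. \<one>\<^bsub>V\<^esub>)\<rparr>"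

text \<open>The differential for inhomogeneous cochains with values in a right module; additively
  \<open>(\<delta>f)(g\<^sub>1,\<dots>,g\<^sub>n\<^sub>+\<^sub>1) = f(g\<^sub>2,\<dots>,g\<^sub>n\<^sub>+\<^sub>1) + \<Sum>\<^sub>i (-1)\<^sup>i f(\<dots>,g\<^sub>ig\<^sub>i\<^sub>+\<^sub>1,\<dots>) + (-1)\<^sup>n\<^sup>+\<^sup>1 f(g\<^sub>1,\<dots>,g\<^sub>n).g\<^sub>n\<^sub>+\<^sub>1\<close>.\<close>

definition differential ::
    "'g monoid \<Rightarrow> 'v monoid \<Rightarrow> ('v \<Rightarrow> 'g \<Rightarrow> 'v) \<Rightarrow> nat \<Rightarrow> ('g list \<Rightarrow> 'v) \<Rightarrow> 'g list \<Rightarrow> 'v" where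
  "differential R V act n f =
     (\<lambda>gs\<in>tuples R (Suc n).
        f (tl gs) \<otimes>\<^bsub>V\<^esub>
        (\<Otimes>\<^bsub>V\<^esub>i\<in>{1..n}.
           f (take (i - 1) gs @ [gs ! (i - 1) \<otimes>\<^bsub>R\<^esub> gs ! i] @ drop (i + 1) gs)
             [^]\<^bsub>V\<^esub> ((- 1) ^ i :: int)) \<otimes>\<^bsub>V\<^esub>
        act (f (butlast gs)) (last gs) [^]\<^bsub>V\<^esub> ((- 1) ^ Suc n :: int))"

definition cocycles ::
    "'g monoid \<Rightarrow> 'v monoid \<Rightarrow> ('v \<Rightarrow> 'g \<Rightarrow> 'v) \<Rightarrow> nat \<Rightarrow> ('g list \<Rightarrow> 'v) set" where
  "cocycles R V act n =
     {f \<in> carrier (cochains R V n). differential R V act n f = \<one>\<^bsub>cochains R V (Suc n)\<^esub>}"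

fun coboundaries ::
    "'g monoid \<Rightarrow> 'v monoid \<Rightarrow> ('v \<Rightarrow> 'g \<Rightarrow> 'v) \<Rightarrow> nat \<Rightarrow> ('g list \<Rightarrow> 'v) set" where
  "coboundaries R V act 0 = {\<one>\<^bsub>cochains R V 0\<^esub>}"
| "coboundaries R V act (Suc n) = differential R V act n ` carrier (cochains R V n)"

definition cohomology ::
    "'g monoid \<Rightarrow> 'v monoid \<Rightarrow> ('v \<Rightarrow> 'g \<Rightarrow> 'v) \<Rightarrow> nat \<Rightarrow> ('g list \<Rightarrow> 'v) set monoid" where
  "cohomology R V act n =
     (cochains R V n)\<lparr>carrier := cocycles R V act n\<rparr> Mod coboundaries R V act n"

definition coh_class ::
    "'g monoid \<Rightarrow> 'v monoid \<Rightarrow> ('v \<Rightarrow> 'g \<Rightarrow> 'v) \<Rightarrow> nat \<Rightarrow> ('g list \<Rightarrow> 'v) \<Rightarrow> ('g list \<Rightarrow> 'v) set" where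
  "coh_class R V act n f = coboundaries R V act n #>\<^bsub>cochains R V n\<^esub> f"

text \<open>The map \<open>H\<^sup>n(R,V) \<rightarrow> H\<^sup>n(R,W)\<close> induced by a module homomorphism \<open>\<phi>\<close> into \<open>W\<close>, where \<open>act\<close> is
  the action on \<open>W\<close>. Classes are sets of cocycles.\<close>

definition coh_map ::
    "'g monoid \<Rightarrow> 'w monoid \<Rightarrow> ('w \<Rightarrow> 'g \<Rightarrow> 'w) \<Rightarrow> nat \<Rightarrow> ('v \<Rightarrow> 'w) \<Rightarrow>
     ('g list \<Rightarrow> 'v) set \<Rightarrow> ('g list \<Rightarrow> 'w) set" where
  "coh_map R W act n \<phi> c =
     the_elem ((\<lambda>f. coh_class R W act n (\<lambda>gs\<in>tuples R n. \<phi> (f gs))) ` c)"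

definition group_exponent :: "'a monoid \<Rightarrow> nat" where
  "group_exponent G = (LEAST e. 0 < e \<and> (\<forall>x \<in> carrier G. x [^]\<^bsub>G\<^esub> e = \<one>\<^bsub>G\<^esub>))"


section \<open>Compatible pairs\<close>

definition Comp ::
    "'g monoid \<Rightarrow> 'v monoid \<Rightarrow> ('v \<Rightarrow> 'g \<Rightarrow> 'v) \<Rightarrow> (('g \<Rightarrow> 'g) \<times> ('v \<Rightarrow> 'v)) monoid" where
  "Comp R V act =
     (AutoGroup R \<times>\<times> AutoGroup V)
       \<lparr>carrier := {(\<beta>, \<epsilon>). \<beta> \<in> auto R \<and> \<epsilon> \<in> auto V \<and>
          (\<forall>v \<in> carrier V. \<forall>g \<in> carrier R. \<epsilon> (act v g) = act (\<epsilon> v) (\<beta> g))}\<rparr>"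

definition comp_cochain ::
    "'g monoid \<Rightarrow> nat \<Rightarrow> ('g \<Rightarrow> 'g) \<times> ('v \<Rightarrow> 'v) \<Rightarrow> ('g list \<Rightarrow> 'v) \<Rightarrow> 'g list \<Rightarrow> 'v" where
  "comp_cochain R n = (\<lambda>(\<beta>, \<epsilon>) f. \<lambda>gs\<in>tuples R n. \<epsilon> (f (map (inv_into (carrier R) \<beta>) gs)))"

text \<open>A compatible pair permutes the cocycles and the coboundaries, hence it maps a coset of the
  group of coboundaries onto such a coset.\<close>

definition comp_action ::
    "'g monoid \<Rightarrow> 'v monoid \<Rightarrow> ('v \<Rightarrow> 'g \<Rightarrow> 'v) \<Rightarrow> ('g \<Rightarrow> 'g) \<times> ('v \<Rightarrow> 'v) \<Rightarrow>
     ('g list \<Rightarrow> 'v) set \<Rightarrow> ('g list \<Rightarrow> 'v) set" where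
  "comp_action R V act b = (\<lambda>c \<in> carrier (cohomology R V act 2). comp_cochain R 2 b ` c)"

definition comp_orbits ::
    "'g monoid \<Rightarrow> 'v monoid \<Rightarrow> ('v \<Rightarrow> 'g \<Rightarrow> 'v) \<Rightarrow> ('g list \<Rightarrow> 'v) set set set" where
  "comp_orbits R V act =
     orbits (Comp R V act) (carrier (cohomology R V act 2)) (comp_action R V act)"


section \<open>The map \<open>id \<oplus> \<mu>\<close>\<close>

text \<open>Throughout, \<open>T\<close> is an \<open>R\<close>-module with action \<open>act\<close>, and \<open>T\<^sub>n\<close> is the \<open>n\<close>-th term of its
  lower \<open>R\<close>-central series.\<close>

abbreviation sub_term :: "'g monoid \<Rightarrow> 'v monoid \<Rightarrow> ('v \<Rightarrow> 'g \<Rightarrow> 'v) \<Rightarrow> nat \<Rightarrow> 'v monoid" where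
  "sub_term R T act n \<equiv> T\<lparr>carrier := action_series R T act n\<rparr>"

abbreviation quot_term :: "'g monoid \<Rightarrow> 'v monoid \<Rightarrow> ('v \<Rightarrow> 'g \<Rightarrow> 'v) \<Rightarrow> nat \<Rightarrow> 'v set monoid" where
  "quot_term R T act n \<equiv> T Mod action_series R T act n"

abbreviation H2_quot ::
    "'g monoid \<Rightarrow> 'v monoid \<Rightarrow> ('v \<Rightarrow> 'g \<Rightarrow> 'v) \<Rightarrow> nat \<Rightarrow> ('g list \<Rightarrow> 'v set) set monoid" where
  "H2_quot R T act n \<equiv> cohomology R (quot_term R T act n) (quot_act act) 2"

text \<open>The connecting homomorphism \<open>H\<^sup>2(R,T/T\<^sub>n) \<rightarrow> H\<^sup>3(R,T\<^sub>n)\<close>.\<close>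

definition connecting ::
    "'g monoid \<Rightarrow> 'v monoid \<Rightarrow> ('v \<Rightarrow> 'g \<Rightarrow> 'v) \<Rightarrow> nat \<Rightarrow>
     ('g list \<Rightarrow> 'v set) set \<Rightarrow> ('g list \<Rightarrow> 'v) set" where
  "connecting R T act n c =
     the_elem {coh_class R (sub_term R T act n) act 3 (differential R T act 2 f) | f.
       f \<in> carrier (cochains R T 2) \<and>
       (\<lambda>gs\<in>tuples R 2. action_series R T act n #>\<^bsub>T\<^esub> f gs) \<in> c}"

definition split_exponent :: "'g monoid \<Rightarrow> 'v monoid \<Rightarrow> ('v \<Rightarrow> 'g \<Rightarrow> 'v) \<Rightarrow> nat \<Rightarrow> nat" where
  "split_exponent R T act n =
     max (group_exponent (cohomology R T act 2))
         (group_exponent (cohomology R (sub_term R T act n) act 3))"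

text \<open>\<open>a\<^sup>-\<^sup>1T\<^sub>n\<close> where \<open>a = split_exponent R T act n\<close>. This is the intersection of \<open>T\<close> with
  \<open>a\<^sup>-\<^sup>1T\<^sub>n \<le> T \<otimes> \<rat>\<close>; for large \<open>n\<close> the latter is contained in \<open>T\<close>.\<close>

definition divided_term :: "'g monoid \<Rightarrow> 'v monoid \<Rightarrow> ('v \<Rightarrow> 'g \<Rightarrow> 'v) \<Rightarrow> nat \<Rightarrow> 'v set" where
  "divided_term R T act n =
     {t \<in> carrier T. t [^]\<^bsub>T\<^esub> split_exponent R T act n \<in> action_series R T act n}"

text \<open>The image of \<open>H\<^sup>2(R,a\<^sup>-\<^sup>1T\<^sub>n/T\<^sub>n)\<close> in \<open>H\<^sup>2(R,T/T\<^sub>n)\<close>. The inclusion of \<open>a\<^sup>-\<^sup>1T\<^sub>n/T\<^sub>n\<close> into \<open>T/T\<^sub>n\<close>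
  is the identity on cosets.\<close>

definition divided_image ::
    "'g monoid \<Rightarrow> 'v monoid \<Rightarrow> ('v \<Rightarrow> 'g \<Rightarrow> 'v) \<Rightarrow> nat \<Rightarrow> ('g list \<Rightarrow> 'v set) set set" where
  "divided_image R T act n =
     coh_map R (quot_term R T act n) (quot_act act) 2 (\<lambda>v. v) `
       carrier (cohomology R
         (T\<lparr>carrier := divided_term R T act n\<rparr> Mod action_series R T act n) (quot_act act) 2)"

text \<open>The canonical isomorphism \<open>H\<^sup>2(R,T) \<oplus> H\<^sup>3(R,T\<^sub>n) \<rightarrow> H\<^sup>2(R,T/T\<^sub>n)\<close> (for large \<open>n\<close>).\<close>

definition assemble ::
    "'g monoid \<Rightarrow> 'v monoid \<Rightarrow> ('v \<Rightarrow> 'g \<Rightarrow> 'v) \<Rightarrow> nat \<Rightarrow>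
     ('g list \<Rightarrow> 'v) set \<times> ('g list \<Rightarrow> 'v) set \<Rightarrow> ('g list \<Rightarrow> 'v set) set" where
  "assemble R T act n = (\<lambda>(\<alpha>, \<beta>).
     coh_map R (quot_term R T act n) (quot_act act) 2
       (\<lambda>t. action_series R T act n #>\<^bsub>T\<^esub> t) \<alpha>
     \<otimes>\<^bsub>H2_quot R T act n\<^esub>
     (THE c. c \<in> divided_image R T act n \<and> connecting R T act n c = \<beta>))"

definition id_plus_mu ::
    "nat \<Rightarrow> nat \<Rightarrow> 'g monoid \<Rightarrow> 'v monoid \<Rightarrow> ('v \<Rightarrow> 'g \<Rightarrow> 'v) \<Rightarrow> nat \<Rightarrow>
     ('g list \<Rightarrow> 'v set) set \<Rightarrow> ('g list \<Rightarrow> 'v set) set" where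
  "id_plus_mu p d R T act n c =
     (let (\<alpha>, \<beta>) = inv_into (carrier (cohomology R T act 2) \<times>
                             carrier (cohomology R (sub_term R T act n) act 3))
                            (assemble R T act n) c
      in assemble R T act (n + d)
           (\<alpha>, coh_map R (sub_term R T act (n + d)) act 3 (\<lambda>t. t [^]\<^bsub>T\<^esub> p) \<beta>))"

end

theory Submission
  imports Defs "HOL-Algebra.Multiplicative_Group"
begin

text \<open>Let \<open>q = |R|\<close> and regard \<open>T\<close> as an additive group \<open>V\<close>. Averaging over \<open>R\<close> shows that every
  2-cocycle with values in \<open>T/T\<^sub>n\<close> is the reduction of \<open>\<gamma> + \<delta>\<close> with a cocycle \<open>\<gamma>\<close> in \<open>T\<close> and a cochain
  \<open>\<delta>\<close> in \<open>q\<^sup>-\<^sup>1T\<^sub>n\<close>, and then \<open>id \<oplus> \<mu>\<close> sends the class of \<open>\<gamma> + \<delta>\<close> to the class of \<open>\<gamma> + p\<delta>\<close>. Likewise,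
  since \<open>T\<close> is free over \<open>\<int>\<^sub>p\<close>, every compatible pair for \<open>T/T\<^sub>n\<close> lifts to an additive map
  \<open>\<epsilon> + \<kappa>\<close> of \<open>T\<close> with \<open>\<epsilon>\<close> exactly compatible and \<open>\<kappa>\<close> with values in \<open>q\<^sup>-\<^sup>1T\<^sub>n\<close>, and \<open>\<epsilon> + p\<kappa>\<close> is
  a compatible pair for \<open>T/T\<^sub>n\<^sub>+\<^sub>d\<close>. As \<open>\<kappa>\<close> maps \<open>q\<^sup>-\<^sup>1T\<^sub>n\<close> into \<open>T\<^sub>n\<close> for large \<open>n\<close>, the image of
  \<open>(\<epsilon> + \<kappa>)(\<gamma> + \<delta>)\<close> under \<open>id \<oplus> \<mu>\<close> is the class of \<open>(\<epsilon> + p\<kappa>)(\<gamma> + p\<delta>)\<close>. Both constructions are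
  reversible, because \<open>T\<^sub>n\<^sub>+\<^sub>d = pT\<^sub>n\<close>; this identity follows from uniseriality, as every invariant
  subgroup of index a power of \<open>p\<close> is some \<open>T\<^sub>i\<close>.\<close>


section \<open>Additive subgroups and additive maps\<close>

text \<open>Two obstacles shape the proof. \<open>id_plus_mu\<close> is defined by an inverse image,
  a definite description and an exponent a that is taken anew for each n.
  \<open>id_plus_mu_clA\<close> replaces this by the formula \<gamma> + \<delta> \<mapsto> \<gamma>
  + p\<delta>, with q in place of a; everything about orbits rests on that formula. Also, T is a
  multiplicatively written group without a type class. It is therefore copied into the additive
  group of a commutative ring type whose multiplication serves only to write signs and integer
  multiples, so that boundaries become ring terms.

  "Sufficiently large" means that T_n lies in p q q T (and n \<ge> 1). One factor q allows T_n to be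
  divided by q after averaging. The second makes every element of q^(-1) T_n divisible by q in T;
  hence cocycles with values in q^(-1) T_n are coboundaries in T, and \<kappa> maps q^(-1) T_n into
  T_n. The factor p places q^(-1) T_n inside T_1, so that exchanging \<kappa> and p\<kappa> does not
  affect surjectivity modulo T_1, which is what decides whether a lifted map is invertible modulo
  T_n.\<close>

definition add_subgroup :: "'v::ab_group_add set \<Rightarrow> bool" where
  "add_subgroup X \<longleftrightarrow> 0 \<in> X \<and> (\<forall>x\<in>X. \<forall>y\<in>X. x - y \<in> X)"

lemma add_subgroup_zero: "add_subgroup X \<Longrightarrow> 0 \<in> X"
  and add_subgroup_diff: "add_subgroup X \<Longrightarrow> x \<in> X \<Longrightarrow> y \<in> X \<Longrightarrow> x - y \<in> X"
  by (auto simp: add_subgroup_def)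

lemma add_subgroup_uminus: "add_subgroup X \<Longrightarrow> x \<in> X \<Longrightarrow> - x \<in> X"
  using add_subgroup_diff[of X 0 x] by (simp add: add_subgroup_zero)

lemma add_subgroup_add: "add_subgroup X \<Longrightarrow> x \<in> X \<Longrightarrow> y \<in> X \<Longrightarrow> x + y \<in> X"
  using add_subgroup_diff[of X x "- y"] by (simp add: add_subgroup_uminus)

lemma add_subgroup_sum: "add_subgroup X \<Longrightarrow> (\<And>i. i \<in> I \<Longrightarrow> f i \<in> X) \<Longrightarrow> sum f I \<in> X"
  by (induction I rule: infinite_finite_induct)
    (auto intro: add_subgroup_zero add_subgroup_add)

lemma add_subgroup_of_nat_mult:
  "add_subgroup X \<Longrightarrow> x \<in> X \<Longrightarrow> of_nat n * (x::'v::comm_ring_1) \<in> X"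
  by (induction n) (auto simp: algebra_simps intro: add_subgroup_zero add_subgroup_add)

lemma add_subgroup_sign_mult:
  "add_subgroup X \<Longrightarrow> x \<in> X \<Longrightarrow> (- 1) ^ n * (x::'v::comm_ring_1) \<in> X"
  by (induction n) (auto intro: add_subgroup_uminus)

lemma add_subgroup_cong:
  "add_subgroup X \<Longrightarrow> x - y \<in> X \<Longrightarrow> x \<in> X \<longleftrightarrow> y \<in> X"
  using add_subgroup_add[of X "x - y" y] add_subgroup_diff[of X x "x - y"] by auto

lemmas add_subgroup_intros = add_subgroup_zero add_subgroup_diff add_subgroup_uminus
  add_subgroup_add add_subgroup_sum add_subgroup_of_nat_mult add_subgroup_sign_mult

lemma add_subgroup_trivial: "add_subgroup {0}"
  by (simp add: add_subgroup_def)

definition additive_on :: "'v::ab_group_add set \<Rightarrow> ('v \<Rightarrow> 'w::ab_group_add) \<Rightarrow> bool" where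
  "additive_on X f \<longleftrightarrow> (\<forall>x\<in>X. \<forall>y\<in>X. f (x + y) = f x + f y)"

lemma additive_on_add:
  "additive_on X f \<Longrightarrow> x \<in> X \<Longrightarrow> y \<in> X \<Longrightarrow> f (x + y) = f x + f y"
  by (simp add: additive_on_def)

context
  fixes X :: "'v::comm_ring_1 set" and f :: "'v \<Rightarrow> 'w::comm_ring_1"
  assumes X: "add_subgroup X" and f: "additive_on X f"
begin

lemma additive_on_zero: "f 0 = 0"
  using additive_on_add[OF f, of 0 0] X by (simp add: add_subgroup_zero)

lemma additive_on_uminus: "x \<in> X \<Longrightarrow> f (- x) = - f x"
  using additive_on_add[OF f, of x "- x"] X additive_on_zero
  by (simp add: add_subgroup_uminus add_eq_0_iff)

lemma additive_on_diff: "x \<in> X \<Longrightarrow> y \<in> X \<Longrightarrow> f (x - y) = f x - f y"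
  using additive_on_add[OF f, of x "- y"] X additive_on_uminus
  by (simp add: add_subgroup_uminus)

lemma additive_on_sum: "(\<And>i. i \<in> I \<Longrightarrow> g i \<in> X) \<Longrightarrow> f (sum g I) = (\<Sum>i\<in>I. f (g i))"
proof (induction I rule: infinite_finite_induct)
  case (insert i I)
  then have "f (sum g (insert i I)) = f (g i + sum g I)" by simp
  also have "\<dots> = f (g i) + f (sum g I)"
    using insert X by (intro additive_on_add[OF f] add_subgroup_sum) auto
  finally show ?case using insert by simp
qed (auto simp: additive_on_zero)

lemma additive_on_of_nat_mult: "x \<in> X \<Longrightarrow> f (of_nat n * x) = of_nat n * f x"
proof (induction n)
  case (Suc n)
  then show ?case
    using additive_on_add[OF f, of x "of_nat n * x"] add_subgroup_of_nat_mult[OF X, of x n]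
    by (simp add: distrib_right)
qed (simp add: additive_on_zero)

lemma additive_on_sign_mult: "x \<in> X \<Longrightarrow> f ((- 1) ^ n * x) = (- 1) ^ n * f x"
  by (induction n) (auto simp: additive_on_uminus add_subgroup_sign_mult[OF X])

end

lemma additive_on_image:
  fixes f :: "'v::comm_ring_1 \<Rightarrow> 'w::comm_ring_1"
  assumes "add_subgroup X" "additive_on X f" "add_subgroup U" "U \<subseteq> X"
  shows "add_subgroup (f ` U)"
  unfolding add_subgroup_def
proof (intro conjI ballI)
  show "0 \<in> f ` U"
    using additive_on_zero[OF assms(1,2)] add_subgroup_zero[OF assms(3)] by force
  fix x y assume "x \<in> f ` U" "y \<in> f ` U"
  then obtain u v where uv: "u \<in> U" "x = f u" "v \<in> U" "y = f v" by auto
  then have "x - y = f (u - v)"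
    using additive_on_diff[OF assms(1,2), of u v] subsetD[OF assms(4)] by simp
  then show "x - y \<in> f ` U"
    using uv add_subgroup_diff[OF assms(3)] by blast
qed


section \<open>Cochains with values in an additive group\<close>

abbreviation merge :: "'g monoid \<Rightarrow> nat \<Rightarrow> 'g list \<Rightarrow> 'g list" where
  "merge R i gs \<equiv> take (i - 1) gs @ [gs ! (i - 1) \<otimes>\<^bsub>R\<^esub> gs ! i] @ drop (i + 1) gs"

lemma tuples_SucD:
  assumes "gs \<in> tuples R (Suc n)"
  shows "tl gs \<in> tuples R n" "butlast gs \<in> tuples R n" "last gs \<in> carrier R"
proof -
  have "gs \<noteq> []" using assms by (auto simp: tuples_def)
  then show "tl gs \<in> tuples R n" "butlast gs \<in> tuples R n" "last gs \<in> carrier R"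
    using assms by (auto simp: tuples_def dest: list.set_sel(2) in_set_butlastD)
qed

lemma tuples_nth: "gs \<in> tuples R n \<Longrightarrow> i < n \<Longrightarrow> gs ! i \<in> carrier R"
  by (auto simp: tuples_def)

lemma tuples_merge:
  assumes "monoid R" "gs \<in> tuples R (Suc n)" "i \<in> {1..n}"
  shows "merge R i gs \<in> tuples R n"
proof -
  have "gs ! (i - 1) \<otimes>\<^bsub>R\<^esub> gs ! i \<in> carrier R"
    using assms tuples_nth[OF assms(2)] by (intro monoid.m_closed) auto
  then show ?thesis
    using assms by (auto simp: tuples_def dest: in_set_takeD in_set_dropD)
qed

lemma tuples_map:
  assumes "\<sigma> \<in> carrier R \<rightarrow> carrier R" "gs \<in> tuples R n"
  shows "map \<sigma> gs \<in> tuples R n"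
  using assms by (auto simp: tuples_def)

lemma tuples_Cons: "x # gs \<in> tuples R (Suc n) \<longleftrightarrow> x \<in> carrier R \<and> gs \<in> tuples R n"
  by (auto simp: tuples_def)

text \<open>The additive form of \<open>differential\<close>. Values outside \<open>tuples\<close>
  are not normalised, so a boundary is a plain ring term; facts such as linearity are stated on
  \<open>tuples\<close>.\<close>

definition bdry ::
    "'g monoid \<Rightarrow> ('v \<Rightarrow> 'g \<Rightarrow> 'v) \<Rightarrow> nat \<Rightarrow> ('g list \<Rightarrow> 'v) \<Rightarrow> 'g list \<Rightarrow> 'v::comm_ring_1"
  where
  "bdry R A n F gs =
     F (tl gs) + (\<Sum>i\<in>{1..n}. (- 1) ^ i * F (merge R i gs)) +
     (- 1) ^ Suc n * A (F (butlast gs)) (last gs)"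

definition valued :: "'g monoid \<Rightarrow> nat \<Rightarrow> 'v set \<Rightarrow> ('g list \<Rightarrow> 'v) \<Rightarrow> bool" where
  "valued R n X F \<longleftrightarrow> (\<forall>gs \<in> tuples R n. F gs \<in> X)"

lemma valuedD: "valued R n X F \<Longrightarrow> gs \<in> tuples R n \<Longrightarrow> F gs \<in> X"
  by (simp add: valued_def)

lemma valued_mono: "valued R n X F \<Longrightarrow> X \<subseteq> Y \<Longrightarrow> valued R n Y F"
  by (auto simp: valued_def)

lemma bdry_1: "bdry R A 1 F [g, h] = F [h] - F [g \<otimes>\<^bsub>R\<^esub> h] + A (F [g]) h"
  by (simp add: bdry_def)

lemma bdry_2:
  "bdry R A 2 F [g, h, k] =
     F [h, k] - F [g \<otimes>\<^bsub>R\<^esub> h, k] + F [g, h \<otimes>\<^bsub>R\<^esub> k] - A (F [g, h]) k"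
proof -
  have "{1..2::nat} = {1, 2}" by auto
  then show ?thesis by (simp add: bdry_def)
qed

lemma bdry_3:
  "bdry R A 3 F [g, h, k, l] =
     F [h, k, l] - F [g \<otimes>\<^bsub>R\<^esub> h, k, l] + F [g, h \<otimes>\<^bsub>R\<^esub> k, l] - F [g, h, k \<otimes>\<^bsub>R\<^esub> l]
       + A (F [g, h, k]) l"
proof -
  have "{1..3::nat} = {1, 2, 3}" by auto
  then show ?thesis by (simp add: bdry_def numeral_3_eq_3)
qed

lemma tuples_2E: "gs \<in> tuples R 2 \<Longrightarrow> (\<And>g h. g \<in> carrier R \<Longrightarrow> h \<in> carrier R \<Longrightarrow> gs = [g, h] \<Longrightarrow> P) \<Longrightarrow> P"
  by (auto simp: tuples_def length_Suc_conv numeral_2_eq_2)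

lemma tuples_3E:
  "gs \<in> tuples R 3 \<Longrightarrow>
    (\<And>g h k. g \<in> carrier R \<Longrightarrow> h \<in> carrier R \<Longrightarrow> k \<in> carrier R \<Longrightarrow> gs = [g, h, k] \<Longrightarrow> P) \<Longrightarrow> P"
  by (auto simp: tuples_def length_Suc_conv numeral_3_eq_3)

lemma tuples_4E:
  "gs \<in> tuples R 4 \<Longrightarrow>
    (\<And>g h k l. g \<in> carrier R \<Longrightarrow> h \<in> carrier R \<Longrightarrow> k \<in> carrier R \<Longrightarrow> l \<in> carrier R \<Longrightarrow>
       gs = [g, h, k, l] \<Longrightarrow> P) \<Longrightarrow> P"
  by (auto simp: tuples_def length_Suc_conv eval_nat_numeral)

text \<open>V is the working copy of T. Coefficient modules will be quotients of invariant subgroups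
  of V, so that all cochains take values in V and a modulus appears as a subset of V.\<close>

locale additive_rep = group R
  for R :: "'g monoid" (structure) +
  fixes V :: "'v::comm_ring_1 set" and A :: "'v \<Rightarrow> 'g \<Rightarrow> 'v"
  assumes V: "add_subgroup V"
    and A_closed: "x \<in> V \<Longrightarrow> g \<in> carrier R \<Longrightarrow> A x g \<in> V"
    and A_additive: "g \<in> carrier R \<Longrightarrow> additive_on V (\<lambda>x. A x g)"
    and A_mult: "x \<in> V \<Longrightarrow> g \<in> carrier R \<Longrightarrow> h \<in> carrier R \<Longrightarrow> A x (g \<otimes> h) = A (A x g) h"
    and A_one: "x \<in> V \<Longrightarrow> A x \<one> = x"
begin

abbreviation val :: "nat \<Rightarrow> 'v set \<Rightarrow> ('g list \<Rightarrow> 'v) \<Rightarrow> bool" where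
  "val \<equiv> valued R"

abbreviation D :: "nat \<Rightarrow> ('g list \<Rightarrow> 'v) \<Rightarrow> 'g list \<Rightarrow> 'v" where
  "D \<equiv> bdry R A"

lemmas A_add = additive_on_add[OF A_additive]
lemmas A_zero = additive_on_zero[OF V A_additive]
lemmas A_diff = additive_on_diff[OF V A_additive]
lemmas A_of_nat_mult = additive_on_of_nat_mult[OF V A_additive]
lemmas A_sum = additive_on_sum[OF V A_additive]

definition invariant :: "'v set \<Rightarrow> bool" where
  "invariant X \<longleftrightarrow> (\<forall>x\<in>X. \<forall>g\<in>carrier R. A x g \<in> X)"

lemma invariantD: "invariant X \<Longrightarrow> x \<in> X \<Longrightarrow> g \<in> carrier R \<Longrightarrow> A x g \<in> X"
  by (simp add: invariant_def)

lemma invariant_V: "invariant V"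
  by (simp add: invariant_def A_closed)

lemma D_valued:
  assumes "add_subgroup X" "invariant X" "val n X F"
  shows "val (Suc n) X (D n F)"
  unfolding valued_def bdry_def
  by (intro ballI add_subgroup_intros assms valuedD[OF assms(3)] invariantD[OF assms(2)]
        tuples_merge tuples_SucD is_monoid) auto

lemma D_add:
  assumes "val n V F" "val n V G" "gs \<in> tuples R (Suc n)"
  shows "D n (\<lambda>gs. F gs + G gs) gs = D n F gs + D n G gs"
  unfolding bdry_def
  by (simp add: A_add[OF _ valuedD[OF assms(1)] valuedD[OF assms(2)]] tuples_SucD[OF assms(3)]
      algebra_simps sum.distrib)

lemma D_diff:
  assumes "val n V F" "val n V G" "gs \<in> tuples R (Suc n)"
  shows "D n (\<lambda>gs. F gs - G gs) gs = D n F gs - D n G gs"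
  unfolding bdry_def
  by (simp add: A_diff[OF _ valuedD[OF assms(1)] valuedD[OF assms(2)]] tuples_SucD[OF assms(3)]
      algebra_simps sum_subtractf)

lemma D_of_nat_mult:
  assumes "val n V F" "gs \<in> tuples R (Suc n)"
  shows "D n (\<lambda>gs. of_nat m * F gs) gs = of_nat m * D n F gs"
  unfolding bdry_def
  by (simp add: A_of_nat_mult[OF _ valuedD[OF assms(1)]] tuples_SucD[OF assms(2)]
      algebra_simps sum_distrib_left)

lemma D_zero: "gs \<in> tuples R (Suc n) \<Longrightarrow> D n (\<lambda>gs. 0) gs = 0"
  unfolding bdry_def by (simp add: A_zero tuples_SucD)

lemma D_cong:
  assumes "\<And>gs. gs \<in> tuples R n \<Longrightarrow> F gs = G gs" "gs \<in> tuples R (Suc n)"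
  shows "D n F gs = D n G gs"
  unfolding bdry_def
  using tuples_SucD[OF assms(2)] tuples_merge[OF is_monoid assms(2)]
  by (auto simp: assms(1) intro!: sum.cong)

text \<open>The action enters only the last term of the boundary; all other terms commute with an
  additive map E and a homomorphism \<sigma>. With U = {0} this is functoriality for equivariant
  maps, with U = T_n it controls maps that are equivariant modulo T_n.\<close>

lemma D_map:
  assumes \<sigma>: "\<sigma> \<in> hom R R" and E: "additive_on V E"
    and U: "add_subgroup U" "\<And>x g. x \<in> V \<Longrightarrow> g \<in> carrier R \<Longrightarrow> E (A x (\<sigma> g)) - A (E x) g \<in> U"
    and F: "val n V F" and gs: "gs \<in> tuples R (Suc n)"
  shows "D n (\<lambda>gs. E (F (map \<sigma> gs))) gs - E (D n F (map \<sigma> gs)) \<in> U"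
proof -
  have \<sigma>': "\<sigma> \<in> carrier R \<rightarrow> carrier R" using \<sigma> by (simp add: hom_def)
  have mgs: "map \<sigma> gs \<in> tuples R (Suc n)" using \<sigma>' gs by (rule tuples_map)
  have len: "length gs = Suc n" and ne: "gs \<noteq> []" using gs by (auto simp: tuples_def)
  have merge_map: "merge R i (map \<sigma> gs) = map \<sigma> (merge R i gs)" if "i \<in> {1..n}" for i
    using that len \<sigma> tuples_nth[OF gs] by (auto simp: take_map drop_map hom_def)
  let ?S = "\<lambda>gs. \<Sum>i\<in>{1..n}. (- 1) ^ i * F (merge R i gs)"
  have FV: "F (tl (map \<sigma> gs)) \<in> V" "F (butlast (map \<sigma> gs)) \<in> V"
    "\<And>i. i \<in> {1..n} \<Longrightarrow> F (merge R i (map \<sigma> gs)) \<in> V"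
    using valuedD[OF F] tuples_SucD[OF mgs] tuples_merge[OF is_monoid mgs] by auto
  have last: "last (map \<sigma> gs) \<in> carrier R" using tuples_SucD[OF mgs] by simp
  have SV: "?S (map \<sigma> gs) \<in> V"
    using FV by (intro add_subgroup_sum V add_subgroup_sign_mult) auto
  have "E (D n F (map \<sigma> gs)) =
      E (F (tl (map \<sigma> gs))) + E (?S (map \<sigma> gs)) +
      (- 1) ^ Suc n * E (A (F (butlast (map \<sigma> gs))) (last (map \<sigma> gs)))"
    unfolding bdry_def using SV FV last
    by (simp add: additive_on_add[OF E] additive_on_sign_mult[OF V E] additive_on_uminus[OF V E]
        add_subgroup_intros[OF V] A_closed del: power_Suc)
  also have "E (?S (map \<sigma> gs)) = (\<Sum>i\<in>{1..n}. (- 1) ^ i * E (F (merge R i (map \<sigma> gs))))"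
    using FV
    by (subst additive_on_sum[OF V E])
      (auto simp: additive_on_sign_mult[OF V E] intro!: add_subgroup_sign_mult V sum.cong)
  also have "\<dots> = (\<Sum>i\<in>{1..n}. (- 1) ^ i * E (F (map \<sigma> (merge R i gs))))"
    by (intro sum.cong refl) (simp only: merge_map)
  finally have "D n (\<lambda>gs. E (F (map \<sigma> gs))) gs - E (D n F (map \<sigma> gs)) =
      - ((- 1) ^ Suc n * (E (A (F (map \<sigma> (butlast gs))) (\<sigma> (last gs)))
        - A (E (F (map \<sigma> (butlast gs)))) (last gs)))"
    unfolding bdry_def using ne by (simp add: map_tl map_butlast last_map algebra_simps)
  also have "\<dots> \<in> U"
    using FV(2) tuples_SucD(3)[OF gs]
    by (intro add_subgroup_intros U) (auto simp: map_butlast)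
  finally show ?thesis .
qed

lemma D_D_1:
  assumes "val 1 V F" "gs \<in> tuples R 3"
  shows "D 2 (D 1 F) gs = 0"
  using assms(2)
proof (rule tuples_3E)
  fix g h k assume c: "g \<in> carrier R" "h \<in> carrier R" "k \<in> carrier R" and gs: "gs = [g, h, k]"
  have F: "\<And>x. x \<in> carrier R \<Longrightarrow> F [x] \<in> V"
    using assms(1) by (simp add: valued_def tuples_def)
  show ?thesis
    unfolding gs bdry_1 bdry_2 using c
    by (simp add: F A_add A_diff A_closed add_subgroup_intros[OF V] A_mult m_assoc)
qed

lemma D_D_2:
  assumes "val 2 V F" "gs \<in> tuples R 4"
  shows "D 3 (D 2 F) gs = 0"
  using assms(2)
proof (rule tuples_4E)
  fix g h k l assume c: "g \<in> carrier R" "h \<in> carrier R" "k \<in> carrier R" "l \<in> carrier R"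
    and gs: "gs = [g, h, k, l]"
  have F: "\<And>x y. x \<in> carrier R \<Longrightarrow> y \<in> carrier R \<Longrightarrow> F [x, y] \<in> V"
    using assms(1) by (simp add: valued_def tuples_def)
  show ?thesis
    unfolding gs bdry_2 bdry_3 using c
    by (simp add: F A_add A_diff A_closed add_subgroup_intros[OF V] A_mult m_assoc)
qed

lemma sum_left_translate:
  assumes "finite (carrier R)" "g \<in> carrier R"
  shows "(\<Sum>x\<in>carrier R. f (x \<otimes> g)) = (\<Sum>x\<in>carrier R. f x)"
  by (rule sum.reindex_bij_witness[where i = "\<lambda>x. x \<otimes> inv g" and j = "\<lambda>x. x \<otimes> g"])
    (use assms in \<open>auto simp: m_assoc\<close>)

text \<open>Summing the boundary over its first argument is the usual contraction that shows that the
  group order annihilates cohomology in positive degrees.\<close>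

definition transfer :: "('g list \<Rightarrow> 'v) \<Rightarrow> 'g list \<Rightarrow> 'v" where
  "transfer F gs = (\<Sum>x\<in>carrier R. F (x # gs))"

lemma transfer_valued:
  assumes "add_subgroup X" "val (Suc n) X F"
  shows "val n X (transfer F)"
  unfolding transfer_def valued_def
  using assms by (auto intro!: add_subgroup_sum simp: valued_def tuples_Cons)

text \<open>Sum \<open>D 2 F [x, g, h]\<close> over x. The first term does not depend on x and gives
  the factor \<open>order R\<close>; the substitution of x for xg in the second makes the three
  other terms equal to \<open>- D 1 (transfer F) [g, h]\<close>. The action is on the last argument
  and commutes with the sum.\<close>

lemma transfer_2:
  assumes fin: "finite (carrier R)" and "val 2 V F" "gs \<in> tuples R 2"
  shows "of_nat (order R) * F gs = D 1 (transfer F) gs + transfer (D 2 F) gs"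
  using assms(3)
proof (rule tuples_2E)
  fix g h assume c: "g \<in> carrier R" "h \<in> carrier R" and gs: "gs = [g, h]"
  have F: "\<And>x y. x \<in> carrier R \<Longrightarrow> y \<in> carrier R \<Longrightarrow> F [x, y] \<in> V"
    using assms(2) by (simp add: valued_def tuples_def)
  show ?thesis
    unfolding gs bdry_1 transfer_def bdry_2 using c
    by (simp add: sum.distrib sum_subtractf A_sum F sum_left_translate[OF fin, of g "\<lambda>x. F [x, h]"]
        order_def)
qed

lemma transfer_3:
  assumes fin: "finite (carrier R)" and "val 3 V F" "gs \<in> tuples R 3"
  shows "of_nat (order R) * F gs = D 2 (transfer F) gs + transfer (D 3 F) gs"
  using assms(3)
proof (rule tuples_3E)
  fix g h k assume c: "g \<in> carrier R" "h \<in> carrier R" "k \<in> carrier R" and gs: "gs = [g, h, k]"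
  have F: "\<And>x y z. x \<in> carrier R \<Longrightarrow> y \<in> carrier R \<Longrightarrow> z \<in> carrier R \<Longrightarrow> F [x, y, z] \<in> V"
    using assms(2) by (simp add: valued_def tuples_def)
  show ?thesis
    unfolding gs bdry_2 transfer_def bdry_3 using c
    by (simp add: sum.distrib sum_subtractf A_sum F
        sum_left_translate[OF fin, of g "\<lambda>x. F [x, h, k]"] order_def)
qed

end

section \<open>Cohomology of a module presented as a quotient of an additive group\<close>

definition lift_cochain :: "'g monoid \<Rightarrow> ('v \<Rightarrow> 'w) \<Rightarrow> nat \<Rightarrow> ('g list \<Rightarrow> 'v) \<Rightarrow> 'g list \<Rightarrow> 'w" where
  "lift_cochain R \<rho> n F = (\<lambda>gs\<in>tuples R n. \<rho> (F gs))"

definition lift_class ::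
    "'g monoid \<Rightarrow> 'w monoid \<Rightarrow> ('w \<Rightarrow> 'g \<Rightarrow> 'w) \<Rightarrow> ('v \<Rightarrow> 'w) \<Rightarrow> nat \<Rightarrow> ('g list \<Rightarrow> 'v) \<Rightarrow>
     ('g list \<Rightarrow> 'w) set" where
  "lift_class R W act \<rho> n F = coh_class R W act n (lift_cochain R \<rho> n F)"

text \<open>Equality of classes with coefficients X/K, expressed on representatives in V. The index
  n is the degree of the bounding cochain, one less than the degree of F and G.\<close>

definition cohomologous_mod ::
    "'g monoid \<Rightarrow> ('v \<Rightarrow> 'g \<Rightarrow> 'v) \<Rightarrow> 'v set \<Rightarrow> 'v set \<Rightarrow> nat \<Rightarrow> ('g list \<Rightarrow> 'v) \<Rightarrow>
     ('g list \<Rightarrow> 'v::comm_ring_1) \<Rightarrow> bool" where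
  "cohomologous_mod R A X K n F G \<longleftrightarrow>
     (\<exists>c. valued R n X c \<and> valued R (Suc n) K (\<lambda>gs. F gs - G gs - bdry R A n c gs))"

text \<open>One calculus for all coefficient modules: W is X/K via \<rho>. It is instantiated with T
  (X = V, K = {0}), T_n, T/T_n, a^(-1) T_n / T_n and the layers T_i / T_(i+1).\<close>

locale presented_module = additive_rep R V A
  for R :: "'g monoid" (structure) and V :: "'v::comm_ring_1 set" and A +
  fixes W :: "'w monoid" and act :: "'w \<Rightarrow> 'g \<Rightarrow> 'w" and X K :: "'v set" and \<rho> :: "'v \<Rightarrow> 'w"
  assumes W: "comm_group W"
    and X: "add_subgroup X" "X \<subseteq> V" "invariant X"
    and K: "add_subgroup K" "K \<subseteq> X"
    and \<rho>_closed: "x \<in> X \<Longrightarrow> \<rho> x \<in> carrier W"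
    and \<rho>_surj: "w \<in> carrier W \<Longrightarrow> \<exists>x\<in>X. \<rho> x = w"
    and \<rho>_add: "x \<in> X \<Longrightarrow> y \<in> X \<Longrightarrow> \<rho> (x + y) = \<rho> x \<otimes>\<^bsub>W\<^esub> \<rho> y"
    and \<rho>_kernel: "x \<in> X \<Longrightarrow> \<rho> x = \<one>\<^bsub>W\<^esub> \<longleftrightarrow> x \<in> K"
    and \<rho>_act: "x \<in> X \<Longrightarrow> g \<in> carrier R \<Longrightarrow> act (\<rho> x) g = \<rho> (A x g)"
begin

interpretation W: comm_group W by (rule W)

abbreviation lift :: "nat \<Rightarrow> ('g list \<Rightarrow> 'v) \<Rightarrow> 'g list \<Rightarrow> 'w" where
  "lift \<equiv> lift_cochain R \<rho>"

abbreviation cl :: "nat \<Rightarrow> ('g list \<Rightarrow> 'v) \<Rightarrow> ('g list \<Rightarrow> 'w) set" where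
  "cl \<equiv> lift_class R W act \<rho>"

lemma \<rho>_zero: "\<rho> 0 = \<one>\<^bsub>W\<^esub>"
  using \<rho>_kernel[of 0] X K by (simp add: add_subgroup_zero)

lemma \<rho>_uminus: "x \<in> X \<Longrightarrow> \<rho> (- x) = inv\<^bsub>W\<^esub> \<rho> x"
  using \<rho>_add[of "- x" x] W.inv_equality[of "\<rho> (- x)" "\<rho> x"] X
  by (simp add: \<rho>_zero \<rho>_closed add_subgroup_uminus)

lemma \<rho>_eq_iff: assumes "x \<in> X" "y \<in> X" shows "\<rho> x = \<rho> y \<longleftrightarrow> x - y \<in> K"
proof -
  have "\<rho> x = \<rho> (x - y) \<otimes>\<^bsub>W\<^esub> \<rho> y"
    using assms X \<rho>_add[of "x - y" y] by (simp add: add_subgroup_diff)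
  then have "\<rho> x = \<rho> y \<longleftrightarrow> \<rho> (x - y) = \<one>\<^bsub>W\<^esub>"
    using assms X by (auto simp: add_subgroup_diff \<rho>_closed)
  then show ?thesis using assms X \<rho>_kernel by (simp add: add_subgroup_diff)
qed

lemma \<rho>_sum:
  "finite I \<Longrightarrow> (\<And>i. i \<in> I \<Longrightarrow> f i \<in> X) \<Longrightarrow> \<rho> (sum f I) = (\<Otimes>\<^bsub>W\<^esub>i\<in>I. \<rho> (f i))"
proof (induction I rule: finite_induct)
  case (insert i I)
  have "\<rho> (sum f (insert i I)) = \<rho> (f i) \<otimes>\<^bsub>W\<^esub> \<rho> (sum f I)"
    using insert X by (simp add: \<rho>_add add_subgroup_sum)
  then show ?case using insert by (simp add: \<rho>_closed)
qed (simp add: \<rho>_zero)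

lemma \<rho>_sign_mult: assumes "x \<in> X" shows "\<rho> ((- 1) ^ n * x) = \<rho> x [^]\<^bsub>W\<^esub> ((- 1) ^ n :: int)"
proof (cases "even n")
  case True
  then show ?thesis using assms \<rho>_closed by (simp add: int_pow_def2)
next
  case False
  then show ?thesis using assms \<rho>_closed W.int_pow_neg[of "\<rho> x" 1] by (simp add: \<rho>_uminus)
qed

lemma carrier_cochains: "carrier (cochains R W n) = tuples R n \<rightarrow>\<^sub>E carrier W"
  by (simp add: cochains_def)

lemma lift_closed: "val n X F \<Longrightarrow> lift n F \<in> carrier (cochains R W n)"
  by (auto simp: carrier_cochains lift_cochain_def valued_def \<rho>_closed)

lemma lift_surj:
  assumes "f \<in> carrier (cochains R W n)"
  shows "\<exists>F. val n X F \<and> f = lift n F"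
proof -
  have "\<forall>gs\<in>tuples R n. \<exists>x\<in>X. \<rho> x = f gs"
    using assms \<rho>_surj by (auto simp: carrier_cochains)
  then obtain F where "\<forall>gs\<in>tuples R n. F gs \<in> X \<and> \<rho> (F gs) = f gs" by metis
  moreover from this have "f = lift n F"
    using assms by (intro ext) (auto simp: lift_cochain_def carrier_cochains PiE_def extensional_def)
  ultimately show ?thesis by (auto simp: valued_def)
qed

lemma lift_eq_iff:
  assumes "val n X F" "val n X G"
  shows "lift n F = lift n G \<longleftrightarrow> val n K (\<lambda>gs. F gs - G gs)"
proof -
  have "lift n F = lift n G \<longleftrightarrow> (\<forall>gs\<in>tuples R n. \<rho> (F gs) = \<rho> (G gs))"
    unfolding lift_cochain_def restrict_def fun_eq_iff by auto
  then show ?thesis using assms by (simp add: \<rho>_eq_iff valued_def)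
qed

lemma lift_mult:
  assumes "val n X F" "val n X G"
  shows "lift n F \<otimes>\<^bsub>cochains R W n\<^esub> lift n G = lift n (\<lambda>gs. F gs + G gs)"
  using assms by (auto simp: cochains_def lift_cochain_def valued_def \<rho>_add)

lemma lift_zero: "\<one>\<^bsub>cochains R W n\<^esub> = lift n (\<lambda>gs. 0)"
  by (simp add: cochains_def lift_cochain_def \<rho>_zero)

lemma D_valued_X: "val n X F \<Longrightarrow> val (Suc n) X (D n F)"
  by (rule D_valued[OF X(1,3)])

text \<open>Term by term, since \<rho> is an equivariant homomorphism. This is the one place where
  the product formula of \<open>differential\<close> is unfolded; from here on only
  \<open>bdry\<close> is computed with.\<close>

lemma differential_lift:
  assumes F: "val n X F"
  shows "differential R W act n (lift n F) = lift (Suc n) (D n F)"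
proof
  fix gs
  show "differential R W act n (lift n F) gs = lift (Suc n) (D n F) gs"
  proof (cases "gs \<in> tuples R (Suc n)")
    case True
    note T = tuples_SucD[OF True] tuples_merge[OF is_monoid True]
    have FX: "F (tl gs) \<in> X" "F (butlast gs) \<in> X" "\<And>i. i \<in> {1..n} \<Longrightarrow> F (merge R i gs) \<in> X"
      using T valuedD[OF F] by auto
    have FX': "A (F (butlast gs)) (last gs) \<in> X"
      using FX X T by (simp add: invariantD)
    have S: "(\<Sum>i\<in>{1..n}. (- 1) ^ i * F (merge R i gs)) \<in> X"
      using FX X by (intro add_subgroup_intros) auto
    have "\<rho> (D n F gs) = \<rho> (F (tl gs)) \<otimes>\<^bsub>W\<^esub> \<rho> (\<Sum>i\<in>{1..n}. (- 1) ^ i * F (merge R i gs))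
        \<otimes>\<^bsub>W\<^esub> \<rho> ((- 1) ^ Suc n * A (F (butlast gs)) (last gs))"
      unfolding bdry_def using FX FX' S X(1)
      by (simp add: \<rho>_add add_subgroup_intros del: power_Suc)
    also have "\<rho> (\<Sum>i\<in>{1..n}. (- 1) ^ i * F (merge R i gs)) =
        (\<Otimes>\<^bsub>W\<^esub>i\<in>{1..n}. \<rho> (F (merge R i gs)) [^]\<^bsub>W\<^esub> ((- 1) ^ i :: int))"
      using FX X(1) by (subst \<rho>_sum) (auto simp: \<rho>_sign_mult \<rho>_closed intro!: add_subgroup_sign_mult W.finprod_cong')
    also have "\<dots> = (\<Otimes>\<^bsub>W\<^esub>i\<in>{1..n}. lift n F (merge R i gs) [^]\<^bsub>W\<^esub> ((- 1) ^ i :: int))"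
      using FX T by (intro W.finprod_cong') (auto simp: lift_cochain_def \<rho>_closed)
    also have "\<rho> ((- 1) ^ Suc n * A (F (butlast gs)) (last gs)) =
        act (lift n F (butlast gs)) (last gs) [^]\<^bsub>W\<^esub> ((- 1) ^ Suc n :: int)"
      using FX FX' T by (simp add: \<rho>_sign_mult \<rho>_act lift_cochain_def del: power_Suc)
    also have "\<rho> (F (tl gs)) = lift n F (tl gs)"
      using T by (simp add: lift_cochain_def)
    finally have "\<rho> (D n F gs) = differential R W act n (lift n F) gs"
      unfolding differential_def using True by simp
    then show ?thesis using True by (simp add: lift_cochain_def)
  qed (simp add: differential_def lift_cochain_def)
qed

lemma lift_cocycle_iff:
  assumes "val n X F"
  shows "lift n F \<in> cocycles R W act n \<longleftrightarrow> val (Suc n) K (D n F)"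
  using assms lift_eq_iff[OF D_valued_X[OF assms], of "\<lambda>gs. 0"] X
  by (simp add: cocycles_def lift_closed differential_lift lift_zero valued_def add_subgroup_zero)

lemma coboundaries_Suc:
  "coboundaries R W act (Suc n) = {lift (Suc n) (D n c) | c. val n X c}"
proof -
  have "carrier (cochains R W n) = {lift n c | c. val n X c}"
    using lift_surj lift_closed by blast
  then show ?thesis using differential_lift by (auto simp: image_def)
qed

section \<open>Cohomology classes in terms of representatives\<close>

abbreviation cohomologous :: "nat \<Rightarrow> ('g list \<Rightarrow> 'v) \<Rightarrow> ('g list \<Rightarrow> 'v) \<Rightarrow> bool" where
  "cohomologous \<equiv> cohomologous_mod R A X K"

lemma cohomologousI:
  "val n X c \<Longrightarrow> (\<And>gs. gs \<in> tuples R (Suc n) \<Longrightarrow> F gs - G gs - D n c gs \<in> K) \<Longrightarrow> cohomologous n F G"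
  by (auto simp: cohomologous_mod_def valued_def)

lemma cohomologous_if_diff:
  assumes "val (Suc n) K (\<lambda>gs. F gs - G gs)"
  shows "cohomologous n F G"
  unfolding cohomologous_mod_def
proof (intro exI conjI)
  show "val n X (\<lambda>gs. 0)" using X by (simp add: valued_def add_subgroup_zero)
  show "val (Suc n) K (\<lambda>gs. F gs - G gs - D n (\<lambda>gs. 0) gs)"
    using assms by (simp add: valued_def D_zero)
qed

lemma cohomologous_refl: "cohomologous n F F"
  using K by (intro cohomologous_if_diff) (simp add: valued_def add_subgroup_zero)

lemma cohomologous_sym: assumes "cohomologous n F G" shows "cohomologous n G F"
proof -
  obtain c where c: "val n X c" "val (Suc n) K (\<lambda>gs. F gs - G gs - D n c gs)"
    using assms by (auto simp: cohomologous_mod_def)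
  have "val n X (\<lambda>gs. 0 - c gs)" using c X by (simp add: valued_def add_subgroup_uminus)
  moreover have "G gs - F gs - D n (\<lambda>gs. 0 - c gs) gs \<in> K" if "gs \<in> tuples R (Suc n)" for gs
  proof -
    have "G gs - F gs - D n (\<lambda>gs. 0 - c gs) gs = - (F gs - G gs - D n c gs)"
      using that D_diff[OF _ valued_mono[OF c(1) X(2)] that, of "\<lambda>gs. 0"] add_subgroup_zero[OF V]
      by (simp add: D_zero valued_def)
    then show ?thesis by (simp only: add_subgroup_uminus[OF K(1) valuedD[OF c(2) that]])
  qed
  ultimately show ?thesis by (rule cohomologousI)
qed

lemma cohomologous_trans:
  assumes "cohomologous n F G" "cohomologous n G H" shows "cohomologous n F H"
proof -
  obtain c where c: "val n X c" "val (Suc n) K (\<lambda>gs. F gs - G gs - D n c gs)"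
    using assms(1) by (auto simp: cohomologous_mod_def)
  obtain e where e: "val n X e" "val (Suc n) K (\<lambda>gs. G gs - H gs - D n e gs)"
    using assms(2) by (auto simp: cohomologous_mod_def)
  have "val n X (\<lambda>gs. c gs + e gs)" using c e X by (simp add: valued_def add_subgroup_add)
  moreover have "F gs - H gs - D n (\<lambda>gs. c gs + e gs) gs \<in> K" if "gs \<in> tuples R (Suc n)" for gs
  proof -
    have "F gs - H gs - D n (\<lambda>gs. c gs + e gs) gs =
        (F gs - G gs - D n c gs) + (G gs - H gs - D n e gs)"
      using D_add[OF valued_mono[OF c(1) X(2)] valued_mono[OF e(1) X(2)] that] by simp
    then show ?thesis by (simp only: add_subgroup_add[OF K(1) valuedD[OF c(2) that] valuedD[OF e(2) that]])
  qed
  ultimately show ?thesis by (rule cohomologousI)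
qed

text \<open>Translates cosets of the group of coboundaries into the relation
  \<open>cohomologous\<close>; the later descriptions of equality, unit and product of classes go
  through it.\<close>

lemma mem_cl_iff:
  assumes F: "val (Suc n) X F"
  shows "h \<in> cl (Suc n) F \<longleftrightarrow>
    (\<exists>G. val (Suc n) X G \<and> h = lift (Suc n) G \<and> cohomologous n G F)"
proof -
  have mult: "lift (Suc n) (D n c) \<otimes>\<^bsub>cochains R W (Suc n)\<^esub> lift (Suc n) F =
      lift (Suc n) (\<lambda>gs. D n c gs + F gs)" if "val n X c" for c
    using that F by (intro lift_mult D_valued_X)
  have "h \<in> cl (Suc n) F \<longleftrightarrow> (\<exists>c. val n X c \<and> h = lift (Suc n) (\<lambda>gs. D n c gs + F gs))"
    unfolding lift_class_def coh_class_def r_coset_def coboundaries_Suc using mult by auto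
  also have "\<dots> \<longleftrightarrow> (\<exists>G. val (Suc n) X G \<and> h = lift (Suc n) G \<and> cohomologous n G F)"
  proof safe
    fix c assume c: "val n X c"
    have "val (Suc n) X (\<lambda>gs. D n c gs + F gs)"
      using D_valued_X[OF c] F X(1) by (simp add: valued_def add_subgroup_add)
    moreover have "cohomologous n (\<lambda>gs. D n c gs + F gs) F"
      unfolding cohomologous_mod_def using c K by (auto simp: valued_def add_subgroup_zero)
    ultimately show "\<exists>G. val (Suc n) X G \<and>
        lift (Suc n) (\<lambda>gs. D n c gs + F gs) = lift (Suc n) G \<and> cohomologous n G F" by blast
  next
    fix G assume G: "val (Suc n) X G" "cohomologous n G F"
    then obtain c where c: "val n X c" "val (Suc n) K (\<lambda>gs. G gs - F gs - D n c gs)"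
      by (auto simp: cohomologous_mod_def)
    have "val (Suc n) X (\<lambda>gs. D n c gs + F gs)"
      using D_valued_X[OF c(1)] F X(1) by (simp add: valued_def add_subgroup_add)
    then have "lift (Suc n) G = lift (Suc n) (\<lambda>gs. D n c gs + F gs)"
      using G c(2) by (subst lift_eq_iff) (auto simp: algebra_simps)
    then show "\<exists>c. val n X c \<and> lift (Suc n) G = lift (Suc n) (\<lambda>gs. D n c gs + F gs)"
      using c(1) by blast
  qed
  finally show ?thesis .
qed

lemma lift_mem_cl: "val (Suc n) X F \<Longrightarrow> lift (Suc n) F \<in> cl (Suc n) F"
  using mem_cl_iff cohomologous_refl by blast

lemma lift_mem_cl_iff:
  assumes "val (Suc n) X F" "val (Suc n) X G"
  shows "lift (Suc n) G \<in> cl (Suc n) F \<longleftrightarrow> cohomologous n G F"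
proof
  assume "lift (Suc n) G \<in> cl (Suc n) F"
  then obtain G' where G': "val (Suc n) X G'" "lift (Suc n) G = lift (Suc n) G'"
    "cohomologous n G' F"
    using mem_cl_iff[OF assms(1)] by blast
  then have "cohomologous n G G'"
    using lift_eq_iff[OF assms(2) G'(1)] cohomologous_if_diff by simp
  then show "cohomologous n G F" using G'(3) cohomologous_trans by blast
next
  assume "cohomologous n G F"
  then show "lift (Suc n) G \<in> cl (Suc n) F" using mem_cl_iff[OF assms(1)] assms(2) by blast
qed

lemma cl_eq_iff:
  assumes "val (Suc n) X F" "val (Suc n) X G"
  shows "cl (Suc n) F = cl (Suc n) G \<longleftrightarrow> cohomologous n F G"
proof
  show "cl (Suc n) F = cl (Suc n) G \<Longrightarrow> cohomologous n F G"
    using assms lift_mem_cl[of n F] lift_mem_cl_iff[of n G F] by simp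
  assume "cohomologous n F G"
  then show "cl (Suc n) F = cl (Suc n) G"
    unfolding set_eq_iff mem_cl_iff[OF assms(1)] mem_cl_iff[OF assms(2)]
    using cohomologous_sym cohomologous_trans by blast
qed

lemma carrier_cohomology:
  "carrier (cohomology R W act n) = {cl n F | F. val n X F \<and> val (Suc n) K (D n F)}"
proof -
  have "carrier (cohomology R W act n) = coh_class R W act n ` cocycles R W act n"
    by (auto simp: cohomology_def FactGroup_def RCOSETS_def coh_class_def r_coset_def)
  also have "\<dots> = {cl n F | F. val n X F \<and> lift n F \<in> cocycles R W act n}"
    unfolding lift_class_def using lift_surj by (fastforce simp: cocycles_def)
  also have "\<dots> = {cl n F | F. val n X F \<and> val (Suc n) K (D n F)}"
    using lift_cocycle_iff by blast
  finally show ?thesis .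
qed

lemma one_cohomology: "\<one>\<^bsub>cohomology R W act (Suc n)\<^esub> = cl (Suc n) (\<lambda>gs. 0)"
proof -
  have zero: "val (Suc n) X (\<lambda>gs. 0)" using X by (simp add: valued_def add_subgroup_zero)
  have "{lift (Suc n) (D n c) | c. val n X c} = cl (Suc n) (\<lambda>gs. 0)"
  proof (intro equalityI subsetI)
    fix h assume "h \<in> {lift (Suc n) (D n c) | c. val n X c}"
    then obtain c where c: "val n X c" "h = lift (Suc n) (D n c)" by blast
    have "cohomologous n (D n c) (\<lambda>gs. 0)"
      by (rule cohomologousI[OF c(1)]) (simp add: add_subgroup_zero[OF K(1)])
    then show "h \<in> cl (Suc n) (\<lambda>gs. 0)"
      using c lift_mem_cl_iff[OF zero D_valued_X[OF c(1)]] by simp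
  next
    fix h assume "h \<in> cl (Suc n) (\<lambda>gs. 0)"
    then obtain G where G: "val (Suc n) X G" "h = lift (Suc n) G" "cohomologous n G (\<lambda>gs. 0)"
      using mem_cl_iff[OF zero] by blast
    then obtain c where c: "val n X c" "val (Suc n) K (\<lambda>gs. G gs - D n c gs)"
      by (auto simp: cohomologous_mod_def)
    then have "h = lift (Suc n) (D n c)"
      using lift_eq_iff[OF G(1) D_valued_X[OF c(1)]] G(2) by simp
    then show "h \<in> {lift (Suc n) (D n c) | c. val n X c}" using c(1) by blast
  qed
  then show ?thesis
    unfolding cohomology_def FactGroup_def coboundaries_Suc by simp
qed

text \<open>The product in \<open>Mod\<close> is the product of sets, so both inclusions are needed:
  bounding cochains add up, and a representative H of the sum splits as (H - G) + G.\<close>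

lemma cl_mult:
  assumes F: "val (Suc n) X F" and G: "val (Suc n) X G"
  shows "cl (Suc n) F \<otimes>\<^bsub>cohomology R W act (Suc n)\<^esub> cl (Suc n) G =
    cl (Suc n) (\<lambda>gs. F gs + G gs)"
proof -
  have FG: "val (Suc n) X (\<lambda>gs. F gs + G gs)"
    using F G X by (simp add: valued_def add_subgroup_add)
  have "cl (Suc n) F \<otimes>\<^bsub>cohomology R W act (Suc n)\<^esub> cl (Suc n) G =
      {f \<otimes>\<^bsub>cochains R W (Suc n)\<^esub> h | f h. f \<in> cl (Suc n) F \<and> h \<in> cl (Suc n) G}"
    by (auto simp: cohomology_def FactGroup_def set_mult_def)
  also have "\<dots> = cl (Suc n) (\<lambda>gs. F gs + G gs)" (is "?L = ?R")
  proof (intro equalityI subsetI)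
    fix x assume "x \<in> ?L"
    then obtain F' G' where F': "val (Suc n) X F'" "cohomologous n F' F"
      and G': "val (Suc n) X G'" "cohomologous n G' G"
      and x: "x = lift (Suc n) F' \<otimes>\<^bsub>cochains R W (Suc n)\<^esub> lift (Suc n) G'"
      using mem_cl_iff F G by auto
    obtain c where c: "val n X c" "val (Suc n) K (\<lambda>gs. F' gs - F gs - D n c gs)"
      using F' by (auto simp: cohomologous_mod_def)
    obtain e where e: "val n X e" "val (Suc n) K (\<lambda>gs. G' gs - G gs - D n e gs)"
      using G' by (auto simp: cohomologous_mod_def)
    have "val n X (\<lambda>gs. c gs + e gs)" using c e X by (simp add: valued_def add_subgroup_add)
    moreover have "(F' gs + G' gs) - (F gs + G gs) - D n (\<lambda>gs. c gs + e gs) gs \<in> K"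
      if "gs \<in> tuples R (Suc n)" for gs
    proof -
      have "(F' gs + G' gs) - (F gs + G gs) - D n (\<lambda>gs. c gs + e gs) gs =
          (F' gs - F gs - D n c gs) + (G' gs - G gs - D n e gs)"
        using D_add[OF valued_mono[OF c(1) X(2)] valued_mono[OF e(1) X(2)] that] by simp
      then show ?thesis by (simp only: add_subgroup_add[OF K(1) valuedD[OF c(2) that] valuedD[OF e(2) that]])
    qed
    ultimately have "cohomologous n (\<lambda>gs. F' gs + G' gs) (\<lambda>gs. F gs + G gs)"
      by (rule cohomologousI)
    moreover have "x = lift (Suc n) (\<lambda>gs. F' gs + G' gs)"
      unfolding x using F' G' by (intro lift_mult)
    moreover have "val (Suc n) X (\<lambda>gs. F' gs + G' gs)"
      using F' G' X by (simp add: valued_def add_subgroup_add)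
    ultimately show "x \<in> ?R" using mem_cl_iff[OF FG] by blast
  next
    fix x assume "x \<in> ?R"
    then obtain H where H: "val (Suc n) X H" "x = lift (Suc n) H"
      "cohomologous n H (\<lambda>gs. F gs + G gs)"
      using mem_cl_iff[OF FG] by auto
    have HG: "val (Suc n) X (\<lambda>gs. H gs - G gs)"
      using H G X by (simp add: valued_def add_subgroup_diff)
    have "cohomologous n (\<lambda>gs. H gs - G gs) F"
      using H(3) by (simp add: cohomologous_mod_def algebra_simps)
    then have "lift (Suc n) (\<lambda>gs. H gs - G gs) \<in> cl (Suc n) F"
      using HG mem_cl_iff[OF F] by blast
    moreover have "x = lift (Suc n) (\<lambda>gs. H gs - G gs) \<otimes>\<^bsub>cochains R W (Suc n)\<^esub> lift (Suc n) G"
      using lift_mult[OF HG G] H by simp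
    ultimately show "x \<in> ?L" using lift_mem_cl[OF G] by blast
  qed
  finally show ?thesis .
qed

end

text \<open>Closure under subtraction replaces division with remainder: subtracting the least
  positive element repeatedly from an element of P has to end at 0. It will show that the exponents
  of the cohomology groups divide q.\<close>

lemma Least_positive_dvd:
  fixes N :: nat
  assumes "P N" "N > 0" and diff: "\<And>k l. P k \<Longrightarrow> P l \<Longrightarrow> l \<le> k \<Longrightarrow> P (k - l)"
  defines "e \<equiv> LEAST e. 0 < e \<and> P e"
  shows "P e" "e dvd N"
proof -
  have e: "0 < e \<and> P e" unfolding e_def by (rule LeastI[of _ N]) (use assms in simp)
  have "e dvd k" if "P k" for k
    using that
  proof (induction k rule: less_induct)
    case (less k)
    show ?case
    proof (cases "k = 0")
      case False
      then have "e \<le> k" unfolding e_def using less.prems by (intro Least_le) simp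
      then have "e dvd k - e" using less e False diff by simp
      then show ?thesis using \<open>e \<le> k\<close> by (simp add: dvd_minus_self)
    qed simp
  qed
  then show "P e" "e dvd N" using e assms by auto
qed

context presented_module
begin

lemma cl_pow:
  assumes F: "val (Suc n) X F"
  shows "cl (Suc n) F [^]\<^bsub>cohomology R W act (Suc n)\<^esub> (k::nat) = cl (Suc n) (\<lambda>gs. of_nat k * F gs)"
proof (induction k)
  case 0
  then show ?case by (simp add: nat_pow_def one_cohomology)
next
  case (Suc k)
  have "val (Suc n) X (\<lambda>gs. of_nat k * F gs)"
    using F X by (simp add: valued_def add_subgroup_of_nat_mult)
  then have "cl (Suc n) (\<lambda>gs. of_nat k * F gs) \<otimes>\<^bsub>cohomology R W act (Suc n)\<^esub> cl (Suc n) F =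
      cl (Suc n) (\<lambda>gs. of_nat (Suc k) * F gs)"
    using cl_mult[OF _ F] by (simp add: algebra_simps)
  then show ?case using Suc by (simp add: nat_pow_def)
qed

lemma \<rho>_pow: "x \<in> X \<Longrightarrow> \<rho> x [^]\<^bsub>W\<^esub> (k::nat) = \<rho> (of_nat k * x)"
proof (induction k)
  case (Suc k)
  have eq: "of_nat (Suc k) * x = of_nat k * x + x" by (simp add: distrib_right)
  show ?case
    unfolding eq using Suc by (simp add: \<rho>_add add_subgroup_of_nat_mult[OF X(1)] nat_pow_def)
qed (simp add: \<rho>_zero nat_pow_def)

text \<open>k kills the cohomology of degree n + 1 with coefficients X/K.
  \<open>group_exponent\<close> is the least positive such k, which has this property as soon as one
  positive k is known; the transfer will provide q.\<close>

definition annihilates :: "nat \<Rightarrow> nat \<Rightarrow> bool" where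
  "annihilates n k \<longleftrightarrow>
     (\<forall>F. val (Suc n) X F \<and> val (Suc (Suc n)) K (D (Suc n) F) \<longrightarrow>
        cohomologous n (\<lambda>gs. of_nat k * F gs) (\<lambda>gs. 0))"

lemma annihilates_diff:
  assumes "annihilates n k" "annihilates n l" "l \<le> k"
  shows "annihilates n (k - l)"
  unfolding annihilates_def
proof (intro allI impI)
  fix F assume F: "val (Suc n) X F \<and> val (Suc (Suc n)) K (D (Suc n) F)"
  then obtain c where c: "val n X c" "val (Suc n) K (\<lambda>gs. of_nat k * F gs - D n c gs)"
    using assms(1) by (fastforce simp: annihilates_def cohomologous_mod_def)
  obtain e where e: "val n X e" "val (Suc n) K (\<lambda>gs. of_nat l * F gs - D n e gs)"
    using assms(2) F by (fastforce simp: annihilates_def cohomologous_mod_def)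
  have "val n X (\<lambda>gs. c gs - e gs)" using c e X by (simp add: valued_def add_subgroup_diff)
  moreover have "of_nat (k - l) * F gs - 0 - D n (\<lambda>gs. c gs - e gs) gs \<in> K"
    if gs: "gs \<in> tuples R (Suc n)" for gs
  proof -
    have "of_nat (k - l) * F gs - 0 - D n (\<lambda>gs. c gs - e gs) gs =
        (of_nat k * F gs - D n c gs) - (of_nat l * F gs - D n e gs)"
      using D_diff[OF valued_mono[OF c(1) X(2)] valued_mono[OF e(1) X(2)] gs] assms(3)
      by (simp add: of_nat_diff algebra_simps)
    then show ?thesis
      by (simp only: add_subgroup_diff[OF K(1) valuedD[OF c(2) gs] valuedD[OF e(2) gs]])
  qed
  ultimately show "cohomologous n (\<lambda>gs. of_nat (k - l) * F gs) (\<lambda>gs. 0)"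
    by (rule cohomologousI)
qed

lemma group_exponent_cohomology:
  "group_exponent (cohomology R W act (Suc n)) = (LEAST e. 0 < e \<and> annihilates n e)"
proof -
  have zero: "val (Suc n) X (\<lambda>gs. 0)" using X by (simp add: valued_def add_subgroup_zero)
  have "(\<forall>x\<in>carrier (cohomology R W act (Suc n)).
      x [^]\<^bsub>cohomology R W act (Suc n)\<^esub> k = \<one>\<^bsub>cohomology R W act (Suc n)\<^esub>) \<longleftrightarrow> annihilates n k"
    for k :: nat
  proof -
    have "cl (Suc n) F [^]\<^bsub>cohomology R W act (Suc n)\<^esub> k = \<one>\<^bsub>cohomology R W act (Suc n)\<^esub> \<longleftrightarrow>
        cohomologous n (\<lambda>gs. of_nat k * F gs) (\<lambda>gs. 0)" if F: "val (Suc n) X F" for F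
    proof -
      have "val (Suc n) X (\<lambda>gs. of_nat k * F gs)"
        using F X by (simp add: valued_def add_subgroup_of_nat_mult)
      then show ?thesis unfolding cl_pow[OF F] one_cohomology by (rule cl_eq_iff[OF _ zero])
    qed
    then show ?thesis unfolding carrier_cohomology annihilates_def by auto
  qed
  then show ?thesis unfolding group_exponent_def by simp
qed

lemma group_exponent_annihilates:
  assumes "annihilates n N" "N > 0"
  shows "annihilates n (group_exponent (cohomology R W act (Suc n)))"
    and "group_exponent (cohomology R W act (Suc n)) dvd N"
  unfolding group_exponent_cohomology
  using Least_positive_dvd[of "annihilates n" N] assms annihilates_diff by auto

lemma annihilates_mult:
  assumes "annihilates n k"
  shows "annihilates n (l * k)"
  unfolding annihilates_def
proof (intro allI impI)
  fix F assume F: "val (Suc n) X F \<and> val (Suc (Suc n)) K (D (Suc n) F)"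
  then obtain c where c: "val n X c" "val (Suc n) K (\<lambda>gs. of_nat k * F gs - D n c gs)"
    using assms(1) by (fastforce simp: annihilates_def cohomologous_mod_def)
  have "val n X (\<lambda>gs. of_nat l * c gs)" using c X by (simp add: valued_def add_subgroup_of_nat_mult)
  moreover have "of_nat (l * k) * F gs - 0 - D n (\<lambda>gs. of_nat l * c gs) gs \<in> K"
    if gs: "gs \<in> tuples R (Suc n)" for gs
  proof -
    have "of_nat (l * k) * F gs - 0 - D n (\<lambda>gs. of_nat l * c gs) gs =
        of_nat l * (of_nat k * F gs - D n c gs)"
      using D_of_nat_mult[OF valued_mono[OF c(1) X(2)] gs] by (simp add: algebra_simps)
    then show ?thesis
      by (simp only: add_subgroup_of_nat_mult[OF K(1) valuedD[OF c(2) gs]])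
  qed
  ultimately show "cohomologous n (\<lambda>gs. of_nat (l * k) * F gs) (\<lambda>gs. 0)"
    by (rule cohomologousI)
qed

end

text \<open>A homomorphism \<theta> of coefficient modules together with an equivariant lift
  \<Theta> to V. The instances are the reduction modulo T_n and an inclusion, both with the identity
  as lift, and multiplication by p.\<close>

locale presented_module_map =
  M: presented_module R V A W act X K \<rho> + M': presented_module R V A W' act' X' K' \<rho>'
  for R :: "'g monoid" (structure) and V :: "'v::comm_ring_1 set" and A
    and W :: "'w monoid" and act X K \<rho> and W' :: "'u monoid" and act' X' K' \<rho>' +
  fixes \<Theta> :: "'v \<Rightarrow> 'v" and \<theta> :: "'w \<Rightarrow> 'u"
  assumes \<Theta>: "additive_on V \<Theta>" "\<And>x g. x \<in> V \<Longrightarrow> g \<in> carrier R \<Longrightarrow> \<Theta> (A x g) = A (\<Theta> x) g"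
    and \<Theta>_X: "\<And>x. x \<in> X \<Longrightarrow> \<Theta> x \<in> X'" and \<Theta>_K: "\<And>x. x \<in> K \<Longrightarrow> \<Theta> x \<in> K'"
    and \<theta>: "\<And>x. x \<in> X \<Longrightarrow> \<theta> (\<rho> x) = \<rho>' (\<Theta> x)"
begin

lemma D_\<Theta>:
  assumes "M.val n X F" "gs \<in> tuples R (Suc n)"
  shows "M.D n (\<lambda>gs. \<Theta> (F gs)) gs = \<Theta> (M.D n F gs)"
  using M.D_map[OF _ \<Theta>(1) add_subgroup_trivial _ valued_mono[OF assms(1) M.X(2)] assms(2), of id] \<Theta>(2)
  by (simp add: hom_def)

lemma cohomologous_map:
  assumes "M.val (Suc n) X F" "M.val (Suc n) X G" "M.cohomologous n F G"
  shows "M'.cohomologous n (\<lambda>gs. \<Theta> (F gs)) (\<lambda>gs. \<Theta> (G gs))"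
proof -
  obtain c where c: "M.val n X c" "M.val (Suc n) K (\<lambda>gs. F gs - G gs - M.D n c gs)"
    using assms by (auto simp: cohomologous_mod_def)
  have "M.val n X' (\<lambda>gs. \<Theta> (c gs))" using c \<Theta>_X by (auto simp: valued_def)
  moreover have "\<Theta> (F gs) - \<Theta> (G gs) - M.D n (\<lambda>gs. \<Theta> (c gs)) gs \<in> K'"
    if gs: "gs \<in> tuples R (Suc n)" for gs
  proof -
    have in_V: "F gs \<in> V" "G gs \<in> V" "M.D n c gs \<in> V"
      using valuedD[OF assms(1) gs] valuedD[OF assms(2) gs] valuedD[OF M.D_valued_X[OF c(1)] gs] M.X
      by auto
    have "\<Theta> (F gs) - \<Theta> (G gs) - M.D n (\<lambda>gs. \<Theta> (c gs)) gs = \<Theta> (F gs - G gs - M.D n c gs)"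
      using in_V by (simp add: D_\<Theta>[OF c(1) gs] additive_on_diff[OF M.V \<Theta>(1)] add_subgroup_diff[OF M.V])
    then show ?thesis using \<Theta>_K valuedD[OF c(2) gs] by simp
  qed
  ultimately show ?thesis by (rule M'.cohomologousI)
qed

lemma coh_map_cl:
  assumes F: "M.val (Suc n) X F"
  shows "coh_map R W' act' (Suc n) \<theta> (M.cl (Suc n) F) = M'.cl (Suc n) (\<lambda>gs. \<Theta> (F gs))"
proof -
  have "coh_class R W' act' (Suc n) (\<lambda>gs\<in>tuples R (Suc n). \<theta> (f gs)) =
      M'.cl (Suc n) (\<lambda>gs. \<Theta> (F gs))" if "f \<in> M.cl (Suc n) F" for f
  proof -
    obtain G where G: "M.val (Suc n) X G" "f = M.lift (Suc n) G" "M.cohomologous n G F"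
      using \<open>f \<in> M.cl (Suc n) F\<close> M.mem_cl_iff[OF F] by blast
    have "(\<lambda>gs\<in>tuples R (Suc n). \<theta> (f gs)) = M'.lift (Suc n) (\<lambda>gs. \<Theta> (G gs))"
      using G by (auto simp: lift_cochain_def valued_def \<theta> intro!: restrict_ext)
    then have "coh_class R W' act' (Suc n) (\<lambda>gs\<in>tuples R (Suc n). \<theta> (f gs)) =
        M'.cl (Suc n) (\<lambda>gs. \<Theta> (G gs))"
      by (simp add: lift_class_def)
    also have "\<dots> = M'.cl (Suc n) (\<lambda>gs. \<Theta> (F gs))"
      using cohomologous_map[OF G(1) F G(3)] G(1) F \<Theta>_X
      by (subst M'.cl_eq_iff) (auto simp: valued_def)
    finally show ?thesis .
  qed
  then have "(\<lambda>f. coh_class R W' act' (Suc n) (\<lambda>gs\<in>tuples R (Suc n). \<theta> (f gs))) ` M.cl (Suc n) F =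
      {M'.cl (Suc n) (\<lambda>gs. \<Theta> (F gs))}"
    using M.lift_mem_cl[OF F] by (auto simp: image_iff)
  then show ?thesis unfolding coh_map_def by simp
qed

end

section \<open>Index of additive subgroups\<close>

definition add_coset :: "'v::ab_group_add set \<Rightarrow> 'v \<Rightarrow> 'v set" where
  "add_coset U x = (+) x ` U"

definition add_index :: "'v::ab_group_add set \<Rightarrow> 'v set \<Rightarrow> nat" where
  "add_index W U = card (add_coset U ` W)"

lemma add_coset_eq_iff:
  assumes "add_subgroup U" shows "add_coset U x = add_coset U y \<longleftrightarrow> x - y \<in> U"
proof
  assume "add_coset U x = add_coset U y"
  moreover have "x + 0 \<in> add_coset U x"
    unfolding add_coset_def using add_subgroup_zero[OF assms] by (rule imageI)
  ultimately show "x - y \<in> U" by (auto simp: add_coset_def)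
next
  have sub: "add_coset U x \<subseteq> add_coset U y" if "x - y \<in> U" for x y
  proof
    fix z assume "z \<in> add_coset U x"
    then obtain u where "u \<in> U" "z = x + u" by (auto simp: add_coset_def)
    then have "z = y + ((x - y) + u)" "(x - y) + u \<in> U"
      using that add_subgroup_add[OF assms] by auto
    then show "z \<in> add_coset U y" unfolding add_coset_def by blast
  qed
  assume "x - y \<in> U"
  then show "add_coset U x = add_coset U y"
    using sub[of x y] sub[of y x] add_subgroup_uminus[OF assms, of "x - y"] by auto
qed

lemma card_image_eq_if_same_fibres:
  assumes "\<And>x y. x \<in> W \<Longrightarrow> y \<in> W \<Longrightarrow> f x = f y \<longleftrightarrow> g x = g y"
  shows "card (f ` W) = card (g ` W)"
proof (rule bij_betw_same_card)
  have "inv_into W f (f x) \<in> W \<and> f (inv_into W f (f x)) = f x" if "x \<in> W" for x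
    using that by (simp add: inv_into_into f_inv_into_f)
  then have *: "g (inv_into W f (f x)) = g x" if "x \<in> W" for x
    using that assms by blast
  show "bij_betw (\<lambda>c. g (inv_into W f c)) (f ` W) (g ` W)"
    unfolding bij_betw_def inj_on_def using * assms by (auto simp: image_iff)
qed

lemma add_index_eq_card_image:
  assumes "add_subgroup U" "\<And>x y. x \<in> W \<Longrightarrow> y \<in> W \<Longrightarrow> f x = f y \<longleftrightarrow> x - y \<in> U"
  shows "add_index W U = card (f ` W)"
  unfolding add_index_def using assms
  by (intro card_image_eq_if_same_fibres) (simp add: add_coset_eq_iff)

text \<open>\<open>card\<close> records an infinite index as 0; the product formula remains valid
  with this convention.\<close>

lemma add_index_mult:
  assumes U: "add_subgroup U" and M: "add_subgroup M" and W: "add_subgroup W"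
    and "U \<subseteq> M" "M \<subseteq> W"
  shows "add_index W U = add_index W M * add_index M U"
proof -
  define r where "r x = inv_into W (add_coset M) (add_coset M x)" for x
  have r: "r x \<in> W" "add_coset M (r x) = add_coset M x" if "x \<in> W" for x
    unfolding r_def using that by (simp_all add: inv_into_into f_inv_into_f)
  have rM: "x - r x \<in> M" if "x \<in> W" for x
    using r(2)[OF that] add_coset_eq_iff[OF M, of x "r x"] by simp
  \<comment> \<open>The pair consists of the coset modulo M and of the coset modulo U of the
    deviation from the chosen representative \<open>r x\<close>; it identifies the set W/U with W/M
    \<times> M/U.\<close>
  let ?\<kappa> = "\<lambda>x. (add_coset M x, add_coset U (x - r x))"
  have "add_index W U = card (?\<kappa> ` W)"
  proof (rule add_index_eq_card_image[OF U])
    fix x y assume "x \<in> W" "y \<in> W"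
    show "?\<kappa> x = ?\<kappa> y \<longleftrightarrow> x - y \<in> U"
    proof
      assume *: "?\<kappa> x = ?\<kappa> y"
      then have "r x = r y" by (simp add: r_def)
      with * show "x - y \<in> U" by (simp add: add_coset_eq_iff[OF U])
    next
      assume *: "x - y \<in> U"
      then have "add_coset M x = add_coset M y"
        using add_coset_eq_iff[OF M] \<open>U \<subseteq> M\<close> by blast
      moreover from this have "r x = r y" by (simp add: r_def)
      ultimately show "?\<kappa> x = ?\<kappa> y" using * by (simp add: add_coset_eq_iff[OF U])
    qed
  qed
  also have "?\<kappa> ` W = add_coset M ` W \<times> add_coset U ` M"
  proof (intro equalityI subsetI)
    fix z assume "z \<in> ?\<kappa> ` W"
    then show "z \<in> add_coset M ` W \<times> add_coset U ` M" using rM by auto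
  next
    fix z assume "z \<in> add_coset M ` W \<times> add_coset U ` M"
    then obtain x m where x: "x \<in> W" and m: "m \<in> M" and z: "z = (add_coset M x, add_coset U m)"
      by auto
    have "add_coset M (r x + m) = add_coset M x"
      using add_coset_eq_iff[OF M, of "r x + m" "r x"] m r(2)[OF x] by simp
    moreover from this have "r (r x + m) = r x" by (simp add: r_def)
    moreover have "r x + m \<in> W" using r(1)[OF x] m \<open>M \<subseteq> W\<close> add_subgroup_add[OF W] by blast
    ultimately have "z = ?\<kappa> (r x + m)" "r x + m \<in> W" using z by auto
    then show "z \<in> ?\<kappa> ` W" by blast
  qed
  finally show ?thesis by (simp add: add_index_def card_cartesian_product)
qed

lemma add_index_eq_1_imp_subset:
  assumes "add_subgroup U" "add_subgroup W" "add_index W U = 1"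
  shows "W \<subseteq> U"
proof
  fix x assume "x \<in> W"
  obtain C where C: "add_coset U ` W = {C}"
    using assms(3) by (auto simp: add_index_def card_1_singleton_iff)
  have "add_coset U x \<in> {C}" "add_coset U 0 \<in> {C}"
    unfolding C[symmetric] using \<open>x \<in> W\<close> add_subgroup_zero[OF assms(2)] by blast+
  then have "add_coset U x = add_coset U 0" by simp
  then show "x \<in> U" using add_coset_eq_iff[OF assms(1), of x 0] by simp
qed

lemma add_index_self: "add_subgroup U \<Longrightarrow> add_index U U = 1"
proof -
  assume U: "add_subgroup U"
  have "add_index U U = card ((\<lambda>x. ()) ` U)"
    using U by (intro add_index_eq_card_image) (simp_all add: add_subgroup_diff)
  also have "(\<lambda>x. ()) ` U = {()}" using add_subgroup_zero[OF U] by blast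
  finally show ?thesis by simp
qed

lemma add_index_image:
  fixes f :: "'v::comm_ring_1 \<Rightarrow> 'v"
  assumes W: "add_subgroup W" and U: "add_subgroup U" "U \<subseteq> W"
    and f: "additive_on W f" "\<And>x. x \<in> W \<Longrightarrow> f x = 0 \<Longrightarrow> x = 0"
  shows "add_index (f ` W) (f ` U) = add_index W U"
proof -
  have "add_coset (f ` U) (f x) = add_coset (f ` U) (f y) \<longleftrightarrow> x - y \<in> U"
    if "x \<in> W" "y \<in> W" for x y
  proof -
    have "f x - f y \<in> f ` U \<longleftrightarrow> f (x - y) \<in> f ` U"
      using additive_on_diff[OF W f(1) that] by simp
    also have "\<dots> \<longleftrightarrow> x - y \<in> U"
    proof
      assume "f (x - y) \<in> f ` U"
      then obtain u where u: "u \<in> U" "f (x - y) = f u" by auto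
      then have "u \<in> W" "x - y \<in> W" using U(2) that W by (auto intro: add_subgroup_diff)
      then have "x - y - u = 0"
        using additive_on_diff[OF W f(1), of "x - y" u] u f(2)[of "x - y - u"] add_subgroup_diff[OF W]
        by simp
      then show "x - y \<in> U" using u by simp
    qed auto
    finally show ?thesis
      using add_coset_eq_iff[OF additive_on_image[OF W f(1) U]] by simp
  qed
  then have "add_index W U = card ((\<lambda>x. add_coset (f ` U) (f x)) ` W)"
    by (intro add_index_eq_card_image[OF U(1)])
  then show ?thesis by (simp add: add_index_def image_image)
qed

definition multiples :: "nat \<Rightarrow> 'v::comm_ring_1 set \<Rightarrow> 'v set" where
  "multiples n X = (*) (of_nat n) ` X"

lemma additive_of_nat_mult: "additive_on X (\<lambda>x::'v::comm_ring_1. of_nat n * x)"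
  by (simp add: additive_on_def algebra_simps)

lemma add_subgroup_multiples: "add_subgroup X \<Longrightarrow> add_subgroup (multiples n X)"
  unfolding multiples_def by (rule additive_on_image[OF _ additive_of_nat_mult]) auto

lemma multiples_subset: "add_subgroup X \<Longrightarrow> multiples n X \<subseteq> X"
  unfolding multiples_def using add_subgroup_of_nat_mult by blast

lemma multiples_mono: "X \<subseteq> Y \<Longrightarrow> multiples n X \<subseteq> multiples n Y"
  unfolding multiples_def by blast

lemma multiples_multiples: "multiples m (multiples n X) = multiples (m * n) X"
  unfolding multiples_def by (simp add: image_image mult.assoc)

lemma multiplesI: "x \<in> X \<Longrightarrow> of_nat n * x \<in> multiples n X"
  unfolding multiples_def by blast

lemma multiplesE: "y \<in> multiples n X \<Longrightarrow> (\<And>x. x \<in> X \<Longrightarrow> y = of_nat n * x \<Longrightarrow> P) \<Longrightarrow> P"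
  unfolding multiples_def by blast


section \<open>Uniserial lattices\<close>

text \<open>Orbit lengths are powers of p. If x0 were the only fixed point, all other orbits would
  have length divisible by p, and \<open>card E\<close> would be 1 modulo p.\<close>

lemma (in group_action) p_group_second_fixed_point:
  assumes "prime p" "order G = p ^ e" "finite E" "p dvd card E"
    and x0: "x0 \<in> E" "\<And>g. g \<in> carrier G \<Longrightarrow> \<phi> g x0 = x0"
  shows "\<exists>x\<in>E. x \<noteq> x0 \<and> (\<forall>g\<in>carrier G. \<phi> g x = x)"
proof (rule ccontr)
  assume no: "\<not> ?thesis"
  have o0: "orbit G \<phi> x0 = {x0}"
    using x0 orbit_refl[OF x0(1)] by (auto simp: orbit_def)
  have o0_in: "{x0} \<in> orbits G E \<phi>" using x0(1) o0 by (auto simp: orbits_def)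
  have fin: "finite (orbits G E \<phi>)"
    using \<open>finite E\<close> by (simp add: orbits_def setcompr_eq_image)
  have dvd: "p dvd card orb" if orb: "orb \<in> orbits G E \<phi> - {{x0}}" for orb
  proof -
    obtain x where x: "x \<in> E" "orb = orbit G \<phi> x" using orb by (auto simp: orbits_def)
    have "card orb dvd p ^ e"
      using orbit_stabilizer_theorem[OF x(1)] assms(2) x(2) by (metis dvd_triv_left)
    then obtain i where i: "card orb = p ^ i" using \<open>prime p\<close> divides_primepow_nat by blast
    show ?thesis
    proof (cases i)
      case 0
      then obtain y where "orb = {y}" using i by (auto simp: card_1_singleton_iff)
      then have "orbit G \<phi> x = {x}" using x orbit_refl[OF x(1)] by auto
      then have "\<forall>g\<in>carrier G. \<phi> g x = x" by (auto simp: orbit_def)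
      then have "x = x0" using no x(1) by blast
      then show ?thesis using orb x(2) o0 by simp
    qed (simp add: i)
  qed
  have "card E = (\<Sum>orb\<in>orbits G E \<phi>. card orb)"
    using disjoint_sum[OF \<open>finite E\<close>, of "\<lambda>x. 1::nat"] by simp
  also have "\<dots> = 1 + (\<Sum>orb\<in>orbits G E \<phi> - {{x0}}. card orb)"
    using sum.remove[OF fin o0_in, of card] by simp
  finally have "card E = 1 + (\<Sum>orb\<in>orbits G E \<phi> - {{x0}}. card orb)" .
  moreover have "p dvd (\<Sum>orb\<in>orbits G E \<phi> - {{x0}}. card orb)"
    by (rule dvd_sum) (rule dvd)
  ultimately have "p dvd 1" using \<open>p dvd card E\<close> dvd_add_left_iff by metis
  then show False using \<open>prime p\<close> not_prime_unit by blast
qed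

text \<open>\<open>Vs_commutator\<close> and \<open>Vs_least\<close> together say that
  \<open>Vs (Suc i)\<close> is the commutator [R, \<open>Vs i\<close>], without mention of generated
  subgroups. The rank d of T is present as the index of pV in V.\<close>

locale uniserial_lattice = additive_rep R V A
  for R :: "'g monoid" (structure) and V :: "'v::comm_ring_1 set" and A +
  fixes p e d :: nat and Vs :: "nat \<Rightarrow> 'v set"
  assumes prime: "prime p" and order_R: "order R = p ^ e"
    and Vs_0: "Vs 0 = V"
    and Vs_subgroup: "add_subgroup (Vs i)"
    and Vs_commutator: "x \<in> Vs i \<Longrightarrow> g \<in> carrier R \<Longrightarrow> A x g - x \<in> Vs (Suc i)"
    and Vs_least: "add_subgroup U \<Longrightarrow> (\<And>x g. x \<in> Vs i \<Longrightarrow> g \<in> carrier R \<Longrightarrow> A x g - x \<in> U) \<Longrightarrow>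
      Vs (Suc i) \<subseteq> U"
    and Vs_index: "add_index (Vs i) (Vs (Suc i)) = p"
    and p_mult_Vs: "x \<in> Vs i \<Longrightarrow> of_nat p * x \<in> Vs (Suc i)"
    and torsion_free: "x \<in> V \<Longrightarrow> of_nat p * x = 0 \<Longrightarrow> x = 0"
    and V_index: "add_index V (multiples p V) = p ^ d"
begin

lemma finite_R: "finite (carrier R)"
  using order_R prime prime_gt_0_nat[of p] by (auto simp: order_def intro: card_ge_0_finite)

lemma Vs_Suc_subset: "Vs (Suc i) \<subseteq> Vs i"
proof (induction i)
  case 0
  show ?case by (rule Vs_least) (auto simp: Vs_0 V A_closed add_subgroup_diff)
next
  case (Suc i)
  show ?case by (rule Vs_least[OF Vs_subgroup]) (use Suc Vs_commutator in blast)
qed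

lemma Vs_antimono: "i \<le> j \<Longrightarrow> Vs j \<subseteq> Vs i"
  using lift_Suc_antimono_le[of Vs i j] Vs_Suc_subset by blast

lemma Vs_subset: "Vs i \<subseteq> V"
  using Vs_antimono[of 0 i] Vs_0 by simp

lemma Vs_invariant: "invariant (Vs i)"
  unfolding invariant_def
proof (intro ballI)
  fix x g assume "x \<in> Vs i" "g \<in> carrier R"
  then have "A x g - x \<in> Vs i" using Vs_commutator Vs_Suc_subset by blast
  then show "A x g \<in> Vs i"
    using add_subgroup_add[OF Vs_subgroup[of i], of "A x g - x" x] \<open>x \<in> Vs i\<close> by simp
qed

lemma V_Vs_index: "add_index V (Vs n) = p ^ n"
proof (induction n)
  case 0
  show ?case using add_index_self[OF V] by (simp add: Vs_0)
next
  case (Suc n)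
  then show ?case
    using add_index_mult[OF Vs_subgroup Vs_subgroup V Vs_Suc_subset Vs_subset, of n] Vs_index
    by simp
qed

lemma Vs_strict: "i < j \<Longrightarrow> \<not> Vs i \<subseteq> Vs j"
proof
  assume "i < j" "Vs i \<subseteq> Vs j"
  then have "Vs i = Vs (Suc i)" using Vs_antimono[of "Suc i" j] Vs_Suc_subset[of i] by auto
  then have "p = 1" using Vs_index[of i] add_index_self[OF Vs_subgroup[of i]] by metis
  then show False using prime by simp
qed

text \<open>One application of \<open>p_mult_Vs\<close> per step. It supplies the bound p^m that the
  lifting of maps modulo T_m will require of its modulus.\<close>

lemma p_power_mult_Vs: "multiples (p ^ m) V \<subseteq> Vs m"
proof (induction m)
  case 0
  then show ?case by (simp add: Vs_0 multiples_def)
next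
  case (Suc m)
  show ?case
  proof
    fix y assume "y \<in> multiples (p ^ Suc m) V"
    then obtain x where "x \<in> V" "y = of_nat (p ^ Suc m) * x" by (rule multiplesE)
    then have "y = of_nat p * (of_nat (p ^ m) * x)" "of_nat (p ^ m) * x \<in> Vs m"
      using Suc by (auto simp: mult.assoc multiples_def)
    then show "y \<in> Vs (Suc m)" using p_mult_Vs by simp
  qed
qed

lemma torsion_free_power: "x \<in> V \<Longrightarrow> of_nat (p ^ m) * x = 0 \<Longrightarrow> x = 0"
proof (induction m)
  case (Suc m)
  have "of_nat p * (of_nat (p ^ m) * x) = 0" using Suc.prems by (simp add: mult.assoc)
  then have "of_nat (p ^ m) * x = 0" using torsion_free add_subgroup_of_nat_mult[OF V] Suc.prems by blast
  then show ?case using Suc by simp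
qed simp

lemma cancel_power:
  assumes "x \<in> V" "y \<in> V" "of_nat (p ^ m) * x = of_nat (p ^ m) * y"
  shows "x = y"
  using torsion_free_power[of "x - y" m] assms add_subgroup_diff[OF V] by (simp add: right_diff_distrib)

lemma cancel_p: "x \<in> V \<Longrightarrow> y \<in> V \<Longrightarrow> of_nat p * x = of_nat p * y \<Longrightarrow> x = y"
  using cancel_power[of x y 1] by simp

text \<open>The usual argument for the nilpotency of the action of a \<open>p\<close>-group on a finite \<open>p\<close>-group:
  fixed points in the quotient.\<close>

lemma fixed_coset:
  assumes N: "add_subgroup N" "N \<subseteq> V" "invariant N" and dvd: "p dvd add_index V N"
    and pos: "add_index V N > 0"
  shows "\<exists>v\<in>V - N. \<forall>g\<in>carrier R. A v g - v \<in> N"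
proof -
  define E where "E = add_coset N ` V"
  \<comment> \<open>The inverse turns the right action A into a left action, as
    \<open>group_action\<close> demands; the cosets fixed by the whole group are the same.\<close>
  define \<phi> where "\<phi> g = (\<lambda>C\<in>E. (\<lambda>x. A x (inv g)) ` C)" for g
  have img: "(\<lambda>x. A x g) ` add_coset N v = add_coset N (A v g)" if "v \<in> V" "g \<in> carrier R" for v g
  proof -
    have "(\<lambda>x. A x g) ` add_coset N v = add_coset ((\<lambda>x. A x g) ` N) (A v g)"
      using that N by (force simp: add_coset_def image_image A_add)
    also have "(\<lambda>x. A x g) ` N = N"
    proof (intro equalityI subsetI)
      fix n assume "n \<in> N"
      then have "A (A n (inv g)) g = n" "A n (inv g) \<in> N"
        using that N by (auto simp: A_mult[symmetric] A_one invariantD subset_iff)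
      then show "n \<in> (\<lambda>x. A x g) ` N" by force
    qed (use that N in \<open>auto simp: invariantD\<close>)
    finally show ?thesis .
  qed
  have \<phi>: "\<phi> g (add_coset N v) = add_coset N (A v (inv g))" if "v \<in> V" "g \<in> carrier R" for v g
    using that img by (simp add: \<phi>_def E_def)
  have \<phi>_inv: "\<phi> (inv g) (\<phi> g C) = C" "\<phi> g C \<in> E" if "C \<in> E" "g \<in> carrier R" for g C
    using that by (auto simp: E_def \<phi> A_closed A_mult[symmetric] A_one)
  have Bij: "\<phi> g \<in> Bij E" if g: "g \<in> carrier R" for g
  proof -
    have "bij_betw (\<phi> g) E E"
      using g \<phi>_inv[OF _ g] \<phi>_inv[of _ "inv g"]
      by (intro bij_betw_byWitness[of _ "\<phi> (inv g)"]) auto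
    then show ?thesis by (simp add: Bij_def \<phi>_def)
  qed
  have "\<phi> \<in> hom R (BijGroup E)"
  proof (rule homI)
    fix g assume "g \<in> carrier R"
    then show "\<phi> g \<in> carrier (BijGroup E)" using Bij by (simp add: BijGroup_def)
  next
    fix g h assume gh: "g \<in> carrier R" "h \<in> carrier R"
    have "\<phi> (g \<otimes> h) = compose E (\<phi> g) (\<phi> h)"
    proof
      fix C
      show "\<phi> (g \<otimes> h) C = compose E (\<phi> g) (\<phi> h) C"
      proof (cases "C \<in> E")
        case True
        then show ?thesis using gh
          by (auto simp: E_def \<phi> compose_def A_closed A_mult[symmetric] inv_mult_group)
      qed (simp add: \<phi>_def compose_def)
    qed
    then show "\<phi> (g \<otimes> h) = \<phi> g \<otimes>\<^bsub>BijGroup E\<^esub> \<phi> h" using gh Bij by (simp add: BijGroup_def)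
  qed
  then interpret act: group_action R E \<phi>
    by (intro group_action.intro group_hom.intro group_hom_axioms.intro is_group group_BijGroup)
  have N_coset: "add_coset N 0 = N" by (simp add: add_coset_def)
  have "\<phi> g N = N" if "g \<in> carrier R" for g
    using \<phi>[of 0 g] that V by (simp add: add_subgroup_zero A_zero N_coset)
  moreover have "N \<in> E" unfolding E_def using N_coset add_subgroup_zero[OF V] by (metis imageI)
  moreover have "finite E" using pos unfolding add_index_def E_def by (rule card_ge_0_finite)
  ultimately obtain C where C: "C \<in> E" "C \<noteq> N" "\<forall>g\<in>carrier R. \<phi> g C = C"
    using act.p_group_second_fixed_point[OF prime order_R, of N] dvd
    unfolding add_index_def E_def by blast
  then obtain v where v: "v \<in> V" "C = add_coset N v" by (auto simp: E_def)
  have "v \<notin> N" using C(2) v add_coset_eq_iff[OF N(1), of v 0] N_coset by auto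
  moreover have "A v g - v \<in> N" if g: "g \<in> carrier R" for g
  proof -
    have "add_coset N (A v (inv (inv g))) = add_coset N v"
      using C(3) v \<phi>[of v "inv g"] g by simp
    then show ?thesis using g add_coset_eq_iff[OF N(1)] by simp
  qed
  ultimately show ?thesis using v by blast
qed

text \<open>Induction on the index of N. The preimage U of the fixed points of V/N is invariant and
  strictly larger than N by \<open>fixed_coset\<close>, so it contains some T_j; then T_(j+1) =
  [R, T_j] lies in [R, U] and hence in N.\<close>

lemma Vs_eventually_subset:
  assumes "add_subgroup N" "N \<subseteq> V" "invariant N" "add_index V N = p ^ s"
  shows "\<exists>j. Vs j \<subseteq> N"
  using assms
proof (induction s arbitrary: N rule: less_induct)
  case (less s)
  note N = less.prems
  show ?case
  proof (cases s)
    case 0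
    then have "V \<subseteq> N" using N V by (intro add_index_eq_1_imp_subset) auto
    then show ?thesis using Vs_0 by blast
  next
    case (Suc s')
    then obtain v where v: "v \<in> V" "v \<notin> N" "\<forall>g\<in>carrier R. A v g - v \<in> N"
      using fixed_coset[OF N(1-3)] N(4) prime prime_gt_0_nat[of p] by auto
    \<comment> \<open>The preimage in V of the fixed points of V/N.\<close>
    define U where "U = {v\<in>V. \<forall>g\<in>carrier R. A v g - v \<in> N}"
    have U: "add_subgroup U"
      unfolding add_subgroup_def
    proof (intro conjI ballI)
      show "0 \<in> U" using V N by (simp add: U_def A_zero add_subgroup_zero)
      fix x y assume xy: "x \<in> U" "y \<in> U"
      have "A (x - y) g - (x - y) \<in> N" if g: "g \<in> carrier R" for g
      proof -
        have eq: "A (x - y) g - (x - y) = (A x g - x) - (A y g - y)"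
          using xy g by (simp add: U_def A_diff algebra_simps)
        have "A x g - x \<in> N" "A y g - y \<in> N" using xy g by (auto simp: U_def)
        from add_subgroup_diff[OF N(1) this] show ?thesis by (simp only: eq)
      qed
      then show "x - y \<in> U" using xy V by (simp add: U_def add_subgroup_diff)
    qed
    have U_inv: "invariant U"
      unfolding invariant_def
    proof (intro ballI)
      fix x h assume x: "x \<in> U" and h: "h \<in> carrier R"
      have "A (A x h) g - A x h \<in> N" if g: "g \<in> carrier R" for g
      proof -
        have eq: "A (A x h) g - A x h = (A x (h \<otimes> g) - x) - (A x h - x)"
          using x h g by (simp add: U_def A_mult)
        have "A x (h \<otimes> g) - x \<in> N" "A x h - x \<in> N" using x h g by (auto simp: U_def)
        from add_subgroup_diff[OF N(1) this] show ?thesis by (simp only: eq)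
      qed
      then show "A x h \<in> U" using x h by (simp add: U_def A_closed)
    qed
    have UV: "U \<subseteq> V" by (auto simp: U_def)
    have NU: "N \<subseteq> U" using N by (auto simp: U_def invariantD add_subgroup_diff subset_iff)
    have index: "p ^ s = add_index V U * add_index U N"
      using add_index_mult[OF N(1) U V NU UV] N(4) by simp
    then have "add_index V U dvd p ^ s" by simp
    then obtain s'' where s'': "add_index V U = p ^ s''" "s'' \<le> s"
      using prime divides_primepow_nat by blast
    have "s'' \<noteq> s"
    proof
      assume "s'' = s"
      then have "add_index U N = 1" using index s'' prime prime_gt_0_nat[of p] by simp
      then show False using add_index_eq_1_imp_subset[OF N(1) U] v by (auto simp: U_def)
    qed
    then obtain j where j: "Vs j \<subseteq> U" using less.IH[of s'' U] U UV U_inv s'' by auto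
    have "Vs (Suc j) \<subseteq> N"
      by (rule Vs_least[OF N(1)]) (use j in \<open>auto simp: U_def\<close>)
    then show ?thesis by blast
  qed
qed

section \<open>Invariant subgroups of p-power index are terms of the series\<close>

definition add_sum :: "'v set \<Rightarrow> 'v set \<Rightarrow> 'v set" where
  "add_sum M N = {x + y | x y. x \<in> M \<and> y \<in> N}"

lemma add_sumI: "x \<in> M \<Longrightarrow> y \<in> N \<Longrightarrow> x + y \<in> add_sum M N"
  by (auto simp: add_sum_def)

lemma add_subgroup_add_sum:
  assumes "add_subgroup M" "add_subgroup N" shows "add_subgroup (add_sum M N)"
  unfolding add_subgroup_def
proof (intro conjI ballI)
  show "0 \<in> add_sum M N" using add_sumI[of 0 M 0 N] assms by (simp add: add_subgroup_zero)
  fix x y assume "x \<in> add_sum M N" "y \<in> add_sum M N"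
  then obtain a b a' b' where "a \<in> M" "b \<in> N" "x = a + b" "a' \<in> M" "b' \<in> N" "y = a' + b'"
    by (auto simp: add_sum_def)
  then show "x - y \<in> add_sum M N"
    using add_sumI[of "a - a'" M "b - b'" N] assms by (simp add: add_subgroup_diff algebra_simps)
qed

text \<open>A Nakayama argument. Take the last T_i that contains N. As T_i / T_(i+1) has prime
  order, T_i = N + T_(i+1). Taking commutators with R improves T_i = N + T_(i+1+k) to T_i = N +
  T_(i+2+k), and since some T_j lies in N, finally T_i = N. Comparing indices gives i = s.\<close>

lemma invariant_subgroup_eq_Vs:
  assumes N: "add_subgroup N" "N \<subseteq> V" "invariant N" "add_index V N = p ^ s"
  shows "N = Vs s"
proof -
  obtain j where j: "Vs j \<subseteq> N" using Vs_eventually_subset[OF N] by blast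
  have "\<exists>i. N \<subseteq> Vs i \<and> \<not> N \<subseteq> Vs (Suc i)"
  proof (rule ccontr)
    assume "\<not> ?thesis"
    then have "N \<subseteq> Vs i" for i using N(2) Vs_0 by (induction i) auto
    then show False using Vs_strict[of j "Suc j"] j by (meson lessI order_trans)
  qed
  then obtain i where i: "N \<subseteq> Vs i" "\<not> N \<subseteq> Vs (Suc i)" by blast
  have sum1: "Vs i \<subseteq> add_sum N (Vs (Suc i))"
  proof -
    let ?M = "add_sum N (Vs (Suc i))"
    have M: "add_subgroup ?M" using N Vs_subgroup by (intro add_subgroup_add_sum)
    have "Vs (Suc i) \<subseteq> ?M" using add_sumI[of 0 N] N by (force simp: add_subgroup_zero)
    moreover have "N \<subseteq> ?M" using add_sumI[of _ N 0] Vs_subgroup by (force simp: add_subgroup_zero)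
    moreover have "?M \<subseteq> Vs i"
      using i(1) Vs_Suc_subset[of i] add_subgroup_add[OF Vs_subgroup[of i]] by (auto simp: add_sum_def)
    ultimately have idx: "p = add_index (Vs i) ?M * add_index ?M (Vs (Suc i))"
      using add_index_mult[OF Vs_subgroup M Vs_subgroup, of "Suc i" i] Vs_index[of i] by simp
    have "add_index ?M (Vs (Suc i)) \<noteq> 1"
      using add_index_eq_1_imp_subset[OF Vs_subgroup M] i(2) \<open>N \<subseteq> ?M\<close> by blast
    then have "add_index (Vs i) ?M = 1"
      using idx prime prime_product by metis
    then show ?thesis using add_index_eq_1_imp_subset[OF M Vs_subgroup] by blast
  qed
  have sumk: "Vs i \<subseteq> add_sum N (Vs (Suc i + k))" for k
  proof (induction k)
    case 0
    then show ?case using sum1 by simp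
  next
    case (Suc k)
    \<comment> \<open>If x = y + z with y in N and z in T_(i+1+k), the commutator of y stays in N
      and that of z drops by one step.\<close>
    have "Vs (Suc i) \<subseteq> add_sum N (Vs (Suc i + Suc k))"
    proof (rule Vs_least)
      show "add_subgroup (add_sum N (Vs (Suc i + Suc k)))"
        using N Vs_subgroup by (intro add_subgroup_add_sum)
      fix x g assume "x \<in> Vs i" and g: "g \<in> carrier R"
      then obtain y z where y: "y \<in> N" and z: "z \<in> Vs (Suc i + k)" and x: "x = y + z"
        using Suc by (auto simp: add_sum_def)
      have "A x g - x = (A y g - y) + (A z g - z)"
        using y z x g N(2) Vs_subset by (simp add: A_add subset_iff)
      moreover have "A y g - y \<in> N" using N y g by (simp add: invariantD add_subgroup_diff)
      ultimately show "A x g - x \<in> add_sum N (Vs (Suc i + Suc k))"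
        using Vs_commutator[OF z g] add_sumI by simp
    qed
    then have "add_sum N (Vs (Suc i)) \<subseteq> add_sum N (Vs (Suc i + Suc k))"
      using N add_sumI[of _ N] by (fastforce simp: add_sum_def add.assoc[symmetric] intro: add_subgroup_add)
    then show ?case using sum1 by blast
  qed
  have "Vs (Suc i + j) \<subseteq> N" using j Vs_antimono[of j "Suc i + j"] by auto
  then have "Vs i \<subseteq> N"
    using sumk[of j] add_subgroup_add[OF N(1)] by (fastforce simp: add_sum_def)
  then have "N = Vs i" using i by blast
  moreover from this have "p ^ i = p ^ s" using N(4) V_Vs_index by simp
  then have "i = s" using prime prime_gt_1_nat[of p] by simp
  ultimately show ?thesis by simp
qed

text \<open>pT_n is invariant, and since multiplication by p is injective its index is [V : pV]
  [pV : pT_n] = p^d p^n. By \<open>invariant_subgroup_eq_Vs\<close> the index determines the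
  term.\<close>

lemma multiples_p_Vs: "multiples p (Vs n) = Vs (n + d)"
proof (rule invariant_subgroup_eq_Vs)
  show sub: "add_subgroup (multiples p (Vs n))" by (rule add_subgroup_multiples[OF Vs_subgroup])
  have sub': "multiples p (Vs n) \<subseteq> Vs n" by (rule multiples_subset[OF Vs_subgroup])
  then show "multiples p (Vs n) \<subseteq> V" using Vs_subset by blast
  show "invariant (multiples p (Vs n))"
    unfolding invariant_def multiples_def
    using Vs_subset Vs_invariant by (auto simp: A_of_nat_mult subset_iff invariantD)
  have inj: "\<And>x. x \<in> V \<Longrightarrow> of_nat p * x = 0 \<Longrightarrow> x = 0" by (rule torsion_free)
  have pV: "add_subgroup (multiples p V)" "multiples p V \<subseteq> V"
    using add_subgroup_multiples[OF V] multiples_subset[OF V] by auto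
  have "add_index V (multiples p (Vs n)) =
      add_index V (multiples p V) * add_index (multiples p V) (multiples p (Vs n))"
    using add_index_mult[OF sub pV(1) V multiples_mono[OF Vs_subset] pV(2)] by simp
  also have "add_index (multiples p V) (multiples p (Vs n)) = add_index V (Vs n)"
    unfolding multiples_def
    by (rule add_index_image[OF V Vs_subgroup Vs_subset additive_of_nat_mult inj])
  finally show "add_index V (multiples p (Vs n)) = p ^ (n + d)"
    by (simp add: V_index V_Vs_index power_add mult.commute)
qed

lemma multiples_p_power_Vs: "multiples (p ^ j) (Vs n) = Vs (n + j * d)"
proof (induction j)
  case 0
  then show ?case by (simp add: multiples_def)
next
  case (Suc j)
  have "multiples (p ^ Suc j) (Vs n) = multiples p (multiples (p ^ j) (Vs n))"
    by (simp add: multiples_multiples)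
  also have "\<dots> = Vs (n + j * d + d)" by (simp add: Suc multiples_p_Vs)
  finally show ?case by (simp add: algebra_simps)
qed

end

section \<open>The canonical decomposition of the second cohomology\<close>

lemma (in comm_group) comm_group_subgroup:
  assumes "subgroup H G" shows "comm_group (G\<lparr>carrier := H\<rparr>)"
proof (rule group.group_comm_groupI[OF subgroup_imp_group[OF assms]])
  fix x y assume "x \<in> carrier (G\<lparr>carrier := H\<rparr>)" "y \<in> carrier (G\<lparr>carrier := H\<rparr>)"
  then show "x \<otimes>\<^bsub>G\<lparr>carrier := H\<rparr>\<^esub> y = y \<otimes>\<^bsub>G\<lparr>carrier := H\<rparr>\<^esub> x"
    using subgroup.subset[OF assms] m_comm by auto
qed

text \<open>\<psi> is an equivariant isomorphism of V onto the multiplicatively written T; subgroups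
  of T are handled as images of subgroups of V.\<close>

locale embedded_module = additive_rep R V A
  for R :: "'g monoid" (structure) and V :: "'v::comm_ring_1 set" and A +
  fixes T :: "'w monoid" and act :: "'w \<Rightarrow> 'g \<Rightarrow> 'w" and \<psi> :: "'v \<Rightarrow> 'w"
  assumes T: "comm_group T"
    and \<psi>_closed: "x \<in> V \<Longrightarrow> \<psi> x \<in> carrier T"
    and \<psi>_surj: "t \<in> carrier T \<Longrightarrow> \<exists>x\<in>V. \<psi> x = t"
    and \<psi>_add: "x \<in> V \<Longrightarrow> y \<in> V \<Longrightarrow> \<psi> (x + y) = \<psi> x \<otimes>\<^bsub>T\<^esub> \<psi> y"
    and \<psi>_kernel: "x \<in> V \<Longrightarrow> \<psi> x = \<one>\<^bsub>T\<^esub> \<longleftrightarrow> x = 0"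
    and \<psi>_act: "x \<in> V \<Longrightarrow> g \<in> carrier R \<Longrightarrow> act (\<psi> x) g = \<psi> (A x g)"
begin

interpretation T: comm_group T by (rule T)

lemma presented_T: "presented_module R V A T act V {0} \<psi>"
  by unfold_locales
    (use T \<psi>_closed \<psi>_surj \<psi>_add \<psi>_kernel \<psi>_act V invariant_V add_subgroup_trivial in
      \<open>auto simp: add_subgroup_zero\<close>)

interpretation pT: presented_module R V A T act V "{0}" \<psi> by (rule presented_T)

lemma subgroup_image:
  assumes X: "add_subgroup X" "X \<subseteq> V"
  shows "subgroup (\<psi> ` X) T"
proof (rule subgroup.intro)
  show "\<psi> ` X \<subseteq> carrier T" using X \<psi>_closed by auto
  show "\<one>\<^bsub>T\<^esub> \<in> \<psi> ` X" using pT.\<rho>_zero add_subgroup_zero[OF X(1)] by force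
  fix x y assume "x \<in> \<psi> ` X" "y \<in> \<psi> ` X"
  then obtain a b where "a \<in> X" "b \<in> X" "x = \<psi> a" "y = \<psi> b" by auto
  then show "x \<otimes>\<^bsub>T\<^esub> y \<in> \<psi> ` X"
    using \<psi>_add[of a b] add_subgroup_add[OF X(1), of a b] X(2) by (metis imageI subsetD)
next
  fix x assume "x \<in> \<psi> ` X"
  then obtain a where "a \<in> X" "x = \<psi> a" by auto
  then show "inv\<^bsub>T\<^esub> x \<in> \<psi> ` X"
    using pT.\<rho>_uminus[of a] add_subgroup_uminus[OF X(1), of a] X(2) by (metis imageI subsetD)
qed

lemma \<psi>_mem_image_iff:
  assumes "x \<in> V" "K \<subseteq> V" shows "\<psi> x \<in> \<psi> ` K \<longleftrightarrow> x \<in> K"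
proof
  assume "\<psi> x \<in> \<psi> ` K"
  then obtain k where "k \<in> K" "\<psi> x = \<psi> k" by auto
  then show "x \<in> K" using pT.\<rho>_eq_iff[of x k] assms by auto
qed auto

lemma presented_sub:
  assumes X: "add_subgroup X" "X \<subseteq> V" "invariant X"
  shows "presented_module R V A (T\<lparr>carrier := \<psi> ` X\<rparr>) act X {0} \<psi>"
proof -
  interpret TX: comm_group "T\<lparr>carrier := \<psi> ` X\<rparr>"
    by (rule T.comm_group_subgroup[OF subgroup_image[OF X(1,2)]])
  show ?thesis
    by unfold_locales
      (use X TX.comm_group_axioms \<psi>_add \<psi>_kernel \<psi>_act V add_subgroup_trivial in
        \<open>auto simp: add_subgroup_zero subset_iff\<close>)
qed

text \<open>Each g permutes K, since K is also invariant under the inverse of g; hence acting on the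
  elements of a coset of K produces a full coset.\<close>

lemma quot_act_coset:
  assumes K: "add_subgroup K" "K \<subseteq> V" "invariant K" and x: "x \<in> V" and g: "g \<in> carrier R"
  shows "quot_act act (\<psi> ` K #>\<^bsub>T\<^esub> \<psi> x) g = \<psi> ` K #>\<^bsub>T\<^esub> \<psi> (A x g)"
proof -
  have coset: "\<psi> ` K #>\<^bsub>T\<^esub> \<psi> y = (\<lambda>k. \<psi> (k + y)) ` K" if "y \<in> V" for y
    unfolding r_coset_def using that K(2) by (auto simp: \<psi>_add subset_iff)
  have "quot_act act (\<psi> ` K #>\<^bsub>T\<^esub> \<psi> x) g = (\<lambda>k. \<psi> (A k g + A x g)) ` K"
    unfolding quot_act_def coset[OF x] image_image
  proof (rule image_cong[OF refl])
    fix k assume "k \<in> K"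
    then have k: "k \<in> V" using K by blast
    show "act (\<psi> (k + x)) g = \<psi> (A k g + A x g)"
      using \<psi>_act[of "k + x" g] k x g by (simp add: add_subgroup_add[OF V] A_add)
  qed
  also have "\<dots> = (\<lambda>k. \<psi> (k + A x g)) ` (\<lambda>k. A k g) ` K" by (simp add: image_image)
  also have "(\<lambda>k. A k g) ` K = K"
  proof (intro equalityI subsetI)
    fix k assume "k \<in> K"
    then have "A (A k (inv g)) g = k" "A k (inv g) \<in> K"
      using g K by (auto simp: A_mult[symmetric] A_one invariantD subset_iff)
    then show "k \<in> (\<lambda>k. A k g) ` K" by force
  qed (use g K in \<open>auto simp: invariantD\<close>)
  finally show ?thesis using coset[OF A_closed[OF x g]] by simp
qed

lemma presented_quot:
  assumes X: "add_subgroup X" "X \<subseteq> V" "invariant X"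
    and K: "add_subgroup K" "K \<subseteq> X" "invariant K"
  shows "presented_module R V A (T\<lparr>carrier := \<psi> ` X\<rparr> Mod \<psi> ` K) (quot_act act) X K
    (\<lambda>x. \<psi> ` K #>\<^bsub>T\<^esub> \<psi> x)"
proof -
  let ?TX = "T\<lparr>carrier := \<psi> ` X\<rparr>"
  interpret TX: comm_group ?TX
    by (rule T.comm_group_subgroup[OF subgroup_image[OF X(1,2)]])
  have KV: "K \<subseteq> V" using X K by blast
  have sub: "subgroup (\<psi> ` K) ?TX"
    by (rule T.subgroup_incl[OF subgroup_image[OF K(1) KV] subgroup_image[OF X(1,2)]])
      (use K in auto)
  interpret N: normal "\<psi> ` K" ?TX
    by (rule TX.subgroup_imp_normal[OF sub])
  have coset: "\<psi> ` K #>\<^bsub>?TX\<^esub> t = \<psi> ` K #>\<^bsub>T\<^esub> t" for t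
    by (simp add: r_coset_def)
  have setmult: "M <#>\<^bsub>?TX\<^esub> M' = M <#>\<^bsub>T\<^esub> M'" for M M'
    by (simp add: set_mult_def)
  show ?thesis
  proof (intro presented_module.intro presented_module_axioms.intro additive_rep_axioms X K(1,2))
    show "comm_group (?TX Mod \<psi> ` K)" by (rule TX.abelian_FactGroup[OF sub])
  next
    fix x assume "x \<in> X"
    then show "\<psi> ` K #>\<^bsub>T\<^esub> \<psi> x \<in> carrier (?TX Mod \<psi> ` K)"
      unfolding FactGroup_def RCOSETS_def by (auto simp: coset)
  next
    fix w assume "w \<in> carrier (?TX Mod \<psi> ` K)"
    then show "\<exists>x\<in>X. \<psi> ` K #>\<^bsub>T\<^esub> \<psi> x = w"
      unfolding FactGroup_def RCOSETS_def by (auto simp: coset)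
  next
    fix x y assume "x \<in> X" "y \<in> X"
    then have "\<psi> x \<in> carrier ?TX" "\<psi> y \<in> carrier ?TX" "x \<in> V" "y \<in> V" using X by auto
    then show "\<psi> ` K #>\<^bsub>T\<^esub> \<psi> (x + y) =
        (\<psi> ` K #>\<^bsub>T\<^esub> \<psi> x) \<otimes>\<^bsub>?TX Mod \<psi> ` K\<^esub> (\<psi> ` K #>\<^bsub>T\<^esub> \<psi> y)"
      using N.rcos_sum[of "\<psi> x" "\<psi> y"] by (simp add: FactGroup_def coset setmult \<psi>_add)
  next
    fix x assume x: "x \<in> X"
    then have xV: "x \<in> V" using X by blast
    have "\<psi> ` K #>\<^bsub>T\<^esub> \<psi> x = \<psi> ` K \<longleftrightarrow> \<psi> x \<in> \<psi> ` K"
      using T.coset_join1[OF _ _ subgroup_image[OF K(1) KV], of "\<psi> x"]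
        T.coset_join2[OF _ subgroup_image[OF K(1) KV], of "\<psi> x"] \<psi>_closed[OF xV]
        subgroup.subset[OF subgroup_image[OF K(1) KV]] by blast
    then show "(\<psi> ` K #>\<^bsub>T\<^esub> \<psi> x = \<one>\<^bsub>?TX Mod \<psi> ` K\<^esub>) = (x \<in> K)"
      using \<psi>_mem_image_iff[OF xV KV] by (simp add: FactGroup_def)
  next
    fix x g assume "x \<in> X" "g \<in> carrier R"
    then show "quot_act act (\<psi> ` K #>\<^bsub>T\<^esub> \<psi> x) g = \<psi> ` K #>\<^bsub>T\<^esub> \<psi> (A x g)"
      using X by (intro quot_act_coset[OF K(1) KV K(3)]) auto
  qed
qed

lemma \<psi>_pow: "x \<in> V \<Longrightarrow> \<psi> x [^]\<^bsub>T\<^esub> (k::nat) = \<psi> (of_nat k * x)"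
  by (rule pT.\<rho>_pow)

lemma carrier_T: "\<psi> ` V = carrier T"
  using \<psi>_closed \<psi>_surj by auto

end

locale embedded_lattice =
  uniserial_lattice R V A p e d Vs + embedded_module R V A T act \<psi>
  for R :: "'g monoid" (structure) and V :: "'v::comm_ring_1 set" and A p e d Vs
    and T :: "'w monoid" and act \<psi> +
  assumes \<psi>_Vs: "\<psi> ` Vs i = action_series R T act i"
begin

section \<open>The coefficient modules built from the terms T_n\<close>

abbreviation S :: "nat \<Rightarrow> 'w set" where "S n \<equiv> action_series R T act n"

abbreviation q :: nat where "q \<equiv> p ^ e"

interpretation T: comm_group T by (rule T)

interpretation pT: presented_module R V A T act V "{0}" \<psi> by (rule presented_T)

abbreviation red :: "nat \<Rightarrow> 'v \<Rightarrow> 'w set" where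
  "red n x \<equiv> S n #>\<^bsub>T\<^esub> \<psi> x"

lemma presented_S: "presented_module R V A (sub_term R T act n) act (Vs n) {0} \<psi>"
  using presented_sub[OF Vs_subgroup Vs_subset Vs_invariant, of n] by (simp add: \<psi>_Vs)

lemma presented_A: "presented_module R V A (quot_term R T act n) (quot_act act) V (Vs n) (red n)"
  using presented_quot[OF V _ invariant_V Vs_subgroup Vs_subset Vs_invariant, of n]
  by (simp add: \<psi>_Vs carrier_T)

definition divided :: "nat \<Rightarrow> 'v set" where
  "divided n = {x \<in> V. of_nat (split_exponent R T act n) * x \<in> Vs n}"

text \<open>In contrast to the exponent \<open>a\<close> which defines \<open>divided n\<close>, the multiple \<open>q\<close> of \<open>a\<close> does not
  depend on \<open>n\<close>.\<close>

definition E :: "nat \<Rightarrow> 'v set" where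
  "E n = {x \<in> V. of_nat q * x \<in> Vs n}"

lemma add_subgroup_preimage:
  "add_subgroup {x \<in> V. of_nat m * x \<in> Vs n}"
  using V Vs_subgroup[of n]
  by (auto simp: add_subgroup_def algebra_simps)

lemma invariant_preimage:
  "invariant {x \<in> V. of_nat m * x \<in> Vs n}"
  unfolding invariant_def using Vs_invariant[of n]
  by (auto simp: A_closed A_of_nat_mult[symmetric] invariantD)

lemma divided_image_\<psi>: "\<psi> ` divided n = divided_term R T act n"
proof -
  have "\<psi> (of_nat m * x) \<in> S n \<longleftrightarrow> of_nat m * x \<in> Vs n" if "x \<in> V" for m x
    using \<psi>_mem_image_iff[OF add_subgroup_of_nat_mult[OF V that] Vs_subset] by (simp add: \<psi>_Vs)
  then show ?thesis
    unfolding divided_def divided_term_def carrier_T[symmetric] by (auto simp: \<psi>_pow)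
qed

lemma Vs_subset_preimage: "Vs n \<subseteq> {x \<in> V. of_nat m * x \<in> Vs n}"
  using Vs_subset[of n] add_subgroup_of_nat_mult[OF Vs_subgroup[of n]] by auto

lemma presented_D:
  "presented_module R V A (T\<lparr>carrier := divided_term R T act n\<rparr> Mod S n) (quot_act act)
     (divided n) (Vs n) (red n)"
  using presented_quot[of "divided n" "Vs n"] add_subgroup_preimage invariant_preimage
    Vs_subgroup[of n] Vs_invariant[of n] Vs_subset_preimage
  unfolding divided_image_\<psi> \<psi>_Vs by (auto simp: divided_def)

abbreviation clT :: "('g list \<Rightarrow> 'v) \<Rightarrow> ('g list \<Rightarrow> 'w) set" where
  "clT \<equiv> lift_class R T act \<psi> 2"

abbreviation clS :: "nat \<Rightarrow> ('g list \<Rightarrow> 'v) \<Rightarrow> ('g list \<Rightarrow> 'w) set" where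
  "clS n \<equiv> lift_class R (sub_term R T act n) act \<psi> 3"

abbreviation clA :: "nat \<Rightarrow> ('g list \<Rightarrow> 'v) \<Rightarrow> ('g list \<Rightarrow> 'w set) set" where
  "clA n \<equiv> lift_class R (quot_term R T act n) (quot_act act) (red n) 2"

abbreviation clD :: "nat \<Rightarrow> ('g list \<Rightarrow> 'v) \<Rightarrow> ('g list \<Rightarrow> 'w set) set" where
  "clD n \<equiv> lift_class R (T\<lparr>carrier := divided_term R T act n\<rparr> Mod S n) (quot_act act) (red n) 2"

abbreviation coh :: "'v set \<Rightarrow> 'v set \<Rightarrow> nat \<Rightarrow> ('g list \<Rightarrow> 'v) \<Rightarrow> ('g list \<Rightarrow> 'v) \<Rightarrow> bool" where
  "coh \<equiv> cohomologous_mod R A"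

text \<open>The general lemmas speak of degree \<open>Suc n\<close>; these rules fold the degrees
  into the numerals of the definitions.\<close>

lemma Suc_2: "Suc 2 = 3" by simp
lemma Suc_3: "Suc 3 = 4" by simp

lemma clT_eq_iff: "val 2 V F \<Longrightarrow> val 2 V G \<Longrightarrow> clT F = clT G \<longleftrightarrow> coh V {0} 1 F G"
  using presented_module.cl_eq_iff[OF presented_T, where n = 1] by (simp only: Suc_1)

lemma clA_eq_iff: "val 2 V F \<Longrightarrow> val 2 V G \<Longrightarrow> clA n F = clA n G \<longleftrightarrow> coh V (Vs n) 1 F G"
  using presented_module.cl_eq_iff[OF presented_A, where n = 1] by (simp only: Suc_1)

lemma clS_eq_iff:
  "val 3 (Vs n) F \<Longrightarrow> val 3 (Vs n) G \<Longrightarrow> clS n F = clS n G \<longleftrightarrow> coh (Vs n) {0} 2 F G"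
  using presented_module.cl_eq_iff[OF presented_S, where n = 2] by (simp only: Suc_2)

lemma carrier_H2_T:
  "carrier (cohomology R T act 2) = {clT F | F. val 2 V F \<and> val 3 {0} (D 2 F)}"
  using presented_module.carrier_cohomology[OF presented_T, where n = 2] by (simp only: Suc_2)

lemma carrier_H2_A:
  "carrier (H2_quot R T act n) = {clA n F | F. val 2 V F \<and> val 3 (Vs n) (D 2 F)}"
  using presented_module.carrier_cohomology[OF presented_A, where n = 2] by (simp only: Suc_2)

lemma carrier_H3_S:
  "carrier (cohomology R (sub_term R T act n) act 3) =
    {clS n F | F. val 3 (Vs n) F \<and> val 4 {0} (D 3 F)}"
  using presented_module.carrier_cohomology[OF presented_S, where n = 3] by (simp only: Suc_3)

text \<open>Source and target are presented by the same reduction \<open>red n\<close>, so the map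
  induced by the inclusion is the identity on representatives.\<close>

lemma divided_image_eq:
  "divided_image R T act n = {clA n F | F. val 2 (divided n) F \<and> val 3 (Vs n) (D 2 F)}"
proof -
  interpret map: presented_module_map R V A
    "T\<lparr>carrier := divided_term R T act n\<rparr> Mod S n" "quot_act act" "divided n" "Vs n" "red n"
    "quot_term R T act n" "quot_act act" V "Vs n" "red n" "\<lambda>x. x" "\<lambda>v. v"
    by (intro presented_module_map.intro presented_D presented_A presented_module_map_axioms.intro)
      (auto simp: divided_def additive_on_def)
  have coh_map: "coh_map R (quot_term R T act n) (quot_act act) 2 (\<lambda>v. v) (clD n F) = clA n F"
    if "val 2 (divided n) F" for F
    using map.coh_map_cl[where n = 1 and F = F] that by (simp only: Suc_1)
  have carrier: "carrier (cohomology R (T\<lparr>carrier := divided_term R T act n\<rparr> Mod S n) (quot_act act) 2) =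
      {clD n F | F. val 2 (divided n) F \<and> val 3 (Vs n) (D 2 F)}"
    using presented_module.carrier_cohomology[OF presented_D, where n = 2] by (simp only: Suc_2)
  show ?thesis
    unfolding divided_image_def carrier using coh_map by (auto simp: image_iff)
qed

lemma coh_map_T_A:
  assumes "val 2 V F"
  shows "coh_map R (quot_term R T act n) (quot_act act) 2 (\<lambda>t. S n #>\<^bsub>T\<^esub> t) (clT F) = clA n F"
proof -
  interpret map: presented_module_map R V A T act V "{0}" \<psi>
    "quot_term R T act n" "quot_act act" V "Vs n" "red n" "\<lambda>x. x" "\<lambda>t. S n #>\<^bsub>T\<^esub> t"
    by (intro presented_module_map.intro presented_T presented_A presented_module_map_axioms.intro)
      (auto simp: additive_on_def add_subgroup_zero[OF Vs_subgroup])
  show ?thesis using map.coh_map_cl[where n = 1 and F = F] assms by (simp only: Suc_1)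
qed

lemma coh_map_p:
  assumes "val 3 (Vs n) F"
  shows "coh_map R (sub_term R T act (n + d)) act 3 (\<lambda>t. t [^]\<^bsub>T\<^esub> p) (clS n F) =
    clS (n + d) (\<lambda>gs. of_nat p * F gs)"
proof -
  interpret map: presented_module_map R V A "sub_term R T act n" act "Vs n" "{0}" \<psi>
    "sub_term R T act (n + d)" act "Vs (n + d)" "{0}" \<psi> "\<lambda>x. of_nat p * x" "\<lambda>t. t [^]\<^bsub>T\<^esub> p"
    by (intro presented_module_map.intro presented_S presented_module_map_axioms.intro)
      (use Vs_subset[of n] in \<open>auto simp: additive_of_nat_mult A_of_nat_mult multiples_p_Vs[symmetric]
        multiplesI \<psi>_pow subset_iff\<close>)
  show ?thesis using map.coh_map_cl[where n = 2 and F = F] assms by (simp only: Suc_2)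
qed

lemma D_D_1': "val 1 V F \<Longrightarrow> val 3 {0} (D 2 (D 1 F))"
  using D_D_1 by (simp add: valued_def)

lemma D_D_2': "val 2 V F \<Longrightarrow> val 4 {0} (D 3 (D 2 F))"
  using D_D_2 by (simp add: valued_def)

lemma D2_add:
  assumes "val 2 V F" "val 2 V G" "gs \<in> tuples R 3"
  shows "D 2 (\<lambda>gs. F gs + G gs) gs = D 2 F gs + D 2 G gs"
  using D_add[of 2 F G gs] assms by simp

lemma D2_diff:
  assumes "val 2 V F" "val 2 V G" "gs \<in> tuples R 3"
  shows "D 2 (\<lambda>gs. F gs - G gs) gs = D 2 F gs - D 2 G gs"
  using D_diff[of 2 F G gs] assms by simp

lemma D2_of_nat_mult:
  assumes "val 2 V F" "gs \<in> tuples R 3"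
  shows "D 2 (\<lambda>gs. of_nat m * F gs) gs = of_nat m * D 2 F gs"
  using D_of_nat_mult[of 2 F gs] assms by simp

lemma D2_cong:
  assumes "\<And>gs. gs \<in> tuples R 2 \<Longrightarrow> F gs = G gs" "gs \<in> tuples R 3"
  shows "D 2 F gs = D 2 G gs"
  using D_cong[of 2 F G gs] assms by simp

lemma D1_valued: "val 1 X F \<Longrightarrow> add_subgroup X \<Longrightarrow> invariant X \<Longrightarrow> val 2 X (D 1 F)"
  using D_valued[of X 1 F] by (simp add: numeral_2_eq_2)

lemma D2_valued: "val 2 X F \<Longrightarrow> add_subgroup X \<Longrightarrow> invariant X \<Longrightarrow> val 3 X (D 2 F)"
  using D_valued[of X 2 F] by simp

section \<open>The exponents of H^2(R,T) and H^3(R,T_n)\<close>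

lemma annihilates_H2_T: "pT.annihilates 1 q"
  unfolding pT.annihilates_def Suc_1 Suc_2
proof (intro allI impI)
  fix F assume F: "val 2 V F \<and> val 3 {0} (D 2 F)"
  have "val 1 V (transfer F)" using transfer_valued[of V 1 F] V F by (simp add: numeral_2_eq_2)
  moreover have "of_nat q * F gs - 0 - D 1 (transfer F) gs \<in> {0}" if gs: "gs \<in> tuples R (Suc 1)" for gs
  proof -
    have "transfer (D 2 F) gs = 0"
      unfolding transfer_def
      using F gs by (intro sum.neutral) (auto simp: valued_def tuples_def)
    then show ?thesis
      using transfer_2[OF finite_R, of F gs] F gs by (simp add: order_R Suc_1[symmetric] del: Suc_1)
  qed
  ultimately show "pT.cohomologous 1 (\<lambda>gs. of_nat q * F gs) (\<lambda>gs. 0)"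
    by (rule pT.cohomologousI)
qed

lemma cocycle_3_transfer:
  assumes "val 3 V F" "val 4 {0} (D 3 F)" "gs \<in> tuples R 3"
  shows "of_nat q * F gs = D 2 (transfer F) gs"
proof -
  have "transfer (D 3 F) gs = 0"
    unfolding transfer_def
    using assms by (intro sum.neutral) (auto simp: valued_def tuples_def)
  then show ?thesis using transfer_3[OF finite_R assms(1,3)] by (simp add: order_R)
qed

lemma annihilates_H3_S: "presented_module.annihilates R A (Vs n) {0} 2 q"
proof -
  interpret pS: presented_module R V A "sub_term R T act n" act "Vs n" "{0}" \<psi> by (rule presented_S)
  show ?thesis
    unfolding pS.annihilates_def Suc_2 Suc_3
  proof (intro allI impI)
    fix F assume F: "val 3 (Vs n) F \<and> val 4 {0} (D 3 F)"
    then have "val 3 V F" using Vs_subset valued_mono by blast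
    have "val 2 (Vs n) (transfer F)" using transfer_valued[of "Vs n" 2 F] Vs_subgroup F by simp
    moreover have "of_nat q * F gs - 0 - D 2 (transfer F) gs \<in> {0}" if gs: "gs \<in> tuples R (Suc 2)" for gs
      using cocycle_3_transfer[OF \<open>val 3 V F\<close>, of gs] F gs by simp
    ultimately show "pS.cohomologous 2 (\<lambda>gs. of_nat q * F gs) (\<lambda>gs. 0)"
      by (rule pS.cohomologousI)
  qed
qed

text \<open>By the transfer both exponents divide q and so are powers of p. Hence the larger one is
  a multiple of the other, and their maximum still divides q and kills H^3(R,T_n).\<close>

lemma split_exponent:
  shows "split_exponent R T act n dvd q"
    and "presented_module.annihilates R A (Vs n) {0} 2 (split_exponent R T act n)"
proof -
  interpret pS: presented_module R V A "sub_term R T act n" act "Vs n" "{0}" \<psi> by (rule presented_S)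
  have q: "q > 0" using prime prime_gt_0_nat by simp
  obtain i where i: "group_exponent (cohomology R T act 2) = p ^ i" "i \<le> e"
    using pT.group_exponent_annihilates(2)[OF annihilates_H2_T q] prime divides_primepow_nat
    unfolding Suc_1 by blast
  obtain j where j: "group_exponent (cohomology R (sub_term R T act n) act 3) = p ^ j" "j \<le> e"
    using pS.group_exponent_annihilates(2)[OF annihilates_H3_S q] prime divides_primepow_nat
    unfolding Suc_2 by blast
  have a: "split_exponent R T act n = p ^ max i j"
    unfolding split_exponent_def i j using prime prime_gt_1_nat[of p] by (simp add: max_def)
  then show "split_exponent R T act n dvd q" using i j by (simp add: le_imp_power_dvd)
  have "pS.annihilates 2 (p ^ j)"
    using pS.group_exponent_annihilates(1)[OF annihilates_H3_S q] j(1) unfolding Suc_2 by simp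
  then have "pS.annihilates 2 (p ^ (max i j - j) * p ^ j)" by (rule pS.annihilates_mult)
  then show "pS.annihilates 2 (split_exponent R T act n)"
    by (simp add: a power_add[symmetric])
qed

section \<open>Divisibility of T_n and of q^(-1) T_n for large n\<close>

definition deep :: "nat \<Rightarrow> bool" where
  "deep n \<longleftrightarrow> Vs n \<subseteq> multiples (p * q * q) V"

lemma deep_mono: "deep n \<Longrightarrow> n \<le> m \<Longrightarrow> deep m"
  unfolding deep_def using Vs_antimono by blast

text \<open>p q q = p^(1+2e), and p^(1+2e) V is itself the term with index (1+2e)d by
  \<open>multiples_p_power_Vs\<close>.\<close>

lemma eventually_deep: "\<exists>N. \<forall>n\<ge>N. deep n"
proof -
  have "multiples (p ^ (1 + e + e)) V = Vs (0 + (1 + e + e) * d)"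
    using multiples_p_power_Vs[of "1 + e + e" 0] by (simp only: Vs_0)
  then have "deep ((1 + e + e) * d)" unfolding deep_def by (simp add: power_add mult.assoc)
  then show ?thesis using deep_mono by blast
qed

lemma E_subgroup: "add_subgroup (E n)"
  unfolding E_def by (rule add_subgroup_preimage)

lemma E_subset: "E n \<subseteq> V"
  by (auto simp: E_def)

lemma Vs_subset_E: "Vs n \<subseteq> E n"
  unfolding E_def by (rule Vs_subset_preimage)

text \<open>The quotient of x by q exists because T_n lies in qV, and it belongs to
  \<open>E n\<close> by the definition of that set. So T_n = q \<open>E n\<close>.\<close>

lemma deep_Vs: assumes "deep n" "x \<in> Vs n" shows "\<exists>y\<in>E n. x = of_nat q * y"
proof -
  obtain z where z: "z \<in> V" "x = of_nat (p * q * q) * z"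
    using assms unfolding deep_def by (blast elim: multiplesE)
  then have x: "x = of_nat q * (of_nat (p * q) * z)" by (simp add: algebra_simps)
  have "of_nat q * (of_nat (p * q) * z) \<in> Vs n" using assms(2) by (simp only: x)
  then have "of_nat (p * q) * z \<in> E n"
    using add_subgroup_of_nat_mult[OF V z(1)] unfolding E_def by blast
  then show ?thesis using x by blast
qed

text \<open>Here qx lies in T_n and thus in p q q V; cancelling q leaves x in p q V.\<close>

lemma deep_E: assumes "deep n" "x \<in> E n" shows "\<exists>y\<in>V. x = of_nat q * (of_nat p * y)"
proof -
  have "of_nat q * x \<in> Vs n" "x \<in> V" using assms(2) by (auto simp: E_def)
  then obtain z where z: "z \<in> V" "of_nat q * x = of_nat (p * q * q) * z"
    using assms(1) unfolding deep_def by (blast elim: multiplesE)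
  then have "of_nat q * x = of_nat q * (of_nat (q * p) * z)" by (simp add: algebra_simps)
  then have "x = of_nat (q * p) * z"
    using cancel_power \<open>x \<in> V\<close> add_subgroup_of_nat_mult[OF V z(1)] by blast
  then show ?thesis using z(1) by (auto simp: mult.assoc)
qed

lemma deep_E': assumes "deep n" "x \<in> E n" shows "\<exists>y\<in>V. x = of_nat q * y"
  using deep_E[OF assms] add_subgroup_of_nat_mult[OF V] by blast

text \<open>pV lies in T_1. This will make \<kappa> and p\<kappa> both vanish modulo T_1.\<close>

lemma deep_E_Vs_1: assumes "deep n" shows "E n \<subseteq> Vs 1"
proof
  fix x assume "x \<in> E n"
  then obtain y where "y \<in> V" "x = of_nat q * (of_nat p * y)" using deep_E[OF assms] by blast
  then show "x \<in> Vs 1"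
    using p_mult_Vs[of y 0] add_subgroup_of_nat_mult[OF Vs_subgroup, of "of_nat p * y" 1 q]
    by (simp add: Vs_0)
qed

text \<open>Write \<eta> = q\<theta> with \<theta> in V. As V is torsion-free, \<theta> is itself a
  cocycle, and q kills its class: \<eta> = q\<theta> is the boundary of the transfer of \<theta>.
  The bounding cochain has values in V, in general not in \<open>E n\<close>.\<close>

lemma E_cocycle_is_coboundary:
  assumes deep: "deep n" and \<eta>: "val 2 (E n) \<eta>" "\<And>gs. gs \<in> tuples R 3 \<Longrightarrow> D 2 \<eta> gs = 0"
  shows "\<exists>w. val 1 V w \<and> (\<forall>gs\<in>tuples R 2. \<eta> gs = D 1 w gs)"
proof -
  have "\<forall>gs\<in>tuples R 2. \<exists>y\<in>V. \<eta> gs = of_nat q * y"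
    using \<eta>(1) deep_E'[OF deep] by (auto simp: valued_def)
  then obtain \<theta> where \<theta>: "\<And>gs. gs \<in> tuples R 2 \<Longrightarrow> \<theta> gs \<in> V \<and> \<eta> gs = of_nat q * \<theta> gs"
    by metis
  then have \<theta>V: "val 2 V \<theta>" by (simp add: valued_def)
  have "D 2 \<theta> gs = 0" if gs: "gs \<in> tuples R 3" for gs
  proof -
    have "of_nat q * D 2 \<theta> gs = D 2 (\<lambda>gs. of_nat q * \<theta> gs) gs"
      by (rule D2_of_nat_mult[OF \<theta>V gs, symmetric])
    also have "\<dots> = D 2 \<eta> gs" by (rule D2_cong[OF _ gs]) (simp add: \<theta>)
    also have "\<dots> = 0" by (rule \<eta>(2)[OF gs])
    finally show ?thesis
      using torsion_free_power valuedD[OF D2_valued[OF \<theta>V V invariant_V] gs] by blast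
  qed
  then have tr0: "transfer (D 2 \<theta>) gs = 0" if "gs \<in> tuples R 2" for gs
    unfolding transfer_def using that by (intro sum.neutral) (auto simp: tuples_def)
  have "val 1 V (transfer \<theta>)" using transfer_valued[of V 1 \<theta>] V \<theta>V by (simp add: numeral_2_eq_2)
  moreover have "\<eta> gs = D 1 (transfer \<theta>) gs" if gs: "gs \<in> tuples R 2" for gs
    using transfer_2[OF finite_R \<theta>V gs] \<theta>[OF gs] tr0[OF gs] by (simp add: order_R)
  ultimately show ?thesis by blast
qed

text \<open>The cochain form of an element of H^2(R,T) \<oplus> H^3(R,T_n): \<gamma> represents the
  first component and \<open>D 2 \<delta>\<close> the second.\<close>

definition decomposition :: "nat \<Rightarrow> ('g list \<Rightarrow> 'v) \<Rightarrow> ('g list \<Rightarrow> 'v) \<Rightarrow> bool" where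
  "decomposition n \<gamma> \<delta> \<longleftrightarrow>
     val 2 V \<gamma> \<and> val 3 {0} (D 2 \<gamma>) \<and> val 2 (E n) \<delta> \<and> val 3 (Vs n) (D 2 \<delta>)"

abbreviation plus :: "('g list \<Rightarrow> 'v) \<Rightarrow> ('g list \<Rightarrow> 'v) \<Rightarrow> 'g list \<Rightarrow> 'v" where
  "plus F G \<equiv> \<lambda>gs. F gs + G gs"

abbreviation minus :: "('g list \<Rightarrow> 'v) \<Rightarrow> ('g list \<Rightarrow> 'v) \<Rightarrow> 'g list \<Rightarrow> 'v" where
  "minus F G \<equiv> \<lambda>gs. F gs - G gs"

abbreviation times :: "nat \<Rightarrow> ('g list \<Rightarrow> 'v) \<Rightarrow> 'g list \<Rightarrow> 'v" where
  "times m F \<equiv> \<lambda>gs. of_nat m * F gs"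

lemma valued_plus: "add_subgroup X \<Longrightarrow> val n X F \<Longrightarrow> val n X G \<Longrightarrow> val n X (plus F G)"
  by (simp add: valued_def add_subgroup_add)

lemma valued_minus: "add_subgroup X \<Longrightarrow> val n X F \<Longrightarrow> val n X G \<Longrightarrow> val n X (minus F G)"
  by (simp add: valued_def add_subgroup_diff)

lemma val_E_V: "val n (E m) F \<Longrightarrow> val n V F"
  using E_subset valued_mono by blast

lemma val_Vs_V: "val n (Vs m) F \<Longrightarrow> val n V F"
  using Vs_subset valued_mono by blast

lemma val_Vs_E: "val n (Vs m) F \<Longrightarrow> val n (E m) F"
  using Vs_subset_E valued_mono by blast

lemma decompositionD:
  assumes "decomposition n \<gamma> \<delta>"
  shows "val 2 V \<gamma>" "val 3 {0} (D 2 \<gamma>)" "val 2 (E n) \<delta>" "val 3 (Vs n) (D 2 \<delta>)" "val 2 V \<delta>"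
    "val 2 V (plus \<gamma> \<delta>)" "val 3 (Vs n) (D 2 (plus \<gamma> \<delta>))" "val 4 {0} (D 3 (D 2 \<delta>))"
proof -
  show *: "val 2 V \<gamma>" "val 3 {0} (D 2 \<gamma>)" "val 2 (E n) \<delta>" "val 3 (Vs n) (D 2 \<delta>)"
    using assms by (auto simp: decomposition_def)
  show **: "val 2 V \<delta>" by (rule val_E_V[OF *(3)])
  show "val 2 V (plus \<gamma> \<delta>)" by (rule valued_plus[OF V *(1) **])
  show "val 3 (Vs n) (D 2 (plus \<gamma> \<delta>))" using * ** by (simp add: valued_def D2_add)
  show "val 4 {0} (D 3 (D 2 \<delta>))" by (rule D_D_2'[OF **])
qed

text \<open>qb is the boundary of the transfer of b, which has values in T_n = q \<open>E n\<close>.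
  Dividing by q exhibits b as the boundary of a cochain with values in \<open>E n\<close>.\<close>

lemma cocycle_divide:
  assumes deep: "deep n" and b: "val 3 (Vs n) b" "val 4 {0} (D 3 b)"
  shows "\<exists>\<delta>. val 2 (E n) \<delta> \<and> (\<forall>gs\<in>tuples R 3. D 2 \<delta> gs = b gs)"
proof -
  have bV: "val 3 V b" by (rule val_Vs_V[OF b(1)])
  have "val 2 (Vs n) (transfer b)" using transfer_valued[of "Vs n" 2 b] Vs_subgroup b(1) by simp
  then have "\<forall>gs\<in>tuples R 2. \<exists>y\<in>E n. transfer b gs = of_nat q * y"
    using deep_Vs[OF deep] by (auto simp: valued_def)
  then obtain \<delta> where \<delta>: "\<And>gs. gs \<in> tuples R 2 \<Longrightarrow> \<delta> gs \<in> E n \<and> transfer b gs = of_nat q * \<delta> gs"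
    by metis
  then have \<delta>E: "val 2 (E n) \<delta>" by (simp add: valued_def)
  have "D 2 \<delta> gs = b gs" if gs: "gs \<in> tuples R 3" for gs
  proof -
    have "of_nat q * D 2 \<delta> gs = D 2 (times q \<delta>) gs"
      by (rule D2_of_nat_mult[OF val_E_V[OF \<delta>E] gs, symmetric])
    also have "\<dots> = D 2 (transfer b) gs" by (rule D2_cong[OF _ gs]) (simp add: \<delta>)
    also have "\<dots> = of_nat q * b gs" using cocycle_3_transfer[OF bV b(2) gs] by simp
    finally show ?thesis
      using cancel_power valuedD[OF D2_valued[OF val_E_V[OF \<delta>E] V invariant_V] gs] valuedD[OF bV gs]
      by blast
  qed
  then show ?thesis using \<delta>E by blast
qed

text \<open>The boundary of f is a 3-cocycle in T_n. If \<delta> is a cochain in \<open>E n\<close>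
  with the same boundary, then f - \<delta> is a cocycle in V.\<close>

lemma decomposition_exists:
  assumes deep: "deep n" and f: "val 2 V f" "val 3 (Vs n) (D 2 f)"
  shows "\<exists>\<gamma> \<delta>. decomposition n \<gamma> \<delta> \<and> f = plus \<gamma> \<delta>"
proof -
  obtain \<delta> where \<delta>: "val 2 (E n) \<delta>" "\<And>gs. gs \<in> tuples R 3 \<Longrightarrow> D 2 \<delta> gs = D 2 f gs"
    using cocycle_divide[OF deep f(2) D_D_2'[OF f(1)]] by blast
  note \<delta>V = val_E_V[OF \<delta>(1)]
  have "decomposition n (minus f \<delta>) \<delta>"
    unfolding decomposition_def
    using \<delta>(1) valued_minus[OF V f(1) \<delta>V] \<delta>(2) f(2)
    by (simp add: valued_def D2_diff[OF f(1) \<delta>V])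
  then show ?thesis by (intro exI[of _ "minus f \<delta>"] exI[of _ \<delta>]) (auto simp: fun_eq_iff)
qed

text \<open>Injectivity of the connecting homomorphism on classes that come from \<open>E n\<close>.
  If the boundaries differ by that of t with values in T_n, then \<delta> - \<delta>' - t is a
  cocycle in \<open>E n\<close> and so a coboundary in V.\<close>

lemma coh_E_of_coboundary:
  assumes deep: "deep n" and \<delta>: "val 2 (E n) \<delta>" "val 2 (E n) \<delta>'"
    and coh: "coh (Vs n) {0} 2 (D 2 \<delta>) (D 2 \<delta>')"
  shows "coh V (Vs n) 1 \<delta> \<delta>'"
proof -
  obtain t where t: "val 2 (Vs n) t"
    "\<And>gs. gs \<in> tuples R 3 \<Longrightarrow> D 2 \<delta> gs - D 2 \<delta>' gs = D 2 t gs"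
    using coh by (auto simp: cohomologous_mod_def valued_def)
  note V' = val_E_V[OF \<delta>(1)] val_E_V[OF \<delta>(2)] val_Vs_V[OF t(1)]
  let ?\<eta> = "minus (minus \<delta> \<delta>') t"
  have "val 2 (E n) ?\<eta>"
    by (intro valued_minus E_subgroup \<delta> val_Vs_E[OF t(1)])
  moreover have "D 2 ?\<eta> gs = 0" if gs: "gs \<in> tuples R 3" for gs
    using D2_diff[OF valued_minus[OF V V'(1,2)] V'(3) gs] D2_diff[OF V'(1,2) gs] t(2)[OF gs] by simp
  ultimately obtain w where w: "val 1 V w" "\<And>gs. gs \<in> tuples R 2 \<Longrightarrow> ?\<eta> gs = D 1 w gs"
    using E_cocycle_is_coboundary[OF deep] by blast
  have "\<delta> gs - \<delta>' gs - D 1 w gs \<in> Vs n" if gs: "gs \<in> tuples R 2" for gs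
    using w(2)[OF gs, symmetric] valuedD[OF t(1) gs] by simp
  then show ?thesis
    unfolding cohomologous_mod_def valued_def Suc_1 using w(1) by (auto simp: valued_def)
qed

text \<open>The cochain \<eta> below can be read in two ways: t - (\<delta> - \<delta>') shows that
  it has values in \<open>E n\<close>, and \<gamma> - \<gamma>' - \<open>D 1 c\<close> shows that it
  is a cocycle. So it is the boundary of some w. Then \<gamma> - \<gamma>' is the boundary of c + w,
  and \<open>D 2 \<eta>\<close> = 0 says that t bounds the difference of the two 3-cocycles.\<close>

lemma decomposition_unique:
  assumes deep: "deep n" and d: "decomposition n \<gamma> \<delta>" and d': "decomposition n \<gamma>' \<delta>'"
    and coh: "coh V (Vs n) 1 (plus \<gamma> \<delta>) (plus \<gamma>' \<delta>')"
  shows "coh V {0} 1 \<gamma> \<gamma>'" "coh (Vs n) {0} 2 (D 2 \<delta>) (D 2 \<delta>')"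
proof -
  note V1 = decompositionD[OF d] and V2 = decompositionD[OF d']
  obtain c where c: "val 1 V c" "val 2 (Vs n) (\<lambda>gs. plus \<gamma> \<delta> gs - plus \<gamma>' \<delta>' gs - D 1 c gs)"
    using coh unfolding cohomologous_mod_def Suc_1 by blast
  define t where "t = (\<lambda>gs. plus \<gamma> \<delta> gs - plus \<gamma>' \<delta>' gs - D 1 c gs)"
  have t: "val 2 (Vs n) t" using c(2) by (simp add: t_def)
  define \<eta> where "\<eta> = minus t (minus \<delta> \<delta>')"
  have \<delta>\<delta>: "val 2 V (minus \<delta> \<delta>')" by (intro valued_minus V V1 V2)
  have \<eta>: "val 2 (E n) \<eta>"
    unfolding \<eta>_def by (intro valued_minus E_subgroup V1 V2 val_Vs_E[OF t])
  have \<eta>_eq: "\<eta> gs = minus (minus \<gamma> \<gamma>') (D 1 c) gs" for gs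
    by (simp add: \<eta>_def t_def)
  have D1c: "val 2 V (D 1 c)" by (rule D1_valued[OF c(1) V invariant_V])
  have \<eta>0: "D 2 \<eta> gs = 0" if gs: "gs \<in> tuples R 3" for gs
  proof -
    have "D 2 \<eta> gs = D 2 (minus (minus \<gamma> \<gamma>') (D 1 c)) gs"
      by (rule D2_cong[OF \<eta>_eq gs])
    also have "\<dots> = D 2 \<gamma> gs - D 2 \<gamma>' gs - D 2 (D 1 c) gs"
      using D2_diff[OF valued_minus[OF V V1(1) V2(1)] D1c gs] D2_diff[OF V1(1) V2(1) gs] by simp
    also have "\<dots> = 0"
      using valuedD[OF V1(2) gs] valuedD[OF V2(2) gs] valuedD[OF D_D_1'[OF c(1)] gs] by simp
    finally show ?thesis .
  qed
  obtain w where w: "val 1 V w" "\<And>gs. gs \<in> tuples R 2 \<Longrightarrow> \<eta> gs = D 1 w gs"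
    using E_cocycle_is_coboundary[OF deep \<eta> \<eta>0] by blast
  have "val 1 V (plus c w)" by (rule valued_plus[OF V c(1) w(1)])
  moreover have "\<gamma> gs - \<gamma>' gs - D 1 (plus c w) gs \<in> {0}" if gs: "gs \<in> tuples R 2" for gs
    using D_add[OF c(1) w(1), of gs] gs w(2)[OF gs] \<eta>_eq[of gs] by (simp add: algebra_simps numeral_2_eq_2)
  ultimately show "coh V {0} 1 \<gamma> \<gamma>'"
    unfolding cohomologous_mod_def valued_def Suc_1 by (intro exI[of _ "plus c w"]) auto
  have "D 2 \<delta> gs - D 2 \<delta>' gs - D 2 t gs = 0" if gs: "gs \<in> tuples R 3" for gs
    using D2_diff[OF val_Vs_V[OF t] \<delta>\<delta> gs] D2_diff[OF V1(5) V2(5) gs] \<eta>0[OF gs]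
    by (simp add: \<eta>_def)
  then show "coh (Vs n) {0} 2 (D 2 \<delta>) (D 2 \<delta>')"
    unfolding cohomologous_mod_def Suc_2 using t by (intro exI[of _ t]) (auto simp: valued_def)
qed

text \<open>The converse of \<open>decomposition_unique\<close>: the bounding cochain for the
  \<gamma>-parts and the one that \<open>coh_E_of_coboundary\<close> finds for the \<delta>-parts
  are added.\<close>

lemma decomposition_coh:
  assumes deep: "deep n" and d: "decomposition n \<gamma> \<delta>" and d': "decomposition n \<gamma>' \<delta>'"
    and coh: "coh V {0} 1 \<gamma> \<gamma>'" "coh (Vs n) {0} 2 (D 2 \<delta>) (D 2 \<delta>')"
  shows "coh V (Vs n) 1 (plus \<gamma> \<delta>) (plus \<gamma>' \<delta>')"
proof -
  note V1 = decompositionD[OF d] and V2 = decompositionD[OF d']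
  obtain c where c: "val 1 V c" "\<And>gs. gs \<in> tuples R 2 \<Longrightarrow> \<gamma> gs - \<gamma>' gs = D 1 c gs"
    using coh(1) unfolding cohomologous_mod_def Suc_1 by (auto simp: valued_def)
  obtain w where w: "val 1 V w" "\<And>gs. gs \<in> tuples R 2 \<Longrightarrow> \<delta> gs - \<delta>' gs - D 1 w gs \<in> Vs n"
    using coh_E_of_coboundary[OF deep V1(3) V2(3) coh(2)]
    unfolding cohomologous_mod_def Suc_1 by (auto simp: valued_def)
  have "val 1 V (plus c w)" by (rule valued_plus[OF V c(1) w(1)])
  moreover have "plus \<gamma> \<delta> gs - plus \<gamma>' \<delta>' gs - D 1 (plus c w) gs \<in> Vs n"
    if gs: "gs \<in> tuples R 2" for gs
  proof -
    have eq: "plus \<gamma> \<delta> gs - plus \<gamma>' \<delta>' gs - D 1 (plus c w) gs = \<delta> gs - \<delta>' gs - D 1 w gs"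
      using D_add[OF c(1) w(1), of gs] gs c(2)[OF gs] by (simp add: algebra_simps numeral_2_eq_2)
    show ?thesis unfolding eq by (rule w(2)[OF gs])
  qed
  ultimately show ?thesis
    unfolding cohomologous_mod_def valued_def Suc_1 by (intro exI[of _ "plus c w"]) auto
qed

section \<open>The connecting homomorphism and the canonical isomorphism\<close>

lemma coh_D2:
  assumes "val 2 V F" "val 2 V G" "coh V (Vs n) 1 F G"
  shows "coh (Vs n) {0} 2 (D 2 F) (D 2 G)"
proof -
  obtain c where c: "val 1 V c" "val 2 (Vs n) (\<lambda>gs. F gs - G gs - D 1 c gs)"
    using assms(3) unfolding cohomologous_mod_def Suc_1 by blast
  have D1c: "val 2 V (D 1 c)" by (rule D1_valued[OF c(1) V invariant_V])
  have "D 2 F gs - D 2 G gs - D 2 (\<lambda>gs. F gs - G gs - D 1 c gs) gs = 0" if gs: "gs \<in> tuples R 3" for gs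
    using D2_diff[OF valued_minus[OF V assms(1,2)] D1c gs] D2_diff[OF assms(1,2) gs]
      valuedD[OF D_D_1'[OF c(1)] gs] by simp
  then show ?thesis
    unfolding cohomologous_mod_def Suc_2 using c(2)
    by (intro exI[of _ "\<lambda>gs. F gs - G gs - D 1 c gs"]) (auto simp: valued_def)
qed

text \<open>The set in the definition of \<open>connecting\<close> is rewritten with representatives
  in V; \<open>coh_D2\<close> shows that it has a single element, which is what
  \<open>the_elem\<close> requires.\<close>

lemma connecting_clA:
  assumes f: "val 2 V f" "val 3 (Vs n) (D 2 f)"
  shows "connecting R T act n (clA n f) = clS n (D 2 f)"
proof -
  interpret pT: presented_module R V A T act V "{0}" \<psi> by (rule presented_T)
  interpret pA: presented_module R V A "quot_term R T act n" "quot_act act" V "Vs n" "red n"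
    by (rule presented_A)
  have diff: "differential R T act 2 (pT.lift 2 F) = lift_cochain R \<psi> 3 (D 2 F)"
    if "val 2 V F" for F
    using pT.differential_lift[OF that] by simp
  have red: "(\<lambda>gs\<in>tuples R 2. S n #>\<^bsub>T\<^esub> pT.lift 2 F gs) = pA.lift 2 F" for F
    by (auto simp: lift_cochain_def intro!: restrict_ext)
  have mem: "pA.lift 2 F \<in> clA n f \<longleftrightarrow> coh V (Vs n) 1 F f" if "val 2 V F" for F
    using pA.lift_mem_cl_iff[where n = 1 and F = f and G = F] that f(1) unfolding Suc_1 by simp
  have "{coh_class R (sub_term R T act n) act 3 (differential R T act 2 f') | f'.
      f' \<in> carrier (cochains R T 2) \<and> (\<lambda>gs\<in>tuples R 2. S n #>\<^bsub>T\<^esub> f' gs) \<in> clA n f} =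
    {clS n (D 2 F) | F. val 2 V F \<and> coh V (Vs n) 1 F f}" (is "?L = ?R")
  proof (intro equalityI subsetI)
    fix x assume "x \<in> ?L"
    then obtain f' where f': "f' \<in> carrier (cochains R T 2)"
      "(\<lambda>gs\<in>tuples R 2. S n #>\<^bsub>T\<^esub> f' gs) \<in> clA n f"
      "x = coh_class R (sub_term R T act n) act 3 (differential R T act 2 f')" by blast
    obtain F where F: "val 2 V F" "f' = pT.lift 2 F" using pT.lift_surj[OF f'(1)] by blast
    have "coh V (Vs n) 1 F f" using f'(2) unfolding F(2) red mem[OF F(1)] .
    moreover have "x = clS n (D 2 F)"
      unfolding f'(3) F(2) diff[OF F(1)] by (simp add: lift_class_def)
    ultimately show "x \<in> ?R" using F(1) by blast
  next
    fix x assume "x \<in> ?R"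
    then obtain F where F: "val 2 V F" "coh V (Vs n) 1 F f" "x = clS n (D 2 F)" by blast
    have "x = coh_class R (sub_term R T act n) act 3 (differential R T act 2 (pT.lift 2 F))"
      unfolding F(3) diff[OF F(1)] by (simp add: lift_class_def)
    moreover have "(\<lambda>gs\<in>tuples R 2. S n #>\<^bsub>T\<^esub> pT.lift 2 F gs) \<in> clA n f"
      unfolding red mem[OF F(1)] by (rule F(2))
    ultimately show "x \<in> ?L" using pT.lift_closed[OF F(1)] by blast
  qed
  also have "?R = {clS n (D 2 f)}"
  proof -
    have "clS n (D 2 F) = clS n (D 2 f)" if F: "val 2 V F" "coh V (Vs n) 1 F f" for F
    proof -
      obtain c where c: "val 1 V c" "val 2 (Vs n) (\<lambda>gs. F gs - f gs - D 1 c gs)"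
        using F(2) unfolding cohomologous_mod_def Suc_1 by blast
      have D1c: "val 2 V (D 1 c)" by (rule D1_valued[OF c(1) V invariant_V])
      \<comment> \<open>The classes in H^3(R,T_n) can be compared only once the boundary of F is
        known to have values in T_n; this follows from that of f.\<close>
      have "val 3 (Vs n) (D 2 F)"
        unfolding valued_def
      proof
        fix gs assume gs: "gs \<in> tuples R 3"
        have "D 2 (\<lambda>gs. F gs - f gs - D 1 c gs) gs \<in> Vs n"
          using valuedD[OF D2_valued[OF c(2) Vs_subgroup Vs_invariant] gs] .
        also have "D 2 (\<lambda>gs. F gs - f gs - D 1 c gs) gs = D 2 F gs - D 2 f gs"
          using D2_diff[OF valued_minus[OF V F(1) f(1)] D1c gs] D2_diff[OF F(1) f(1) gs]
            valuedD[OF D_D_1'[OF c(1)] gs] by simp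
        finally show "D 2 F gs \<in> Vs n"
          using add_subgroup_cong[OF Vs_subgroup] valuedD[OF f(2) gs] by blast
      qed
      then show ?thesis using clS_eq_iff f(2) coh_D2[OF F(1) f(1) F(2)] by blast
    qed
    moreover have "coh V (Vs n) 1 f f" by (rule pA.cohomologous_refl)
    ultimately show ?thesis using f(1) by blast
  qed
  finally show ?thesis unfolding connecting_def by simp
qed

lemma divided_subset_E: "divided n \<subseteq> E n"
proof -
  obtain m where "q = split_exponent R T act n * m" using split_exponent(1) by (auto simp: dvd_def)
  then have "of_nat q * x = of_nat m * (of_nat (split_exponent R T act n) * x)" for x :: 'v
    by (simp add: algebra_simps)
  then show ?thesis
    unfolding divided_def E_def using add_subgroup_of_nat_mult[OF Vs_subgroup] by auto
qed

text \<open>The analogue of \<open>cocycle_divide\<close> with a in place of q: ab is the boundary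
  of some u with values in T_n, and T_n lies in qV, hence in aV. It is required because
  \<open>divided_image\<close> is defined with a; it proves that the description in
  \<open>assemble\<close> is satisfiable.\<close>

lemma cocycle_divide_split_exponent:
  assumes deep: "deep n" and b: "val 3 (Vs n) b" "val 4 {0} (D 3 b)"
  shows "\<exists>\<delta>. val 2 (divided n) \<delta> \<and> (\<forall>gs\<in>tuples R 3. D 2 \<delta> gs = b gs)"
proof -
  interpret pS: presented_module R V A "sub_term R T act n" act "Vs n" "{0}" \<psi> by (rule presented_S)
  define a where "a = split_exponent R T act n"
  obtain m where m: "q = a * m" using split_exponent(1) by (auto simp: dvd_def a_def)
  have bV: "val 3 V b" by (rule val_Vs_V[OF b(1)])
  have "coh (Vs n) {0} 2 (times a b) (\<lambda>gs. 0)"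
    using split_exponent(2)[of n] b unfolding pS.annihilates_def Suc_2 Suc_3 a_def by blast
  then obtain u where u: "val 2 (Vs n) u"
    "\<And>gs. gs \<in> tuples R 3 \<Longrightarrow> of_nat a * b gs = D 2 u gs"
    unfolding cohomologous_mod_def Suc_2 by (auto simp: valued_def)
  have "\<exists>y\<in>divided n. u gs = of_nat a * y" if "gs \<in> tuples R 2" for gs
  proof -
    have u': "u gs \<in> Vs n" using valuedD[OF u(1) that] .
    then obtain y where y: "y \<in> V" "u gs = of_nat q * y"
      using deep_Vs[OF deep] E_subset by blast
    then have "u gs = of_nat a * (of_nat m * y)" by (simp only: m of_nat_mult mult.assoc)
    moreover from this have "of_nat m * y \<in> divided n"
      using u' add_subgroup_of_nat_mult[OF V y(1)] by (simp add: divided_def a_def)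
    ultimately show ?thesis by blast
  qed
  then obtain \<delta> where \<delta>: "\<And>gs. gs \<in> tuples R 2 \<Longrightarrow> \<delta> gs \<in> divided n \<and> u gs = of_nat a * \<delta> gs"
    by metis
  then have \<delta>D: "val 2 (divided n) \<delta>" by (simp add: valued_def)
  then have \<delta>V: "val 2 V \<delta>" by (auto simp: divided_def valued_def)
  have "D 2 \<delta> gs = b gs" if gs: "gs \<in> tuples R 3" for gs
  proof -
    have "of_nat a * D 2 \<delta> gs = D 2 (times a \<delta>) gs"
      by (rule D2_of_nat_mult[OF \<delta>V gs, symmetric])
    also have "\<dots> = D 2 u gs" by (rule D2_cong[OF _ gs]) (simp add: \<delta>)
    also have "\<dots> = of_nat a * b gs" using u(2)[OF gs] by simp
    \<comment> \<open>Cancellation is available for powers of p in the form of q, so the factor a is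
      completed to q = am.\<close>
    finally have "of_nat m * (of_nat a * D 2 \<delta> gs) = of_nat m * (of_nat a * b gs)" by simp
    then have "of_nat q * D 2 \<delta> gs = of_nat q * b gs" by (simp only: m of_nat_mult mult.left_commute mult.assoc)
    then show ?thesis
      using cancel_power valuedD[OF D2_valued[OF \<delta>V V invariant_V] gs] valuedD[OF bV gs]
      by blast
  qed
  then show ?thesis using \<delta>D by blast
qed

text \<open>\<delta> itself need not have values in a^(-1) T_n, but some \<delta>' with such values
  has the same boundary, and \<open>coh_E_of_coboundary\<close> shows that both have the same class
  modulo T_n. The same argument gives the uniqueness for \<open>THE\<close>.\<close>

lemma assemble_decomposition:
  assumes deep: "deep n" and d: "decomposition n \<gamma> \<delta>"
  shows "assemble R T act n (clT \<gamma>, clS n (D 2 \<delta>)) = clA n (plus \<gamma> \<delta>)"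
proof -
  note V1 = decompositionD[OF d]
  interpret pA: presented_module R V A "quot_term R T act n" "quot_act act" V "Vs n" "red n"
    by (rule presented_A)
  have eq: "clA n \<delta>' = clA n \<delta>"
    if "val 2 (divided n) \<delta>'" "val 3 (Vs n) (D 2 \<delta>')" "clS n (D 2 \<delta>') = clS n (D 2 \<delta>)" for \<delta>'
  proof -
    have \<delta>': "val 2 (E n) \<delta>'" using that(1) divided_subset_E valued_mono by blast
    have "coh (Vs n) {0} 2 (D 2 \<delta>') (D 2 \<delta>)" using that clS_eq_iff V1(4) by blast
    then show ?thesis
      using coh_E_of_coboundary[OF deep \<delta>' V1(3)] clA_eq_iff val_E_V[OF \<delta>'] V1(5) by blast
  qed
  obtain \<delta>' where \<delta>': "val 2 (divided n) \<delta>'" "\<And>gs. gs \<in> tuples R 3 \<Longrightarrow> D 2 \<delta>' gs = D 2 \<delta> gs"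
    using cocycle_divide_split_exponent[OF deep V1(4) V1(8)] by blast
  have \<delta>'V: "val 3 (Vs n) (D 2 \<delta>')" using V1(4) \<delta>'(2) by (simp add: valued_def)
  have "lift_cochain R \<psi> 3 (D 2 \<delta>') = lift_cochain R \<psi> 3 (D 2 \<delta>)"
    using \<delta>'(2) by (auto simp: lift_cochain_def)
  then have clS: "clS n (D 2 \<delta>') = clS n (D 2 \<delta>)" by (simp add: lift_class_def)
  have "(THE c. c \<in> divided_image R T act n \<and> connecting R T act n c = clS n (D 2 \<delta>)) = clA n \<delta>"
  proof (rule the_equality)
    have "clA n \<delta> \<in> divided_image R T act n"
      unfolding divided_image_eq using eq[OF \<delta>'(1) \<delta>'V clS] \<delta>'(1) \<delta>'V by blast
    then show "clA n \<delta> \<in> divided_image R T act n \<and> connecting R T act n (clA n \<delta>) = clS n (D 2 \<delta>)"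
      using connecting_clA[OF V1(5,4)] by simp
  next
    fix c assume c: "c \<in> divided_image R T act n \<and> connecting R T act n c = clS n (D 2 \<delta>)"
    then obtain F where F: "c = clA n F" "val 2 (divided n) F" "val 3 (Vs n) (D 2 F)"
      unfolding divided_image_eq by blast
    have "val 2 V F" using F(2) by (auto simp: divided_def valued_def)
    then have "clS n (D 2 F) = clS n (D 2 \<delta>)" using c connecting_clA F by simp
    then show "c = clA n \<delta>" using eq F by simp
  qed
  moreover have "clA n \<gamma> \<otimes>\<^bsub>H2_quot R T act n\<^esub> clA n \<delta> = clA n (plus \<gamma> \<delta>)"
    using pA.cl_mult[where n = 1 and F = \<gamma> and G = \<delta>] V1 unfolding Suc_1 by simp
  ultimately show ?thesis
    unfolding assemble_def using coh_map_T_A[OF V1(1)] by simp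
qed

lemma carrier_H2_H3_decomposition:
  assumes deep: "deep n"
    and "x \<in> carrier (cohomology R T act 2) \<times> carrier (cohomology R (sub_term R T act n) act 3)"
  shows "\<exists>\<gamma> \<delta>. decomposition n \<gamma> \<delta> \<and> x = (clT \<gamma>, clS n (D 2 \<delta>))"
proof -
  obtain \<gamma> b where \<gamma>: "val 2 V \<gamma>" "val 3 {0} (D 2 \<gamma>)" and b: "val 3 (Vs n) b" "val 4 {0} (D 3 b)"
    and x: "x = (clT \<gamma>, clS n b)"
    using assms(2) unfolding carrier_H2_T carrier_H3_S by blast
  obtain \<delta> where \<delta>: "val 2 (E n) \<delta>" "\<And>gs. gs \<in> tuples R 3 \<Longrightarrow> D 2 \<delta> gs = b gs"
    using cocycle_divide[OF deep b] by blast
  have "lift_cochain R \<psi> 3 (D 2 \<delta>) = lift_cochain R \<psi> 3 b"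
    using \<delta>(2) by (auto simp: lift_cochain_def)
  then have "x = (clT \<gamma>, clS n (D 2 \<delta>))" using x by (simp add: lift_class_def)
  moreover have "decomposition n \<gamma> \<delta>"
    unfolding decomposition_def using \<gamma> \<delta> b by (simp add: valued_def)
  ultimately show ?thesis by blast
qed

text \<open>Makes the \<open>inv_into\<close> in \<open>id_plus_mu\<close> a genuine inverse on the
  image of \<open>assemble\<close>.\<close>

lemma inj_on_assemble:
  assumes deep: "deep n"
  shows "inj_on (assemble R T act n)
    (carrier (cohomology R T act 2) \<times> carrier (cohomology R (sub_term R T act n) act 3))"
proof (rule inj_onI)
  fix x y
  assume x: "x \<in> carrier (cohomology R T act 2) \<times> carrier (cohomology R (sub_term R T act n) act 3)"
    and y: "y \<in> carrier (cohomology R T act 2) \<times> carrier (cohomology R (sub_term R T act n) act 3)"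
    and eq: "assemble R T act n x = assemble R T act n y"
  obtain \<gamma> \<delta> where d: "decomposition n \<gamma> \<delta>" "x = (clT \<gamma>, clS n (D 2 \<delta>))"
    using carrier_H2_H3_decomposition[OF deep x] by blast
  obtain \<gamma>' \<delta>' where d': "decomposition n \<gamma>' \<delta>'" "y = (clT \<gamma>', clS n (D 2 \<delta>'))"
    using carrier_H2_H3_decomposition[OF deep y] by blast
  note V1 = decompositionD[OF d(1)] and V2 = decompositionD[OF d'(1)]
  have "clA n (plus \<gamma> \<delta>) = clA n (plus \<gamma>' \<delta>')"
    using eq d d' assemble_decomposition[OF deep] by simp
  then have "coh V (Vs n) 1 (plus \<gamma> \<delta>) (plus \<gamma>' \<delta>')" using clA_eq_iff V1(6) V2(6) by blast
  then have "coh V {0} 1 \<gamma> \<gamma>'" "coh (Vs n) {0} 2 (D 2 \<delta>) (D 2 \<delta>')"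
    using decomposition_unique[OF deep d(1) d'(1)] by auto
  then show "x = y" using clT_eq_iff[OF V1(1) V2(1)] clS_eq_iff[OF V1(4) V2(4)] d d' by simp
qed

section \<open>Passing from n to n + d\<close>

lemma E_p_mult: "x \<in> E n \<Longrightarrow> of_nat p * x \<in> E (n + d)"
  unfolding E_def multiples_p_Vs[symmetric]
  using multiplesI[of "of_nat q * x" "Vs n" p] add_subgroup_of_nat_mult[OF V, of x p]
  by (auto simp: mult.left_commute)

text \<open>With \<open>E_p_mult\<close> this gives p \<open>E n\<close> = \<open>E (n + d)\<close>.
  From qy = ps with s in T_n, first s is written as qx with x in \<open>E n\<close>, then q is
  cancelled.\<close>

lemma E_p_divide:
  assumes "deep n" "y \<in> E (n + d)" shows "\<exists>x\<in>E n. y = of_nat p * x"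
proof -
  have y: "y \<in> V" "of_nat q * y \<in> multiples p (Vs n)"
    using assms(2) unfolding E_def multiples_p_Vs by auto
  then obtain s where s: "s \<in> Vs n" "of_nat q * y = of_nat p * s" by (blast elim: multiplesE)
  then obtain x where x: "x \<in> E n" "s = of_nat q * x" using deep_Vs[OF assms(1)] by blast
  then have "of_nat q * y = of_nat q * (of_nat p * x)" using s by (simp add: mult.left_commute)
  then have "y = of_nat p * x"
    using cancel_power y(1) x(1) E_subset add_subgroup_of_nat_mult[OF V] by blast
  then show ?thesis using x(1) by blast
qed

lemma decomposition_times_p:
  assumes d: "decomposition n \<gamma> \<delta>" shows "decomposition (n + d) \<gamma> (times p \<delta>)"
proof -
  note V1 = decompositionD[OF d]
  have "val 2 (E (n + d)) (times p \<delta>)" using V1(3) E_p_mult by (simp add: valued_def)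
  moreover have "val 3 (Vs (n + d)) (D 2 (times p \<delta>))"
    using V1(4) by (simp add: valued_def D2_of_nat_mult[OF V1(5)] multiples_p_Vs[symmetric] multiplesI)
  ultimately show ?thesis unfolding decomposition_def using V1 by blast
qed

text \<open>The inverse image is the pair of components by \<open>inj_on_assemble\<close>, and \<mu>
  multiplies the 3-cocycle \<open>D 2 \<delta>\<close> by p, which amounts to replacing \<delta> by
  p\<delta>.\<close>

lemma id_plus_mu_clA:
  assumes deep: "deep n" and d: "decomposition n \<gamma> \<delta>"
  shows "id_plus_mu p d R T act n (clA n (plus \<gamma> \<delta>)) = clA (n + d) (plus \<gamma> (times p \<delta>))"
proof -
  note V1 = decompositionD[OF d]
  let ?C = "carrier (cohomology R T act 2) \<times> carrier (cohomology R (sub_term R T act n) act 3)"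
  have mem: "(clT \<gamma>, clS n (D 2 \<delta>)) \<in> ?C"
    unfolding carrier_H2_T carrier_H3_S using V1 by blast
  have inv: "inv_into ?C (assemble R T act n) (clA n (plus \<gamma> \<delta>)) = (clT \<gamma>, clS n (D 2 \<delta>))"
    using inv_into_f_f[OF inj_on_assemble[OF deep] mem]
    unfolding assemble_decomposition[OF deep d] .
  have "lift_cochain R \<psi> 3 (times p (D 2 \<delta>)) = lift_cochain R \<psi> 3 (D 2 (times p \<delta>))"
    by (auto simp: lift_cochain_def D2_of_nat_mult[OF V1(5)])
  then have "clS (n + d) (times p (D 2 \<delta>)) = clS (n + d) (D 2 (times p \<delta>))"
    by (simp add: lift_class_def)
  then show ?thesis
    unfolding id_plus_mu_def inv
    using coh_map_p[OF V1(4)] assemble_decomposition[OF deep_mono[OF deep] decomposition_times_p[OF d]]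
    by simp
qed

lemma carrier_H2_A_decomposition:
  assumes deep: "deep n"
  shows "carrier (H2_quot R T act n) = {clA n (plus \<gamma> \<delta>) | \<gamma> \<delta>. decomposition n \<gamma> \<delta>}"
  unfolding carrier_H2_A
  using decomposition_exists[OF deep] decompositionD(6,7) by blast

lemma clA_mem_carrier:
  assumes "decomposition n \<gamma> \<delta>" shows "clA n (plus \<gamma> \<delta>) \<in> carrier (H2_quot R T act n)"
  unfolding carrier_H2_A using decompositionD(6,7)[OF assms] by blast

text \<open>\<mu> is well defined and injective on classes: a cochain with values in T_(n+d) = pT_n
  is p times a cochain with values in T_n, and p can be cancelled in V.\<close>

lemma coh_times_p:
  assumes "val 3 (Vs n) F" "val 3 (Vs n) G"
  shows "coh (Vs (n + d)) {0} 2 (times p F) (times p G) \<longleftrightarrow> coh (Vs n) {0} 2 F G"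
proof
  assume "coh (Vs n) {0} 2 F G"
  then obtain t where t: "val 2 (Vs n) t" "\<And>gs. gs \<in> tuples R 3 \<Longrightarrow> F gs - G gs = D 2 t gs"
    by (auto simp: cohomologous_mod_def valued_def)
  have "val 2 (Vs (n + d)) (times p t)"
    using t(1) by (simp add: valued_def multiples_p_Vs[symmetric] multiplesI)
  moreover have "of_nat p * F gs - of_nat p * G gs - D 2 (times p t) gs = 0"
    if gs: "gs \<in> tuples R 3" for gs
    using D2_of_nat_mult[OF val_Vs_V[OF t(1)] gs, of p] t(2)[OF gs, symmetric]
    by (simp add: algebra_simps)
  ultimately show "coh (Vs (n + d)) {0} 2 (times p F) (times p G)"
    unfolding cohomologous_mod_def Suc_2 by (intro exI[of _ "times p t"]) (simp add: valued_def)
next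
  assume "coh (Vs (n + d)) {0} 2 (times p F) (times p G)"
  then obtain t where t: "val 2 (Vs (n + d)) t"
    "\<And>gs. gs \<in> tuples R 3 \<Longrightarrow> of_nat p * F gs - of_nat p * G gs = D 2 t gs"
    by (auto simp: cohomologous_mod_def valued_def)
  have "\<forall>gs\<in>tuples R 2. \<exists>y\<in>Vs n. t gs = of_nat p * y"
    using t(1) unfolding valued_def multiples_p_Vs[symmetric] by (blast elim: multiplesE)
  then obtain s where s: "\<And>gs. gs \<in> tuples R 2 \<Longrightarrow> s gs \<in> Vs n \<and> t gs = of_nat p * s gs" by metis
  then have sV: "val 2 (Vs n) s" by (simp add: valued_def)
  have "F gs - G gs - D 2 s gs = 0" if gs: "gs \<in> tuples R 3" for gs
  proof -
    have "D 2 t gs = D 2 (times p s) gs" by (rule D2_cong[OF _ gs]) (simp add: s)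
    then have "of_nat p * (F gs - G gs) = of_nat p * D 2 s gs"
      using t(2)[OF gs] D2_of_nat_mult[OF val_Vs_V[OF sV] gs, of p] by (simp add: algebra_simps)
    moreover have "F gs - G gs \<in> V"
      using valuedD[OF val_Vs_V[OF assms(1)] gs] valuedD[OF val_Vs_V[OF assms(2)] gs]
      by (rule add_subgroup_diff[OF V])
    ultimately have "F gs - G gs = D 2 s gs"
      using cancel_p valuedD[OF D2_valued[OF val_Vs_V[OF sV] V invariant_V] gs] by blast
    then show ?thesis by simp
  qed
  then show "coh (Vs n) {0} 2 F G"
    unfolding cohomologous_mod_def Suc_2 using sV by (intro exI[of _ s]) (simp add: valued_def)
qed

lemma coh_cong:
  assumes "\<And>gs. gs \<in> tuples R (Suc n) \<Longrightarrow> F gs = F' gs" "\<And>gs. gs \<in> tuples R (Suc n) \<Longrightarrow> G gs = G' gs"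
  shows "coh X K n F G \<longleftrightarrow> coh X K n F' G'"
  unfolding cohomologous_mod_def valued_def using assms by simp

text \<open>Additivity is visible in the cochain formula. For injectivity,
  \<open>decomposition_unique\<close> is applied at n + d, the factor p is removed by
  \<open>coh_times_p\<close>, and \<open>decomposition_coh\<close> leads back to classes modulo
  T_n.\<close>

lemma id_plus_mu_iso:
  assumes deep: "deep n"
  shows "id_plus_mu p d R T act n \<in> iso (H2_quot R T act n) (H2_quot R T act (n + d))"
proof -
  have deep': "deep (n + d)" using deep_mono[OF deep] by simp
  interpret pA: presented_module R V A "quot_term R T act n" "quot_act act" V "Vs n" "red n"
    by (rule presented_A)
  interpret pA': presented_module R V A "quot_term R T act (n + d)" "quot_act act" V "Vs (n + d)"
    "red (n + d)"
    by (rule presented_A)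
  let ?f = "id_plus_mu p d R T act n"
  have "?f \<in> hom (H2_quot R T act n) (H2_quot R T act (n + d))"
  proof (rule homI)
    fix x assume "x \<in> carrier (H2_quot R T act n)"
    then obtain \<gamma> \<delta> where d: "decomposition n \<gamma> \<delta>" "x = clA n (plus \<gamma> \<delta>)"
      unfolding carrier_H2_A_decomposition[OF deep] by blast
    have "?f x = clA (n + d) (plus \<gamma> (times p \<delta>))"
      using id_plus_mu_clA[OF deep d(1)] d(2) by simp
    then show "?f x \<in> carrier (H2_quot R T act (n + d))"
      using clA_mem_carrier[OF decomposition_times_p[OF d(1)]] by simp
  next
    fix x y assume "x \<in> carrier (H2_quot R T act n)" "y \<in> carrier (H2_quot R T act n)"
    then obtain \<gamma> \<delta> \<gamma>' \<delta>' where d: "decomposition n \<gamma> \<delta>" "x = clA n (plus \<gamma> \<delta>)"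
      and d': "decomposition n \<gamma>' \<delta>'" "y = clA n (plus \<gamma>' \<delta>')"
      unfolding carrier_H2_A_decomposition[OF deep] by blast
    note V1 = decompositionD[OF d(1)] and V2 = decompositionD[OF d'(1)]
    note V1' = decompositionD[OF decomposition_times_p[OF d(1)]]
      and V2' = decompositionD[OF decomposition_times_p[OF d'(1)]]
    have d'': "decomposition n (plus \<gamma> \<gamma>') (plus \<delta> \<delta>')"
      unfolding decomposition_def
      using V1 V2 valued_plus[OF V V1(1) V2(1)] valued_plus[OF E_subgroup V1(3) V2(3)]
      by (simp add: valued_def D2_add[OF V1(1) V2(1)] D2_add[OF V1(5) V2(5)] add_subgroup_add[OF Vs_subgroup])
    have "x \<otimes>\<^bsub>H2_quot R T act n\<^esub> y = clA n (plus (plus \<gamma> \<delta>) (plus \<gamma>' \<delta>'))"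
      using pA.cl_mult[where n = 1] V1(6) V2(6) unfolding d(2) d'(2) Suc_1 by blast
    also have "plus (plus \<gamma> \<delta>) (plus \<gamma>' \<delta>') = plus (plus \<gamma> \<gamma>') (plus \<delta> \<delta>')"
      by (simp add: algebra_simps)
    finally have "?f (x \<otimes>\<^bsub>H2_quot R T act n\<^esub> y) =
        clA (n + d) (plus (plus \<gamma> \<gamma>') (times p (plus \<delta> \<delta>')))"
      using id_plus_mu_clA[OF deep d''] by simp
    also have "plus (plus \<gamma> \<gamma>') (times p (plus \<delta> \<delta>')) =
        plus (plus \<gamma> (times p \<delta>)) (plus \<gamma>' (times p \<delta>'))"
      by (simp add: algebra_simps)
    also have "clA (n + d) \<dots> = clA (n + d) (plus \<gamma> (times p \<delta>))
        \<otimes>\<^bsub>H2_quot R T act (n + d)\<^esub> clA (n + d) (plus \<gamma>' (times p \<delta>'))"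
      using pA'.cl_mult[where n = 1 and F = "plus \<gamma> (times p \<delta>)" and G = "plus \<gamma>' (times p \<delta>')"]
        V1'(6) V2'(6) unfolding Suc_1 by simp
    finally show "?f (x \<otimes>\<^bsub>H2_quot R T act n\<^esub> y) = ?f x \<otimes>\<^bsub>H2_quot R T act (n + d)\<^esub> ?f y"
      using id_plus_mu_clA[OF deep d(1)] id_plus_mu_clA[OF deep d'(1)] d(2) d'(2) by simp
  qed
  moreover have "inj_on ?f (carrier (H2_quot R T act n))"
  proof (rule inj_onI)
    fix x y assume x: "x \<in> carrier (H2_quot R T act n)" and y: "y \<in> carrier (H2_quot R T act n)"
      and eq: "?f x = ?f y"
    obtain \<gamma> \<delta> where d: "decomposition n \<gamma> \<delta>" "x = clA n (plus \<gamma> \<delta>)"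
      using x unfolding carrier_H2_A_decomposition[OF deep] by blast
    obtain \<gamma>' \<delta>' where d': "decomposition n \<gamma>' \<delta>'" "y = clA n (plus \<gamma>' \<delta>')"
      using y unfolding carrier_H2_A_decomposition[OF deep] by blast
    note V1 = decompositionD[OF d(1)] and V2 = decompositionD[OF d'(1)]
    note V1' = decompositionD[OF decomposition_times_p[OF d(1)]]
      and V2' = decompositionD[OF decomposition_times_p[OF d'(1)]]
    have "clA (n + d) (plus \<gamma> (times p \<delta>)) = clA (n + d) (plus \<gamma>' (times p \<delta>'))"
      using eq id_plus_mu_clA[OF deep d(1)] id_plus_mu_clA[OF deep d'(1)] d(2) d'(2) by simp
    then have *: "coh V (Vs (n + d)) 1 (plus \<gamma> (times p \<delta>)) (plus \<gamma>' (times p \<delta>'))"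
      using clA_eq_iff V1'(6) V2'(6) by blast
    have "coh (Vs (n + d)) {0} 2 (D 2 (times p \<delta>)) (D 2 (times p \<delta>'))" and g: "coh V {0} 1 \<gamma> \<gamma>'"
      using decomposition_unique[OF deep' decomposition_times_p[OF d(1)] decomposition_times_p[OF d'(1)] *]
      by auto
    moreover have "coh (Vs (n + d)) {0} 2 (D 2 (times p \<delta>)) (D 2 (times p \<delta>')) \<longleftrightarrow>
        coh (Vs (n + d)) {0} 2 (times p (D 2 \<delta>)) (times p (D 2 \<delta>'))"
      unfolding Suc_2[symmetric]
      by (rule coh_cong) (simp_all add: D2_of_nat_mult[OF V1(5)] D2_of_nat_mult[OF V2(5)])
    ultimately have "coh (Vs n) {0} 2 (D 2 \<delta>) (D 2 \<delta>')"
      using coh_times_p[OF V1(4) V2(4)] by blast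
    then have "coh V (Vs n) 1 (plus \<gamma> \<delta>) (plus \<gamma>' \<delta>')"
      using decomposition_coh[OF deep d(1) d'(1) g] by blast
    then show "x = y" using clA_eq_iff[OF V1(6) V2(6)] d d' by simp
  qed
  moreover have "carrier (H2_quot R T act (n + d)) \<subseteq> ?f ` carrier (H2_quot R T act n)"
  proof
    fix y assume "y \<in> carrier (H2_quot R T act (n + d))"
    then obtain \<gamma> \<delta>' where d': "decomposition (n + d) \<gamma> \<delta>'" "y = clA (n + d) (plus \<gamma> \<delta>')"
      unfolding carrier_H2_A_decomposition[OF deep'] by blast
    note V2 = decompositionD[OF d'(1)]
    \<comment> \<open>Surjectivity: \<delta>' is divided by p inside \<open>E n\<close>. The
      boundary of the quotient lies in T_n because p times it lies in T_(n+d) = pT_n.\<close>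
    have "\<forall>gs\<in>tuples R 2. \<exists>x\<in>E n. \<delta>' gs = of_nat p * x"
      using V2(3) E_p_divide[OF deep] by (auto simp: valued_def)
    then obtain \<delta> where \<delta>: "\<And>gs. gs \<in> tuples R 2 \<Longrightarrow> \<delta> gs \<in> E n \<and> \<delta>' gs = of_nat p * \<delta> gs" by metis
    then have \<delta>E: "val 2 (E n) \<delta>" by (simp add: valued_def)
    have "val 3 (Vs n) (D 2 \<delta>)"
      unfolding valued_def
    proof
      fix gs assume gs: "gs \<in> tuples R 3"
      have "D 2 \<delta>' gs = D 2 (times p \<delta>) gs" by (rule D2_cong[OF _ gs]) (simp add: \<delta>)
      also have "\<dots> = of_nat p * D 2 \<delta> gs" by (rule D2_of_nat_mult[OF val_E_V[OF \<delta>E] gs])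
      finally have "of_nat p * D 2 \<delta> gs \<in> multiples p (Vs n)"
        using valuedD[OF V2(4) gs] by (simp add: multiples_p_Vs)
      then obtain s where s: "s \<in> Vs n" "of_nat p * D 2 \<delta> gs = of_nat p * s" by (blast elim: multiplesE)
      then have "D 2 \<delta> gs = s"
        using cancel_p valuedD[OF D2_valued[OF val_E_V[OF \<delta>E] V invariant_V] gs] Vs_subset by blast
      then show "D 2 \<delta> gs \<in> Vs n" using s(1) by simp
    qed
    then have d: "decomposition n \<gamma> \<delta>" unfolding decomposition_def using V2 \<delta>E by blast
    have "lift_cochain R (red (n + d)) 2 (plus \<gamma> (times p \<delta>)) = lift_cochain R (red (n + d)) 2 (plus \<gamma> \<delta>')"
      unfolding lift_cochain_def by (rule restrict_ext) (simp add: \<delta>)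
    then have "y = ?f (clA n (plus \<gamma> \<delta>))"
      using id_plus_mu_clA[OF deep d] d'(2) by (simp add: lift_class_def)
    moreover have "clA n (plus \<gamma> \<delta>) \<in> carrier (H2_quot R T act n)"
      by (rule clA_mem_carrier[OF d])
    ultimately show "y \<in> ?f ` carrier (H2_quot R T act n)" by simp
  qed
  ultimately show ?thesis
    unfolding iso_def bij_betw_def by (auto simp: hom_def)
qed

end

section \<open>Compatible pairs\<close>

locale projective_lattice = embedded_lattice R V A p e d Vs T act \<psi>
  for R :: "'g monoid" (structure) and V :: "'v::comm_ring_1 set" and A p e d Vs
    and T :: "'w monoid" and act \<psi> +
  assumes lifting: "add_subgroup U \<Longrightarrow> U \<subseteq> V \<Longrightarrow> multiples (p ^ m) V \<subseteq> U \<Longrightarrow>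
      (\<And>x. x \<in> V \<Longrightarrow> h x \<in> V) \<Longrightarrow>
      (\<And>x y. x \<in> V \<Longrightarrow> y \<in> V \<Longrightarrow> h (x + y) - (h x + h y) \<in> U) \<Longrightarrow>
      \<exists>F. additive_on V F \<and> (\<forall>x\<in>V. F x \<in> V \<and> F x - h x \<in> U)"
begin

section \<open>Compatible pairs lifted to additive maps of T\<close>

lemma add_sum_least: "add_subgroup U \<Longrightarrow> M \<subseteq> U \<Longrightarrow> N \<subseteq> U \<Longrightarrow> add_sum M N \<subseteq> U"
  by (auto simp: add_sum_def intro: add_subgroup_add)

definition twist :: "('g \<Rightarrow> 'g) \<Rightarrow> ('v \<Rightarrow> 'v) \<Rightarrow> ('g list \<Rightarrow> 'v) \<Rightarrow> 'g list \<Rightarrow> 'v" where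
  "twist \<beta> F f gs = F (f (map (inv_into (carrier R) \<beta>) gs))"

text \<open>A lift to V of a compatible pair for T/T_n. Invertibility modulo T_n is encoded as
  surjectivity modulo T_1: this condition has the same form for n and n + d, and it suffices by
  \<open>compatible_surj\<close> and the finiteness of T/T_n.\<close>

definition compatible :: "nat \<Rightarrow> ('g \<Rightarrow> 'g) \<Rightarrow> ('v \<Rightarrow> 'v) \<Rightarrow> bool" where
  "compatible n \<beta> F \<longleftrightarrow>
     \<beta> \<in> auto R \<and> additive_on V F \<and> (\<forall>x\<in>V. F x \<in> V) \<and>
     (\<forall>x\<in>V. \<forall>g\<in>carrier R. F (A x g) - A (F x) (\<beta> g) \<in> Vs n) \<and>
     (\<forall>x\<in>V. \<exists>y\<in>V. x - F y \<in> Vs 1)"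

lemma autoD:
  assumes "\<beta> \<in> auto R"
  shows "\<beta> \<in> hom R R" "inv_into (carrier R) \<beta> \<in> hom R R"
    "\<And>g. g \<in> carrier R \<Longrightarrow> \<beta> g \<in> carrier R"
    "\<And>g. g \<in> carrier R \<Longrightarrow> inv_into (carrier R) \<beta> g \<in> carrier R"
    "\<And>g. g \<in> carrier R \<Longrightarrow> \<beta> (inv_into (carrier R) \<beta> g) = g"
    "\<And>g. g \<in> carrier R \<Longrightarrow> inv_into (carrier R) \<beta> (\<beta> g) = g"
proof -
  have \<beta>: "\<beta> \<in> hom R R" "bij_betw \<beta> (carrier R) (carrier R)"
    using assms by (auto simp: auto_def Bij_def)
  then have "\<beta> \<in> iso R R" by (simp add: iso_def)
  then have "inv_into (carrier R) \<beta> \<in> iso R R" by (rule iso_set_sym)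
  then show "\<beta> \<in> hom R R" "inv_into (carrier R) \<beta> \<in> hom R R" using \<beta> by (auto simp: iso_def)
  then show "\<And>g. g \<in> carrier R \<Longrightarrow> \<beta> g \<in> carrier R"
    "\<And>g. g \<in> carrier R \<Longrightarrow> inv_into (carrier R) \<beta> g \<in> carrier R"
    by (auto simp: hom_def)
  show "\<And>g. g \<in> carrier R \<Longrightarrow> \<beta> (inv_into (carrier R) \<beta> g) = g"
    "\<And>g. g \<in> carrier R \<Longrightarrow> inv_into (carrier R) \<beta> (\<beta> g) = g"
    using \<beta>(2) by (auto simp: bij_betw_inv_into_right bij_betw_inv_into_left)
qed

lemma compatibleD:
  assumes "compatible n \<beta> F"
  shows "\<beta> \<in> auto R" "additive_on V F" "\<And>x. x \<in> V \<Longrightarrow> F x \<in> V"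
    "\<And>x g. x \<in> V \<Longrightarrow> g \<in> carrier R \<Longrightarrow> F (A x g) - A (F x) (\<beta> g) \<in> Vs n"
    "\<And>x. x \<in> V \<Longrightarrow> \<exists>y\<in>V. x - F y \<in> Vs 1"
  using assms by (auto simp: compatible_def)

text \<open>F carries a commutator of y with g to the commutator of F y with \<beta> g, up to an
  error in T_n. The error is harmless as long as i \<le> n.\<close>

lemma compatible_Vs:
  assumes c: "compatible n \<beta> F" and "i \<le> n" "x \<in> Vs i"
  shows "F x \<in> Vs i"
  using assms(2,3)
proof (induction i arbitrary: x)
  case 0
  then show ?case using compatibleD(3)[OF c] by (simp add: Vs_0)
next
  case (Suc i)
  note F = compatibleD[OF c]
  define U where "U = {x \<in> V. F x \<in> Vs (Suc i)}"
  have "add_subgroup U"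
    using V Vs_subgroup[of "Suc i"] additive_on_zero[OF V F(2)] additive_on_diff[OF V F(2)]
    by (auto simp: U_def add_subgroup_def)
  moreover have "A y g - y \<in> U" if y: "y \<in> Vs i" and g: "g \<in> carrier R" for y g
  proof -
    have yV: "y \<in> V" using y Vs_subset by blast
    have "F y \<in> Vs i" using Suc.IH[OF _ y] Suc.prems by simp
    then have 1: "A (F y) (\<beta> g) - F y \<in> Vs (Suc i)"
      using Vs_commutator autoD(3)[OF F(1) g] by blast
    have 2: "F (A y g) - A (F y) (\<beta> g) \<in> Vs (Suc i)"
      using F(4)[OF yV g] Vs_antimono[OF Suc.prems(1)] by blast
    have "F (A y g - y) = (F (A y g) - A (F y) (\<beta> g)) + (A (F y) (\<beta> g) - F y)"
      using additive_on_diff[OF V F(2) A_closed[OF yV g] yV] by simp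
    then have "F (A y g - y) \<in> Vs (Suc i)"
      by (simp only: add_subgroup_add[OF Vs_subgroup 2 1])
    then show ?thesis using A_closed[OF yV g] yV by (simp add: U_def add_subgroup_diff[OF V])
  qed
  ultimately have "Vs (Suc i) \<subseteq> U" by (rule Vs_least)
  then show ?case using Suc.prems by (auto simp: U_def)
qed

text \<open>A Frattini argument. If V = F V + T_j, then the commutators that generate T_1 lie in F V
  + T_(j+1), up to errors in T_n; with V = F V + T_1 it follows that V = F V + T_(j+1).\<close>

lemma compatible_surj:
  assumes c: "compatible n \<beta> F" and x: "x \<in> V"
  shows "\<exists>y\<in>V. x - F y \<in> Vs n"
proof -
  note F = compatibleD[OF c]
  have FV: "add_subgroup (F ` V)" by (rule additive_on_image[OF V F(2) V]) simp
  have F1: "V \<subseteq> add_sum (F ` V) (Vs 1)"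
  proof
    fix x assume "x \<in> V"
    then obtain y where "y \<in> V" "x - F y \<in> Vs 1" using F(5) by blast
    then show "x \<in> add_sum (F ` V) (Vs 1)" using add_sumI[of "F y" "F ` V" "x - F y"] by simp
  qed
  have "V \<subseteq> add_sum (F ` V) (Vs j)" if "j \<le> n" for j
    using that
  proof (induction j)
    case 0
    have "x \<in> add_sum (F ` V) (Vs 0)" if "x \<in> V" for x
      using add_sumI[of 0 "F ` V" x "Vs 0"] FV that by (simp add: Vs_0 add_subgroup_zero)
    then show ?case by blast
  next
    case (Suc j)
    let ?U = "add_sum (F ` V) (Vs (Suc j))"
    have U: "add_subgroup ?U" by (rule add_subgroup_add_sum[OF FV Vs_subgroup])
    have "Vs 1 \<subseteq> ?U"
      unfolding One_nat_def
    proof (rule Vs_least[OF U])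
      fix x g assume "x \<in> Vs 0" and g: "g \<in> carrier R"
      then obtain y z where y: "y \<in> V" and z: "z \<in> Vs j" and x: "x = F y + z"
        using Suc by (fastforce simp: add_sum_def Vs_0)
      \<comment> \<open>F is equivariant along \<beta>, so a commutator with g in the image arises
        from a commutator with the preimage g' of g.\<close>
      define g' where "g' = inv_into (carrier R) \<beta> g"
      have g': "g' \<in> carrier R" "\<beta> g' = g" unfolding g'_def using autoD[OF F(1)] g by auto
      have "F (A y g') - A (F y) g \<in> Vs n" using F(4)[OF y g'(1)] g'(2) by simp
      then have "F (A y g') - A (F y) g \<in> Vs (Suc j)" using Vs_antimono[OF Suc.prems] by blast
      moreover have "A z g - z \<in> Vs (Suc j)" by (rule Vs_commutator[OF z g])
      ultimately have 2: "(A z g - z) - (F (A y g') - A (F y) g) \<in> Vs (Suc j)"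
        using add_subgroup_diff[OF Vs_subgroup] by blast
      have zV: "z \<in> V" using z Vs_subset by blast
      have 1: "F (A y g' - y) \<in> F ` V" using A_closed[OF y g'(1)] y add_subgroup_diff[OF V] by blast
      have "A x g - x = F (A y g' - y) + ((A z g - z) - (F (A y g') - A (F y) g))"
        using x A_add[OF g F(3)[OF y] zV] additive_on_diff[OF V F(2) A_closed[OF y g'(1)] y] by simp
      then show "A x g - x \<in> ?U" by (simp only: add_sumI[OF 1 2])
    qed
    moreover have "F ` V \<subseteq> ?U"
    proof
      fix x assume "x \<in> F ` V"
      then show "x \<in> ?U" using add_sumI[of x "F ` V" 0] Vs_subgroup by (simp add: add_subgroup_zero)
    qed
    ultimately have "add_sum (F ` V) (Vs 1) \<subseteq> ?U"
      by (intro add_sum_least U)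
    then show ?case using F1 by blast
  qed
  then obtain y z where "y \<in> V" "z \<in> Vs n" "x = F y + z"
    using x by (fastforce simp: add_sum_def)
  then show ?thesis by (intro bexI[of _ y]) simp_all
qed

section \<open>The action of lifted pairs on cochains and classes\<close>

lemma twist_valued:
  assumes c: "compatible n \<beta> F" and "val m V f" shows "val m V (twist \<beta> F f)"
  unfolding valued_def twist_def
  using compatibleD(3)[OF c] valuedD[OF assms(2)] tuples_map autoD(4)[OF compatibleD(1)[OF c]] by blast

lemma twist_D:
  assumes c: "compatible n \<beta> F" and f: "val m V f" and gs: "gs \<in> tuples R (Suc m)"
  shows "D m (twist \<beta> F f) gs - twist \<beta> F (D m f) gs \<in> Vs n"
proof -
  note F = compatibleD[OF c] and \<beta> = autoD[OF compatibleD(1)[OF c]]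
  have "F (A x (inv_into (carrier R) \<beta> g)) - A (F x) g \<in> Vs n" if "x \<in> V" "g \<in> carrier R" for x g
    using F(4)[OF that(1) \<beta>(4)[OF that(2)]] \<beta>(5)[OF that(2)] by simp
  then show ?thesis
    using D_map[OF \<beta>(2) F(2) Vs_subgroup _ f gs] unfolding twist_def by blast
qed

lemma twist_cocycle:
  assumes c: "compatible n \<beta> F" and f: "val 2 V f" "val 3 (Vs n) (D 2 f)"
  shows "val 3 (Vs n) (D 2 (twist \<beta> F f))"
  unfolding valued_def
proof
  fix gs assume gs: "gs \<in> tuples R 3"
  have "map (inv_into (carrier R) \<beta>) gs \<in> tuples R 3"
    using tuples_map gs autoD(4)[OF compatibleD(1)[OF c]] by blast
  then have "twist \<beta> F (D 2 f) gs \<in> Vs n"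
    unfolding twist_def using compatible_Vs[OF c order_refl] valuedD[OF f(2)] by blast
  moreover have "D 2 (twist \<beta> F f) gs - twist \<beta> F (D 2 f) gs \<in> Vs n"
    using twist_D[OF c f(1)] gs by simp
  ultimately show "D 2 (twist \<beta> F f) gs \<in> Vs n" using add_subgroup_cong[OF Vs_subgroup] by blast
qed

lemma finite_carrier_A: "finite (carrier (quot_term R T act n))"
proof -
  interpret pA: presented_module R V A "quot_term R T act n" "quot_act act" V "Vs n" "red n"
    by (rule presented_A)
  have "card (red n ` V) = p ^ n"
    using add_index_eq_card_image[OF Vs_subgroup[of n], of V "red n"] pA.\<rho>_eq_iff V_Vs_index by simp
  moreover have "p ^ n > 0" using prime prime_gt_0_nat by simp
  ultimately have "finite (red n ` V)" by (metis card_ge_0_finite)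
  moreover have "carrier (quot_term R T act n) \<subseteq> red n ` V" using pA.\<rho>_surj by blast
  ultimately show ?thesis by (rule finite_subset[rotated])
qed

text \<open>F maps T_n to itself and so induces \<epsilon> on T/T_n. \<open>compatible_surj\<close>
  makes \<epsilon> surjective, and as T/T_n is finite it is bijective.\<close>

lemma Comp_of_compatible:
  assumes c: "compatible n \<beta> F"
  shows "\<exists>\<epsilon>. (\<beta>, \<epsilon>) \<in> carrier (Comp R (quot_term R T act n) (quot_act act)) \<and>
    (\<forall>x\<in>V. \<epsilon> (red n x) = red n (F x))"
proof -
  note F = compatibleD[OF c]
  let ?Q = "quot_term R T act n"
  interpret pA: presented_module R V A ?Q "quot_act act" V "Vs n" "red n"
    by (rule presented_A)
  \<comment> \<open>Restricted to the carrier, because the members of \<open>auto\<close> are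
    extensional functions.\<close>
  define \<epsilon> where "\<epsilon> = (\<lambda>C\<in>carrier ?Q. red n (F (SOME x. x \<in> V \<and> red n x = C)))"
  have eps: "\<epsilon> (red n x) = red n (F x)" if x: "x \<in> V" for x
  proof -
    define y where "y = (SOME y. y \<in> V \<and> red n y = red n x)"
    have y: "y \<in> V" "red n y = red n x"
      unfolding y_def using someI[of "\<lambda>y. y \<in> V \<and> red n y = red n x" x] x by auto
    then have "y - x \<in> Vs n" using pA.\<rho>_eq_iff x by blast
    then have "F y - F x \<in> Vs n"
      using compatible_Vs[OF c order_refl] additive_on_diff[OF V F(2) y(1) x] by fastforce
    then have "red n (F y) = red n (F x)" using pA.\<rho>_eq_iff[OF F(3)[OF y(1)] F(3)[OF x]] by blast
    then show ?thesis using pA.\<rho>_closed[OF x] by (simp add: \<epsilon>_def y_def)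
  qed
  have carr: "carrier ?Q = red n ` V" using pA.\<rho>_closed pA.\<rho>_surj by blast
  have closed: "\<epsilon> C \<in> carrier ?Q" if "C \<in> carrier ?Q" for C
    using that F(3) pA.\<rho>_closed eps unfolding carr by auto
  have hom: "\<epsilon> \<in> hom ?Q ?Q"
  proof (rule homI)
    fix C C' assume "C \<in> carrier ?Q" "C' \<in> carrier ?Q"
    then obtain x y where xy: "x \<in> V" "y \<in> V" "C = red n x" "C' = red n y" unfolding carr by auto
    have "\<epsilon> (C \<otimes>\<^bsub>?Q\<^esub> C') = \<epsilon> (red n (x + y))" using pA.\<rho>_add[OF xy(1,2)] xy by simp
    also have "\<dots> = red n (F x + F y)"
      using eps[OF add_subgroup_add[OF V xy(1,2)]] additive_on_add[OF F(2) xy(1,2)] by simp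
    also have "\<dots> = \<epsilon> C \<otimes>\<^bsub>?Q\<^esub> \<epsilon> C'" using pA.\<rho>_add[OF F(3) F(3)] eps xy by simp
    finally show "\<epsilon> (C \<otimes>\<^bsub>?Q\<^esub> C') = \<epsilon> C \<otimes>\<^bsub>?Q\<^esub> \<epsilon> C'" .
  qed (rule closed)
  have surj: "\<epsilon> ` carrier ?Q = carrier ?Q"
  proof (intro equalityI subsetI)
    fix C assume "C \<in> carrier ?Q"
    then obtain x where x: "x \<in> V" "C = red n x" unfolding carr by blast
    obtain y where y: "y \<in> V" "x - F y \<in> Vs n" using compatible_surj[OF c x(1)] by blast
    then have "C = \<epsilon> (red n y)" using pA.\<rho>_eq_iff[OF x(1) F(3)] eps x(2) by simp
    then show "C \<in> \<epsilon> ` carrier ?Q" using y(1) unfolding carr by blast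
  qed (use closed in blast)
  then have "inj_on \<epsilon> (carrier ?Q)"
    using finite_carrier_A[of n] by (intro eq_card_imp_inj_on) simp_all
  then have "\<epsilon> \<in> auto ?Q"
    using surj hom by (simp add: auto_def Bij_def bij_betw_def \<epsilon>_def)
  moreover have "\<epsilon> (quot_act act C g) = quot_act act (\<epsilon> C) (\<beta> g)"
    if C: "C \<in> carrier ?Q" and g: "g \<in> carrier R" for C g
  proof -
    obtain x where x: "x \<in> V" "C = red n x" using C unfolding carr by blast
    have \<beta>g: "\<beta> g \<in> carrier R" by (rule autoD(3)[OF F(1) g])
    have "\<epsilon> (quot_act act C g) = red n (F (A x g))"
      using pA.\<rho>_act[OF x(1) g] x eps[OF A_closed[OF x(1) g]] by simp
    also have "\<dots> = red n (A (F x) (\<beta> g))"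
      using F(4)[OF x(1) g] pA.\<rho>_eq_iff[OF F(3)[OF A_closed[OF x(1) g]] A_closed[OF F(3)[OF x(1)] \<beta>g]]
      by blast
    also have "\<dots> = quot_act act (\<epsilon> C) (\<beta> g)"
      using pA.\<rho>_act[OF F(3)[OF x(1)] \<beta>g] x eps[OF x(1)] by simp
    finally show ?thesis .
  qed
  ultimately have "(\<beta>, \<epsilon>) \<in> carrier (Comp R ?Q (quot_act act))"
    using F(1) by (simp add: Comp_def)
  then show ?thesis using eps by blast
qed

text \<open>A choice h of representatives is additive modulo T_n, and \<open>lifting\<close>
  corrects it to an additive map. The hypothesis n \<ge> 1 gives T_n \<subseteq> T_1, so that
  surjectivity modulo T_n implies surjectivity modulo T_1.\<close>

lemma compatible_of_Comp:
  assumes n: "n \<ge> 1" and b: "(\<beta>, \<epsilon>) \<in> carrier (Comp R (quot_term R T act n) (quot_act act))"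
  shows "\<exists>F. compatible n \<beta> F \<and> (\<forall>x\<in>V. \<epsilon> (red n x) = red n (F x))"
proof -
  let ?Q = "quot_term R T act n"
  interpret pA: presented_module R V A ?Q "quot_act act" V "Vs n" "red n"
    by (rule presented_A)
  have \<beta>: "\<beta> \<in> auto R" and \<epsilon>: "\<epsilon> \<in> auto ?Q"
    and eqv: "\<And>C g. C \<in> carrier ?Q \<Longrightarrow> g \<in> carrier R \<Longrightarrow>
      \<epsilon> (quot_act act C g) = quot_act act (\<epsilon> C) (\<beta> g)"
    using b by (auto simp: Comp_def)
  have \<epsilon>_hom: "\<epsilon> \<in> hom ?Q ?Q" and \<epsilon>_surj: "\<epsilon> ` carrier ?Q = carrier ?Q"
    using \<epsilon> by (auto simp: auto_def Bij_def bij_betw_def)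
  have "\<forall>x\<in>V. \<exists>y\<in>V. red n y = \<epsilon> (red n x)"
    using \<epsilon>_hom pA.\<rho>_closed pA.\<rho>_surj by (auto simp: hom_def)
  then obtain h where h: "\<And>x. x \<in> V \<Longrightarrow> h x \<in> V \<and> red n (h x) = \<epsilon> (red n x)" by metis
  have "h (x + y) - (h x + h y) \<in> Vs n" if xy: "x \<in> V" "y \<in> V" for x y
  proof -
    have "red n (h (x + y)) = \<epsilon> (red n x \<otimes>\<^bsub>?Q\<^esub> red n y)"
      using h[OF add_subgroup_add[OF V xy]] pA.\<rho>_add[OF xy] by simp
    also have "\<dots> = red n (h x) \<otimes>\<^bsub>?Q\<^esub> red n (h y)"
      using hom_mult[OF \<epsilon>_hom pA.\<rho>_closed pA.\<rho>_closed] xy h by simp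
    also have "\<dots> = red n (h x + h y)" using pA.\<rho>_add h xy by simp
    finally show ?thesis
      using pA.\<rho>_eq_iff[of "h (x + y)" "h x + h y"] h[OF xy(1)] h[OF xy(2)]
        h[OF add_subgroup_add[OF V xy]] add_subgroup_add[OF V] by simp
  qed
  then have "\<exists>F. additive_on V F \<and> (\<forall>x\<in>V. F x \<in> V \<and> F x - h x \<in> Vs n)"
    using lifting[OF Vs_subgroup Vs_subset p_power_mult_Vs, where h = h] h by simp
  then obtain F where F: "additive_on V F" "\<And>x. x \<in> V \<Longrightarrow> F x \<in> V \<and> F x - h x \<in> Vs n"
    by blast
  have eps: "\<epsilon> (red n x) = red n (F x)" if "x \<in> V" for x
    using F(2)[OF that] h[OF that] pA.\<rho>_eq_iff[of "F x" "h x"] by simp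
  have "F (A x g) - A (F x) (\<beta> g) \<in> Vs n" if x: "x \<in> V" and g: "g \<in> carrier R" for x g
  proof -
    have \<beta>g: "\<beta> g \<in> carrier R" by (rule autoD(3)[OF \<beta> g])
    have FxV: "F x \<in> V" using F(2)[OF x] by blast
    have "red n (F (A x g)) = \<epsilon> (quot_act act (red n x) g)"
      using eps[OF A_closed[OF x g]] pA.\<rho>_act[OF x g] by simp
    also have "\<dots> = red n (A (F x) (\<beta> g))"
      using eqv[OF pA.\<rho>_closed[OF x] g] eps[OF x] pA.\<rho>_act[OF FxV \<beta>g] by simp
    finally show ?thesis
      using pA.\<rho>_eq_iff F(2)[OF A_closed[OF x g]] A_closed[OF FxV \<beta>g] by blast
  qed
  moreover have "\<exists>y\<in>V. x - F y \<in> Vs 1" if x: "x \<in> V" for x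
  proof -
    have "red n x \<in> \<epsilon> ` carrier ?Q" by (simp only: \<epsilon>_surj pA.\<rho>_closed[OF x])
    then obtain C where C: "C \<in> carrier ?Q" "\<epsilon> C = red n x" by (metis imageE)
    then obtain y where y: "y \<in> V" "C = red n y" using pA.\<rho>_surj by blast
    then have "red n x = red n (F y)" using C eps by simp
    then have "x - F y \<in> Vs n" using pA.\<rho>_eq_iff[OF x, of "F y"] F(2)[OF y(1)] by blast
    then show ?thesis using y(1) Vs_antimono[OF n] by blast
  qed
  ultimately have "compatible n \<beta> F" unfolding compatible_def using \<beta> F by blast
  then show ?thesis using eps by blast
qed

text \<open>\<open>comp_action\<close> is the image of a whole class, so besides well-definedness it
  has to be shown that every representative of the target class is reached; this is where
  surjectivity of F modulo T_n enters.\<close>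

lemma comp_action_clA:
  assumes c: "compatible n \<beta> F" and eps: "\<And>x. x \<in> V \<Longrightarrow> \<epsilon> (red n x) = red n (F x)"
    and f: "val 2 V f" "val 3 (Vs n) (D 2 f)"
  shows "comp_action R (quot_term R T act n) (quot_act act) (\<beta>, \<epsilon>) (clA n f) = clA n (twist \<beta> F f)"
proof -
  note F = compatibleD[OF c] and \<beta> = autoD[OF compatibleD(1)[OF c]]
  interpret pA: presented_module R V A "quot_term R T act n" "quot_act act" V "Vs n" "red n"
    by (rule presented_A)
  note tV = twist_valued[OF c]
  have \<beta>t: "map (inv_into (carrier R) \<beta>) gs \<in> tuples R m" if "gs \<in> tuples R m" for gs m
    using tuples_map that \<beta>(4) by blast
  have \<beta>\<beta>: "map \<beta> (map (inv_into (carrier R) \<beta>) gs) = gs" if "gs \<in> tuples R m" for gs m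
    using that \<beta>(5) by (auto simp: tuples_def map_idI subset_iff)
  have comp: "comp_cochain R 2 (\<beta>, \<epsilon>) (pA.lift 2 G) = pA.lift 2 (twist \<beta> F G)" if "val 2 V G" for G
    unfolding comp_cochain_def lift_cochain_def twist_def prod.case
    by (rule restrict_ext) (simp add: \<beta>t eps valuedD[OF that \<beta>t])
  have mem: "h \<in> clA n G \<longleftrightarrow> (\<exists>H. val 2 V H \<and> h = pA.lift 2 H \<and> coh V (Vs n) 1 H G)"
    if "val 2 V G" for h G
    using pA.mem_cl_iff[where n = 1 and F = G and h = h] that unfolding Suc_1 .
  have twist_add: "twist \<beta> F (plus G H) gs = twist \<beta> F G gs + twist \<beta> F H gs"
    if "val 2 V G" "val 2 V H" "gs \<in> tuples R 2" for G H gs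
    unfolding twist_def
    using additive_on_add[OF F(2) valuedD[OF that(1) \<beta>t] valuedD[OF that(2) \<beta>t]] that(3) by blast
  have "comp_cochain R 2 (\<beta>, \<epsilon>) ` clA n f = clA n (twist \<beta> F f)"
  proof (intro equalityI subsetI)
    fix h assume "h \<in> comp_cochain R 2 (\<beta>, \<epsilon>) ` clA n f"
    then obtain G where G: "val 2 V G" "h = pA.lift 2 (twist \<beta> F G)" "coh V (Vs n) 1 G f"
      using mem[OF f(1)] comp by auto
    obtain a where a: "val 1 V a" "val 2 (Vs n) (\<lambda>gs. G gs - f gs - D 1 a gs)"
      using G(3) unfolding cohomologous_mod_def Suc_1 by blast
    have D1a: "val 2 V (D 1 a)" by (rule D1_valued[OF a(1) V invariant_V])
    have "twist \<beta> F G gs - twist \<beta> F f gs - D 1 (twist \<beta> F a) gs \<in> Vs n" if gs: "gs \<in> tuples R 2" for gs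
    proof -
      have "F (G (map (inv_into (carrier R) \<beta>) gs) - f (map (inv_into (carrier R) \<beta>) gs)
          - D 1 a (map (inv_into (carrier R) \<beta>) gs)) \<in> Vs n"
        by (rule compatible_Vs[OF c order_refl valuedD[OF a(2) \<beta>t[OF gs]]])
      then have "twist \<beta> F G gs - twist \<beta> F f gs - twist \<beta> F (D 1 a) gs \<in> Vs n"
        unfolding twist_def
        using additive_on_diff[OF V F(2)] add_subgroup_diff[OF V] valuedD[OF G(1) \<beta>t[OF gs]]
          valuedD[OF f(1) \<beta>t[OF gs]] valuedD[OF D1a \<beta>t[OF gs]] by simp
      moreover have "D 1 (twist \<beta> F a) gs - twist \<beta> F (D 1 a) gs \<in> Vs n"
        using twist_D[OF c a(1)] gs by (simp add: numeral_2_eq_2)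
      ultimately have "(twist \<beta> F G gs - twist \<beta> F f gs - twist \<beta> F (D 1 a) gs) -
          (D 1 (twist \<beta> F a) gs - twist \<beta> F (D 1 a) gs) \<in> Vs n"
        by (rule add_subgroup_diff[OF Vs_subgroup])
      also have "(twist \<beta> F G gs - twist \<beta> F f gs - twist \<beta> F (D 1 a) gs) -
          (D 1 (twist \<beta> F a) gs - twist \<beta> F (D 1 a) gs) =
          twist \<beta> F G gs - twist \<beta> F f gs - D 1 (twist \<beta> F a) gs" by simp
      finally show ?thesis .
    qed
    then have "coh V (Vs n) 1 (twist \<beta> F G) (twist \<beta> F f)"
      unfolding cohomologous_mod_def valued_def Suc_1 using valuedD[OF tV[OF a(1)]]
      by (intro exI[of _ "twist \<beta> F a"]) auto
    then show "h \<in> clA n (twist \<beta> F f)"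
      using mem[OF tV[OF f(1)]] G(2) tV[OF G(1)] by blast
  next
    fix h assume "h \<in> clA n (twist \<beta> F f)"
    then obtain H where H: "val 2 V H" "h = pA.lift 2 H" "coh V (Vs n) 1 H (twist \<beta> F f)"
      using mem[OF tV[OF f(1)]] by blast
    obtain a where a: "val 1 V a" "val 2 (Vs n) (\<lambda>gs. H gs - twist \<beta> F f gs - D 1 a gs)"
      using H(3) unfolding cohomologous_mod_def Suc_1 by blast
    have "\<forall>x\<in>V. \<exists>y\<in>V. x - F y \<in> Vs n" using compatible_surj[OF c] by blast
    then obtain s where s: "\<And>x. x \<in> V \<Longrightarrow> s x \<in> V \<and> x - F (s x) \<in> Vs n" by metis
    \<comment> \<open>b is chosen so that twisting it returns the bounding cochain a modulo T_n: s
      is a section of F modulo T_n, and \<beta> undoes the inverse in \<open>twist\<close>.\<close>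
    define b where "b gs = s (a (map \<beta> gs))" for gs
    have map\<beta>: "map \<beta> gs \<in> tuples R m" if "gs \<in> tuples R m" for gs m
      using tuples_map that \<beta>(3) by blast
    have bV: "val 1 V b" unfolding valued_def b_def using s valuedD[OF a(1)] map\<beta> by blast
    have ab: "val 1 (Vs n) (minus a (twist \<beta> F b))"
      unfolding valued_def
    proof
      fix gs assume gs: "gs \<in> tuples R 1"
      have "minus a (twist \<beta> F b) gs = a gs - F (s (a gs))"
        by (simp only: twist_def b_def \<beta>\<beta>[OF gs])
      then show "minus a (twist \<beta> F b) gs \<in> Vs n" using s valuedD[OF a(1) gs] by simp
    qed
    have D1b: "val 2 V (D 1 b)" by (rule D1_valued[OF bV V invariant_V])
    define G where "G = plus (D 1 b) f"
    have GV: "val 2 V G" unfolding G_def by (rule valued_plus[OF V D1b f(1)])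
    have "H gs - twist \<beta> F G gs \<in> Vs n" if gs: "gs \<in> tuples R 2" for gs
    proof -
      have "D 1 (minus a (twist \<beta> F b)) gs \<in> Vs n"
        by (rule valuedD[OF D1_valued[OF ab Vs_subgroup Vs_invariant] gs])
      then have 1: "D 1 a gs - D 1 (twist \<beta> F b) gs \<in> Vs n"
        using D_diff[OF a(1) tV[OF bV], of gs] gs by (simp add: numeral_2_eq_2)
      have 2: "D 1 (twist \<beta> F b) gs - twist \<beta> F (D 1 b) gs \<in> Vs n"
        using twist_D[OF c bV] gs by (simp add: numeral_2_eq_2)
      have "H gs - twist \<beta> F G gs = (H gs - twist \<beta> F f gs - D 1 a gs) +
          ((D 1 a gs - D 1 (twist \<beta> F b) gs) + (D 1 (twist \<beta> F b) gs - twist \<beta> F (D 1 b) gs))"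
        unfolding G_def twist_add[OF D1b f(1) gs] by simp
      then show ?thesis
        by (simp only: add_subgroup_add[OF Vs_subgroup valuedD[OF a(2) gs] add_subgroup_add[OF Vs_subgroup 1 2]])
    qed
    then have "h = pA.lift 2 (twist \<beta> F G)"
      using pA.lift_eq_iff[OF H(1) tV[OF GV]] H(2) by (simp add: valued_def)
    moreover have "coh V (Vs n) 1 G f"
      unfolding cohomologous_mod_def valued_def G_def using valuedD[OF bV]
      by (intro exI[of _ b]) (auto simp: add_subgroup_zero[OF Vs_subgroup])
    then have "pA.lift 2 G \<in> clA n f" using mem[OF f(1)] GV by blast
    ultimately show "h \<in> comp_cochain R 2 (\<beta>, \<epsilon>) ` clA n f" using comp[OF GV] by (metis imageI)
  qed
  moreover have "clA n f \<in> carrier (H2_quot R T act n)" unfolding carrier_H2_A using f by blast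
  ultimately show ?thesis by (simp add: comp_action_def)
qed

text \<open>Every compatible pair has a lift and every lift comes from a pair, so orbits can be
  described by lifts alone.\<close>

lemma orbit_clA:
  assumes n: "n \<ge> 1" and f: "val 2 V f" "val 3 (Vs n) (D 2 f)"
  shows "orbit (Comp R (quot_term R T act n) (quot_act act))
      (comp_action R (quot_term R T act n) (quot_act act)) (clA n f) =
    {clA n (twist \<beta> F f) | \<beta> F. compatible n \<beta> F}"
proof (intro equalityI subsetI)
  fix x assume "x \<in> orbit (Comp R (quot_term R T act n) (quot_act act))
      (comp_action R (quot_term R T act n) (quot_act act)) (clA n f)"
  then obtain \<beta> \<epsilon> where b: "(\<beta>, \<epsilon>) \<in> carrier (Comp R (quot_term R T act n) (quot_act act))"
    "x = comp_action R (quot_term R T act n) (quot_act act) (\<beta>, \<epsilon>) (clA n f)"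
    unfolding orbit_def by auto
  obtain F where F: "compatible n \<beta> F" "\<And>x. x \<in> V \<Longrightarrow> \<epsilon> (red n x) = red n (F x)"
    using compatible_of_Comp[OF n b(1)] by blast
  then show "x \<in> {clA n (twist \<beta> F f) | \<beta> F. compatible n \<beta> F}"
    using comp_action_clA[OF F f] b(2) by blast
next
  fix x assume "x \<in> {clA n (twist \<beta> F f) | \<beta> F. compatible n \<beta> F}"
  then obtain \<beta> F where F: "compatible n \<beta> F" "x = clA n (twist \<beta> F f)" by blast
  obtain \<epsilon> where b: "(\<beta>, \<epsilon>) \<in> carrier (Comp R (quot_term R T act n) (quot_act act))"
    "\<And>x. x \<in> V \<Longrightarrow> \<epsilon> (red n x) = red n (F x)"
    using Comp_of_compatible[OF F(1)] by blast
  then have "x = comp_action R (quot_term R T act n) (quot_act act) (\<beta>, \<epsilon>) (clA n f)"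
    using comp_action_clA[OF F(1) b(2) f] F(2) by simp
  then show "x \<in> orbit (Comp R (quot_term R T act n) (quot_act act))
      (comp_action R (quot_term R T act n) (quot_act act)) (clA n f)"
    unfolding orbit_def using b(1) by blast
qed

text \<open>The counterpart of \<open>decomposition\<close> for pairs: \<epsilon> is exactly
  compatible as \<gamma> is exactly a cocycle, and \<kappa> has values in \<open>E n\<close> and is
  compatible modulo T_n, like \<delta>.\<close>

definition split_pair :: "nat \<Rightarrow> ('g \<Rightarrow> 'g) \<Rightarrow> ('v \<Rightarrow> 'v) \<Rightarrow> ('v \<Rightarrow> 'v) \<Rightarrow> bool" where
  "split_pair n \<beta> \<epsilon> \<kappa> \<longleftrightarrow>
     \<beta> \<in> auto R \<and> additive_on V \<epsilon> \<and> additive_on V \<kappa> \<and> (\<forall>x\<in>V. \<epsilon> x \<in> V \<and> \<kappa> x \<in> E n) \<and>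
     (\<forall>x\<in>V. \<forall>g\<in>carrier R. \<epsilon> (A x g) = A (\<epsilon> x) (\<beta> g)) \<and>
     (\<forall>x\<in>V. \<forall>g\<in>carrier R. \<kappa> (A x g) - A (\<kappa> x) (\<beta> g) \<in> Vs n) \<and>
     (\<forall>x\<in>V. \<exists>y\<in>V. x - (\<epsilon> y + \<kappa> y) \<in> Vs 1)"

lemma split_pairD:
  assumes "split_pair n \<beta> \<epsilon> \<kappa>"
  shows "\<beta> \<in> auto R" "additive_on V \<epsilon>" "additive_on V \<kappa>"
    "\<And>x. x \<in> V \<Longrightarrow> \<epsilon> x \<in> V" "\<And>x. x \<in> V \<Longrightarrow> \<kappa> x \<in> E n" "\<And>x. x \<in> V \<Longrightarrow> \<kappa> x \<in> V"
    "\<And>x g. x \<in> V \<Longrightarrow> g \<in> carrier R \<Longrightarrow> \<epsilon> (A x g) = A (\<epsilon> x) (\<beta> g)"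
    "\<And>x g. x \<in> V \<Longrightarrow> g \<in> carrier R \<Longrightarrow> \<kappa> (A x g) - A (\<kappa> x) (\<beta> g) \<in> Vs n"
    "\<And>x. x \<in> V \<Longrightarrow> \<exists>y\<in>V. x - (\<epsilon> y + \<kappa> y) \<in> Vs 1"
  using assms E_subset by (auto simp: split_pair_def)

lemma split_pair_compatible:
  assumes s: "split_pair n \<beta> \<epsilon> \<kappa>"
  shows "compatible n \<beta> (\<lambda>x. \<epsilon> x + \<kappa> x)"
proof -
  note S = split_pairD[OF s]
  have "(\<epsilon> (A x g) + \<kappa> (A x g)) - A (\<epsilon> x + \<kappa> x) (\<beta> g) \<in> Vs n" if x: "x \<in> V" and g: "g \<in> carrier R" for x g
  proof -
    have "(\<epsilon> (A x g) + \<kappa> (A x g)) - A (\<epsilon> x + \<kappa> x) (\<beta> g) = \<kappa> (A x g) - A (\<kappa> x) (\<beta> g)"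
      using A_add[OF autoD(3)[OF S(1) g] S(4)[OF x] S(6)[OF x]] S(7)[OF x g] by simp
    then show ?thesis by (simp only: S(8)[OF x g])
  qed
  moreover have "additive_on V (\<lambda>x. \<epsilon> x + \<kappa> x)"
    using S(2,3) by (simp add: additive_on_def)
  ultimately show ?thesis
    unfolding compatible_def using S(1,4,6,9) add_subgroup_add[OF V] by simp
qed

text \<open>Averaging a lift \<open>F\<close> over \<open>R\<close> gives an exactly equivariant map up to an error of \<open>q\<^sup>-\<^sup>1T\<^sub>n\<close>.\<close>

lemma compatible_split:
  assumes deep: "deep n" and c: "compatible n \<beta> F"
  shows "\<exists>\<epsilon> \<kappa>. split_pair n \<beta> \<epsilon> \<kappa> \<and> F = (\<lambda>x. \<epsilon> x + \<kappa> x)"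
proof -
  note F = compatibleD[OF c] and \<beta> = autoD[OF compatibleD(1)[OF c]]
  \<comment> \<open>q times the average of the conjugates of F. It is exactly equivariant along
    \<beta>, and each summand differs from F x by an element of T_n.\<close>
  define M where "M x = (\<Sum>g\<in>carrier R. A (F (A x (inv g))) (\<beta> g))" for x
  have term_V: "A (F (A x (inv g))) (\<beta> g) \<in> V" if "x \<in> V" "g \<in> carrier R" for x g
    using that F(3) \<beta>(3) by (simp add: A_closed)
  have MV: "M x \<in> V" if "x \<in> V" for x
    unfolding M_def using term_V[OF that] by (rule add_subgroup_sum[OF V])
  have M_add: "M (x + y) = M x + M y" if "x \<in> V" "y \<in> V" for x y
    unfolding M_def sum.distrib[symmetric]
    by (rule sum.cong[OF refl])
      (use that F(3) \<beta>(3) in \<open>simp add: A_add A_closed additive_on_add[OF F(2)]\<close>)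
  have M_act: "M (A x h) = A (M x) (\<beta> h)" if x: "x \<in> V" and h: "h \<in> carrier R" for x h
  proof -
    have "A (M x) (\<beta> h) = (\<Sum>g\<in>carrier R. A (A (F (A x (inv g))) (\<beta> g)) (\<beta> h))"
      unfolding M_def using \<beta>(3)[OF h] term_V[OF x] by (simp add: A_sum)
    \<comment> \<open>The action of \<beta> h is absorbed into the summand, which becomes the one
      with index gh; the translation of the index is then removed.\<close>
    also have "\<dots> = (\<Sum>g\<in>carrier R. A (F (A (A x h) (inv (g \<otimes> h)))) (\<beta> (g \<otimes> h)))"
    proof (rule sum.cong[OF refl])
      fix g assume g: "g \<in> carrier R"
      have "h \<otimes> inv (g \<otimes> h) = inv g"
        using g h by (simp add: inv_mult_group m_assoc[symmetric])
      then have "A (A x h) (inv (g \<otimes> h)) = A x (inv g)"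
        using x g h by (simp add: A_mult[symmetric])
      moreover have "\<beta> (g \<otimes> h) = \<beta> g \<otimes> \<beta> h" using \<beta>(1) g h by (simp add: hom_mult)
      ultimately show "A (A (F (A x (inv g))) (\<beta> g)) (\<beta> h) =
          A (F (A (A x h) (inv (g \<otimes> h)))) (\<beta> (g \<otimes> h))"
        using A_mult[OF F(3)[OF A_closed[OF x]] \<beta>(3)[OF g] \<beta>(3)[OF h]] g by simp
    qed
    also have "\<dots> = M (A x h)"
      unfolding M_def by (rule sum_left_translate[OF finite_R h, where f = "\<lambda>g. A (F (A (A x h) (inv g))) (\<beta> g)"])
    finally show ?thesis by simp
  qed
  have M_diff: "of_nat q * F x - M x \<in> Vs n" if x: "x \<in> V" for x
  proof -
    have "of_nat q * F x - M x = (\<Sum>g\<in>carrier R. F x - A (F (A x (inv g))) (\<beta> g))"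
      unfolding M_def sum_subtractf using order_R by (simp add: order_def)
    also have "\<dots> \<in> Vs n"
    proof (rule add_subgroup_sum[OF Vs_subgroup])
      fix g assume g: "g \<in> carrier R"
      have "A (A x (inv g)) g = x" using x g by (simp add: A_mult[symmetric] A_one)
      then show "F x - A (F (A x (inv g))) (\<beta> g) \<in> Vs n"
        using F(4)[OF A_closed[OF x inv_closed[OF g]] g] by simp
    qed
    finally show ?thesis .
  qed
  have "\<forall>x\<in>V. \<exists>y\<in>E n. of_nat q * F x - M x = of_nat q * y"
    using deep_Vs[OF deep M_diff] by blast
  then obtain k where k: "\<And>x. x \<in> V \<Longrightarrow> k x \<in> E n \<and> of_nat q * F x - M x = of_nat q * k x"
    by metis
  \<comment> \<open>Outside \<open>V\<close> the values are irrelevant; this choice makes \<open>F\<close> equal to the sum everywhere.\<close>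
  define \<epsilon> where "\<epsilon> x = F x - k x" for x
  have kV: "k x \<in> V" if "x \<in> V" for x using k[OF that] E_subset by blast
  have \<epsilon>V: "\<epsilon> x \<in> V" if "x \<in> V" for x
    unfolding \<epsilon>_def by (rule add_subgroup_diff[OF V F(3)[OF that] kV[OF that]])
  have \<epsilon>M: "of_nat q * \<epsilon> x = M x" if "x \<in> V" for x
  proof -
    have "of_nat q * \<epsilon> x = of_nat q * F x - of_nat q * k x" by (simp only: \<epsilon>_def right_diff_distrib)
    also have "\<dots> = of_nat q * F x - (of_nat q * F x - M x)" using k[OF that] by simp
    finally show ?thesis by simp
  qed
  have cancel: "x = y" if "x \<in> V" "y \<in> V" "of_nat q * x = of_nat q * y" for x y
    using cancel_power that by blast
  have \<epsilon>_add: "additive_on V \<epsilon>"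
    unfolding additive_on_def
  proof (intro ballI)
    fix x y assume xy: "x \<in> V" "y \<in> V"
    have "of_nat q * \<epsilon> (x + y) = of_nat q * (\<epsilon> x + \<epsilon> y)"
      unfolding distrib_left \<epsilon>M[OF add_subgroup_add[OF V xy]] \<epsilon>M[OF xy(1)] \<epsilon>M[OF xy(2)]
      by (rule M_add[OF xy])
    then show "\<epsilon> (x + y) = \<epsilon> x + \<epsilon> y"
      by (rule cancel[OF \<epsilon>V[OF add_subgroup_add[OF V xy]] add_subgroup_add[OF V \<epsilon>V[OF xy(1)] \<epsilon>V[OF xy(2)]]])
  qed
  have k_add: "additive_on V k"
    unfolding additive_on_def
  proof (intro ballI)
    fix x y assume xy: "x \<in> V" "y \<in> V"
    have "F (x + y) = F x + F y" "\<epsilon> (x + y) = \<epsilon> x + \<epsilon> y"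
      using additive_on_add[OF F(2) xy] additive_on_add[OF \<epsilon>_add xy] by auto
    then show "k (x + y) = k x + k y" by (simp add: \<epsilon>_def algebra_simps)
  qed
  have \<epsilon>_act: "\<epsilon> (A x g) = A (\<epsilon> x) (\<beta> g)" if x: "x \<in> V" and g: "g \<in> carrier R" for x g
  proof -
    have "of_nat q * \<epsilon> (A x g) = of_nat q * A (\<epsilon> x) (\<beta> g)"
      using \<epsilon>M[OF A_closed[OF x g]] M_act[OF x g] \<epsilon>M[OF x] A_of_nat_mult[OF \<beta>(3)[OF g] \<epsilon>V[OF x], of q]
      by simp
    then show ?thesis
      by (rule cancel[OF \<epsilon>V[OF A_closed[OF x g]] A_closed[OF \<epsilon>V[OF x] \<beta>(3)[OF g]]])
  qed
  have k_act: "k (A x g) - A (k x) (\<beta> g) \<in> Vs n" if x: "x \<in> V" and g: "g \<in> carrier R" for x g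
  proof -
    have "k (A x g) - A (k x) (\<beta> g) = F (A x g) - A (F x) (\<beta> g)"
      using \<epsilon>_act[OF x g] A_diff[OF \<beta>(3)[OF g] F(3)[OF x] kV[OF x]] by (simp add: \<epsilon>_def algebra_simps)
    then show ?thesis by (simp only: F(4)[OF x g])
  qed
  have F_eq: "F = (\<lambda>x. \<epsilon> x + k x)" by (simp add: \<epsilon>_def)
  have "split_pair n \<beta> \<epsilon> k"
    unfolding split_pair_def
    using F(1,5) \<epsilon>_add k_add \<epsilon>V k \<epsilon>_act k_act by (simp add: \<epsilon>_def)
  then show ?thesis using F_eq by blast
qed

text \<open>x = qy with y in V, so \<kappa> x = q \<kappa> y, and q \<open>E n\<close> lies in T_n.
  This makes the mixed term \<kappa>\<delta> negligible.\<close>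

lemma split_pair_kill_E:
  assumes deep: "deep n" and s: "split_pair n \<beta> \<epsilon> \<kappa>" and x: "x \<in> E n"
  shows "\<kappa> x \<in> Vs n"
proof -
  note S = split_pairD[OF s]
  obtain y where y: "y \<in> V" "x = of_nat q * y" using deep_E'[OF deep x] by blast
  then have "\<kappa> x = of_nat q * \<kappa> y" using additive_on_of_nat_mult[OF V S(3) y(1), of q] by simp
  then show ?thesis using S(5)[OF y(1)] by (simp add: E_def)
qed

text \<open>Since \<epsilon> is exactly equivariant along \<beta>, the induction of
  \<open>compatible_Vs\<close> works without an error term and for every i.\<close>

lemma split_pair_\<epsilon>_Vs:
  assumes s: "split_pair n \<beta> \<epsilon> \<kappa>" and "x \<in> Vs i"
  shows "\<epsilon> x \<in> Vs i"
  using assms(2)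
proof (induction i arbitrary: x)
  case 0
  then show ?case using split_pairD(4)[OF s] by (simp add: Vs_0)
next
  case (Suc i)
  note S = split_pairD[OF s]
  define U where "U = {x \<in> V. \<epsilon> x \<in> Vs (Suc i)}"
  have "add_subgroup U"
    using V Vs_subgroup[of "Suc i"] additive_on_zero[OF V S(2)] additive_on_diff[OF V S(2)]
    by (auto simp: U_def add_subgroup_def)
  moreover have "A y g - y \<in> U" if y: "y \<in> Vs i" and g: "g \<in> carrier R" for y g
  proof -
    have yV: "y \<in> V" using y Vs_subset by blast
    have "\<epsilon> (A y g - y) = A (\<epsilon> y) (\<beta> g) - \<epsilon> y"
      using additive_on_diff[OF V S(2) A_closed[OF yV g] yV] S(7)[OF yV g] by simp
    then have "\<epsilon> (A y g - y) \<in> Vs (Suc i)"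
      using Vs_commutator[OF Suc.IH[OF y] autoD(3)[OF S(1) g]] by simp
    then show ?thesis using A_closed[OF yV g] yV by (simp add: U_def add_subgroup_diff[OF V])
  qed
  ultimately have "Vs (Suc i) \<subseteq> U" by (rule Vs_least)
  then show ?case using Suc.prems by (auto simp: U_def)
qed

lemma split_pair_\<epsilon>_E:
  assumes s: "split_pair n \<beta> \<epsilon> \<kappa>" and x: "x \<in> E n"
  shows "\<epsilon> x \<in> E n"
proof -
  note S = split_pairD[OF s]
  have xV: "x \<in> V" and qx: "of_nat q * x \<in> Vs n" using x by (auto simp: E_def)
  have "of_nat q * \<epsilon> x = \<epsilon> (of_nat q * x)"
    using additive_on_of_nat_mult[OF V S(2) xV, of q] by simp
  also have "\<dots> \<in> Vs n" by (rule split_pair_\<epsilon>_Vs[OF s qx])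
  finally show ?thesis using S(4)[OF xV] by (simp add: E_def)
qed

text \<open>The values of \<kappa> and p\<kappa> lie in T_1 by \<open>deep_E_Vs_1\<close>, so
  surjectivity modulo T_1 is unchanged; the error of equivariance moves from T_n to pT_n =
  T_(n+d).\<close>

lemma split_pair_scale:
  assumes deep: "deep n" and s: "split_pair n \<beta> \<epsilon> \<kappa>"
  shows "split_pair (n + d) \<beta> \<epsilon> (\<lambda>x. of_nat p * \<kappa> x)"
proof -
  note S = split_pairD[OF s]
  have "additive_on V (\<lambda>x. of_nat p * \<kappa> x)"
    using S(3) by (simp add: additive_on_def distrib_left)
  moreover have "of_nat p * \<kappa> (A x g) - A (of_nat p * \<kappa> x) (\<beta> g) \<in> Vs (n + d)"
    if x: "x \<in> V" and g: "g \<in> carrier R" for x g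
  proof -
    have "of_nat p * \<kappa> (A x g) - A (of_nat p * \<kappa> x) (\<beta> g) =
        of_nat p * (\<kappa> (A x g) - A (\<kappa> x) (\<beta> g))"
      using A_of_nat_mult[OF autoD(3)[OF S(1) g] S(6)[OF x], of p] by (simp add: right_diff_distrib)
    then show ?thesis by (simp only: multiplesI[OF S(8)[OF x g]] multiples_p_Vs[symmetric])
  qed
  moreover have "\<exists>y\<in>V. x - (\<epsilon> y + of_nat p * \<kappa> y) \<in> Vs 1" if xV: "x \<in> V" for x
  proof -
    obtain y where y: "y \<in> V" "x - (\<epsilon> y + \<kappa> y) \<in> Vs 1" using S(9)[OF xV] by blast
    have k: "\<kappa> y \<in> Vs 1" using S(5)[OF y(1)] deep_E_Vs_1[OF deep] by blast
    have "(x - (\<epsilon> y + \<kappa> y)) + (\<kappa> y - of_nat p * \<kappa> y) \<in> Vs 1"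
      by (intro add_subgroup_intros Vs_subgroup y k)
    also have "(x - (\<epsilon> y + \<kappa> y)) + (\<kappa> y - of_nat p * \<kappa> y) = x - (\<epsilon> y + of_nat p * \<kappa> y)" by simp
    finally show ?thesis using y(1) by blast
  qed
  ultimately show ?thesis
    unfolding split_pair_def using S(1,2,4,5,7) E_p_mult by simp
qed

text \<open>\<open>E_p_divide\<close> gives the values of \<kappa>, and cancelling p transfers
  additivity and the congruence from \<kappa>' to \<kappa>. Surjectivity modulo T_1 is again
  insensitive to the change.\<close>

lemma split_pair_unscale:
  assumes deep: "deep n" and s: "split_pair (n + d) \<beta> \<epsilon> \<kappa>'"
  shows "\<exists>\<kappa>. split_pair n \<beta> \<epsilon> \<kappa> \<and> (\<forall>x\<in>V. \<kappa>' x = of_nat p * \<kappa> x)"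
proof -
  note S = split_pairD[OF s]
  have "\<forall>x\<in>V. \<exists>y\<in>E n. \<kappa>' x = of_nat p * y" using S(5) E_p_divide[OF deep] by blast
  then obtain k where k: "\<And>x. x \<in> V \<Longrightarrow> k x \<in> E n \<and> \<kappa>' x = of_nat p * k x" by metis
  have kV: "k x \<in> V" if "x \<in> V" for x using k[OF that] E_subset by blast
  have "additive_on V k"
    unfolding additive_on_def
  proof (intro ballI)
    fix x y assume xy: "x \<in> V" "y \<in> V"
    have xyV: "x + y \<in> V" by (rule add_subgroup_add[OF V xy])
    have "of_nat p * k (x + y) = \<kappa>' (x + y)" using k[OF xyV] by simp
    also have "\<dots> = \<kappa>' x + \<kappa>' y" by (rule additive_on_add[OF S(3) xy])
    also have "\<dots> = of_nat p * (k x + k y)" using k[OF xy(1)] k[OF xy(2)] by (simp add: distrib_left)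
    finally show "k (x + y) = k x + k y"
      by (rule cancel_p[OF kV[OF xyV] add_subgroup_add[OF V kV[OF xy(1)] kV[OF xy(2)]]])
  qed
  moreover have "k (A x g) - A (k x) (\<beta> g) \<in> Vs n" if x: "x \<in> V" and g: "g \<in> carrier R" for x g
  proof -
    have \<beta>g: "\<beta> g \<in> carrier R" by (rule autoD(3)[OF S(1) g])
    have "\<kappa>' (A x g) - A (\<kappa>' x) (\<beta> g) = of_nat p * (k (A x g) - A (k x) (\<beta> g))"
      using k[OF x] k[OF A_closed[OF x g]] A_of_nat_mult[OF \<beta>g kV[OF x], of p]
      by (simp add: right_diff_distrib)
    then have "of_nat p * (k (A x g) - A (k x) (\<beta> g)) \<in> multiples p (Vs n)"
      using S(8)[OF x g] by (simp add: multiples_p_Vs)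
    then obtain s where s: "s \<in> Vs n" "of_nat p * (k (A x g) - A (k x) (\<beta> g)) = of_nat p * s"
      by (rule multiplesE)
    have "k (A x g) - A (k x) (\<beta> g) \<in> V"
      by (rule add_subgroup_diff[OF V kV[OF A_closed[OF x g]] A_closed[OF kV[OF x] \<beta>g]])
    then have "k (A x g) - A (k x) (\<beta> g) = s" using cancel_p s Vs_subset by blast
    then show ?thesis by (simp only: s(1))
  qed
  moreover have "\<exists>y\<in>V. x - (\<epsilon> y + k y) \<in> Vs 1" if xV: "x \<in> V" for x
  proof -
    obtain y where y: "y \<in> V" "x - (\<epsilon> y + \<kappa>' y) \<in> Vs 1" using S(9)[OF xV] by blast
    have ky: "k y \<in> Vs 1" using k[OF y(1)] deep_E_Vs_1[OF deep] by blast
    have "(x - (\<epsilon> y + \<kappa>' y)) + (of_nat p * k y - k y) \<in> Vs 1"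
      by (intro add_subgroup_intros Vs_subgroup y ky)
    also have "(x - (\<epsilon> y + \<kappa>' y)) + (of_nat p * k y - k y) = x - (\<epsilon> y + k y)"
      using k[OF y(1)] by simp
    finally show ?thesis using y(1) by blast
  qed
  ultimately have "split_pair n \<beta> \<epsilon> k"
    unfolding split_pair_def using S(1,2,4,7) k by blast
  then show ?thesis using k by blast
qed

text \<open>(\<epsilon> + \<kappa>)(\<gamma> + \<delta>) has the decomposition \<epsilon>\<gamma> +
  (\<epsilon>\<delta> + \<kappa>\<gamma> + \<kappa>\<delta>), so its image is \<epsilon>\<gamma> +
  p(\<epsilon>\<delta> + \<kappa>\<gamma> + \<kappa>\<delta>). This exceeds (\<epsilon> +
  p\<kappa>)(\<gamma> + p\<delta>) by p(\<kappa>\<delta> - p\<kappa>\<delta>), which lies in pT_n =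
  T_(n+d) because \<kappa>\<delta> has values in T_n. (The inverse of \<beta> on the arguments is
  suppressed here.)\<close>

lemma id_plus_mu_twist:
  assumes deep: "deep n" and s: "split_pair n \<beta> \<epsilon> \<kappa>" and d: "decomposition n \<gamma> \<delta>"
  shows "id_plus_mu p d R T act n (clA n (twist \<beta> (\<lambda>x. \<epsilon> x + \<kappa> x) (plus \<gamma> \<delta>))) =
    clA (n + d) (twist \<beta> (\<lambda>x. \<epsilon> x + of_nat p * \<kappa> x) (plus \<gamma> (times p \<delta>)))"
proof -
  note S = split_pairD[OF s] and V1 = decompositionD[OF d] and \<beta> = autoD[OF split_pairD(1)[OF s]]
  note c = split_pair_compatible[OF s] and c' = split_pair_compatible[OF split_pair_scale[OF deep s]]
  interpret pA': presented_module R V A "quot_term R T act (n + d)" "quot_act act" V "Vs (n + d)"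
    "red (n + d)"
    by (rule presented_A)
  let ?F = "\<lambda>x. \<epsilon> x + \<kappa> x" and ?F' = "\<lambda>x. \<epsilon> x + of_nat p * \<kappa> x"
  have \<beta>t: "map (inv_into (carrier R) \<beta>) gs \<in> tuples R m" if "gs \<in> tuples R m" for gs m
    using tuples_map that \<beta>(4) by blast
  define \<gamma>1 where "\<gamma>1 = twist \<beta> \<epsilon> \<gamma>"
  define \<delta>1 where "\<delta>1 gs = twist \<beta> \<epsilon> \<delta> gs + twist \<beta> \<kappa> \<gamma> gs + twist \<beta> \<kappa> \<delta> gs" for gs
  have twist_plus: "twist \<beta> ?F (plus \<gamma> \<delta>) gs = \<gamma>1 gs + \<delta>1 gs" if gs: "gs \<in> tuples R 2" for gs
    using additive_on_add[OF S(2) valuedD[OF V1(1) \<beta>t[OF gs]] valuedD[OF V1(5) \<beta>t[OF gs]]]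
      additive_on_add[OF S(3) valuedD[OF V1(1) \<beta>t[OF gs]] valuedD[OF V1(5) \<beta>t[OF gs]]]
    by (simp add: twist_def \<gamma>1_def \<delta>1_def)
  have \<gamma>1V: "val 2 V \<gamma>1"
    unfolding valued_def \<gamma>1_def twist_def using S(4) valuedD[OF V1(1)] \<beta>t by blast
  have "D 2 \<gamma>1 gs = 0" if gs: "gs \<in> tuples R 3" for gs
  proof -
    have "\<epsilon> (A x (inv_into (carrier R) \<beta> g)) - A (\<epsilon> x) g \<in> {0}" if "x \<in> V" "g \<in> carrier R" for x g
      using S(7)[OF that(1) \<beta>(4)[OF that(2)]] \<beta>(5)[OF that(2)] by simp
    then have "D 2 \<gamma>1 gs - \<epsilon> (D 2 \<gamma> (map (inv_into (carrier R) \<beta>) gs)) \<in> {0}"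
      unfolding \<gamma>1_def twist_def
      using D_map[OF \<beta>(2) S(2) add_subgroup_trivial _ V1(1), of gs] gs by simp
    then show ?thesis
      using valuedD[OF V1(2) \<beta>t[OF gs]] additive_on_zero[OF V S(2)] by simp
  qed
  then have \<gamma>1c: "val 3 {0} (D 2 \<gamma>1)" by (simp add: valued_def)
  have \<delta>1E: "val 2 (E n) \<delta>1"
    unfolding valued_def \<delta>1_def twist_def
  proof (intro ballI add_subgroup_add[OF E_subgroup])
    fix gs assume gs: "gs \<in> tuples R 2"
    show "\<epsilon> (\<delta> (map (inv_into (carrier R) \<beta>) gs)) \<in> E n"
      by (rule split_pair_\<epsilon>_E[OF s valuedD[OF V1(3) \<beta>t[OF gs]]])
    show "\<kappa> (\<gamma> (map (inv_into (carrier R) \<beta>) gs)) \<in> E n"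
      by (rule S(5)[OF valuedD[OF V1(1) \<beta>t[OF gs]]])
    show "\<kappa> (\<delta> (map (inv_into (carrier R) \<beta>) gs)) \<in> E n"
      by (rule S(5)[OF valuedD[OF V1(5) \<beta>t[OF gs]]])
  qed
  \<comment> \<open>Not computed term by term: the twisted sum is a cocycle modulo T_n and \<gamma>1
    is an exact cocycle, so the rest is a cocycle modulo T_n.\<close>
  have "D 2 \<delta>1 gs \<in> Vs n" if gs: "gs \<in> tuples R 3" for gs
  proof -
    have "D 2 (twist \<beta> ?F (plus \<gamma> \<delta>)) gs = D 2 (plus \<gamma>1 \<delta>1) gs"
      by (rule D2_cong[OF twist_plus gs])
    also have "\<dots> = D 2 \<gamma>1 gs + D 2 \<delta>1 gs" by (rule D2_add[OF \<gamma>1V val_E_V[OF \<delta>1E] gs])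
    also have "\<dots> = D 2 \<delta>1 gs" using valuedD[OF \<gamma>1c gs] by simp
    finally show ?thesis using valuedD[OF twist_cocycle[OF c V1(6,7)] gs] by simp
  qed
  then have d1: "decomposition n \<gamma>1 \<delta>1"
    unfolding decomposition_def using \<gamma>1V \<gamma>1c \<delta>1E by (simp add: valued_def)
  note V2 = decompositionD[OF decomposition_times_p[OF d1]]
    and V3 = decompositionD[OF decomposition_times_p[OF d]]
  have "lift_cochain R (red n) 2 (twist \<beta> ?F (plus \<gamma> \<delta>)) = lift_cochain R (red n) 2 (plus \<gamma>1 \<delta>1)"
    unfolding lift_cochain_def by (rule restrict_ext) (simp only: twist_plus)
  then have "id_plus_mu p d R T act n (clA n (twist \<beta> ?F (plus \<gamma> \<delta>))) =
      clA (n + d) (plus \<gamma>1 (times p \<delta>1))"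
    using id_plus_mu_clA[OF deep d1] by (simp add: lift_class_def)
  also have "\<dots> = clA (n + d) (twist \<beta> ?F' (plus \<gamma> (times p \<delta>)))"
  proof -
    have "plus \<gamma>1 (times p \<delta>1) gs - twist \<beta> ?F' (plus \<gamma> (times p \<delta>)) gs \<in> Vs (n + d)"
      if gs: "gs \<in> tuples R 2" for gs
    proof -
      define x y where "x = \<gamma> (map (inv_into (carrier R) \<beta>) gs)"
        and "y = \<delta> (map (inv_into (carrier R) \<beta>) gs)"
      have x: "x \<in> V" and y: "y \<in> V" "y \<in> E n"
        unfolding x_def y_def using valuedD[OF V1(1) \<beta>t[OF gs]] valuedD[OF V1(3) \<beta>t[OF gs]] E_subset by auto
      have py: "of_nat p * y \<in> V" by (rule add_subgroup_of_nat_mult[OF V y(1)])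
      have ky: "\<kappa> y \<in> Vs n" by (rule split_pair_kill_E[OF deep s y(2)])
      have "plus \<gamma>1 (times p \<delta>1) gs - twist \<beta> ?F' (plus \<gamma> (times p \<delta>)) gs =
          \<epsilon> x + of_nat p * (\<epsilon> y + \<kappa> x + \<kappa> y) - (\<epsilon> (x + of_nat p * y) + of_nat p * \<kappa> (x + of_nat p * y))"
        by (simp add: \<gamma>1_def \<delta>1_def twist_def x_def y_def)
      also have "\<dots> = of_nat p * (\<kappa> y - of_nat p * \<kappa> y)"
        unfolding additive_on_add[OF S(2) x py] additive_on_add[OF S(3) x py]
          additive_on_of_nat_mult[OF V S(2) y(1)] additive_on_of_nat_mult[OF V S(3) y(1)]
        by (simp add: algebra_simps)
      also have "\<dots> \<in> Vs (n + d)"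
        unfolding multiples_p_Vs[symmetric]
        by (intro multiplesI add_subgroup_diff[OF Vs_subgroup] add_subgroup_of_nat_mult[OF Vs_subgroup] ky)
      finally show ?thesis .
    qed
    then have "coh V (Vs (n + d)) 1 (plus \<gamma>1 (times p \<delta>1)) (twist \<beta> ?F' (plus \<gamma> (times p \<delta>)))"
      by (intro pA'.cohomologous_if_diff) (simp add: valued_def numeral_2_eq_2)
    then show ?thesis
      using clA_eq_iff[OF V2(6) twist_valued[OF c' V3(6)]] by blast
  qed
  finally show ?thesis .
qed

section \<open>Images of orbits\<close>

lemma twist_cong:
  assumes "\<beta> \<in> auto R" "val m V f" "\<And>x. x \<in> V \<Longrightarrow> F x = G x" "gs \<in> tuples R m"
  shows "twist \<beta> F f gs = twist \<beta> G f gs"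
  using assms(3) valuedD[OF assms(2)] tuples_map[OF _ assms(4)] autoD(4)[OF assms(1)]
  by (simp add: twist_def Pi_I)

text \<open>A lift for n is split and its \<kappa> is multiplied by p, which gives one inclusion.
  Conversely a lift for n + d is split there, and its \<kappa>' is divided by p; \<beta> and
  \<epsilon> are kept in both directions.\<close>

lemma id_plus_mu_orbit:
  assumes deep: "deep n" and n: "n \<ge> 1" and x: "x \<in> carrier (H2_quot R T act n)"
  shows "id_plus_mu p d R T act n ` orbit (Comp R (quot_term R T act n) (quot_act act))
      (comp_action R (quot_term R T act n) (quot_act act)) x =
    orbit (Comp R (quot_term R T act (n + d)) (quot_act act))
      (comp_action R (quot_term R T act (n + d)) (quot_act act)) (id_plus_mu p d R T act n x)"
proof -
  let ?f = "id_plus_mu p d R T act n"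
  have deep': "deep (n + d)" using deep_mono[OF deep] by simp
  have n': "n + d \<ge> 1" using n by simp
  obtain \<gamma> \<delta> where d: "decomposition n \<gamma> \<delta>" "x = clA n (plus \<gamma> \<delta>)"
    using x unfolding carrier_H2_A_decomposition[OF deep] by blast
  note V1 = decompositionD[OF d(1)] and V2 = decompositionD[OF decomposition_times_p[OF d(1)]]
  have fx: "?f x = clA (n + d) (plus \<gamma> (times p \<delta>))"
    using id_plus_mu_clA[OF deep d(1)] d(2) by simp
  have "?f ` {clA n (twist \<beta> F (plus \<gamma> \<delta>)) | \<beta> F. compatible n \<beta> F} =
      {clA (n + d) (twist \<beta> F (plus \<gamma> (times p \<delta>))) | \<beta> F. compatible (n + d) \<beta> F}"
  proof (intro equalityI subsetI)
    fix y assume "y \<in> ?f ` {clA n (twist \<beta> F (plus \<gamma> \<delta>)) | \<beta> F. compatible n \<beta> F}"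
    then obtain \<beta> F where c: "compatible n \<beta> F" and y: "y = ?f (clA n (twist \<beta> F (plus \<gamma> \<delta>)))"
      by blast
    obtain \<epsilon> \<kappa> where s: "split_pair n \<beta> \<epsilon> \<kappa>" and F: "F = (\<lambda>x. \<epsilon> x + \<kappa> x)"
      using compatible_split[OF deep c] by blast
    have "y = clA (n + d) (twist \<beta> (\<lambda>x. \<epsilon> x + of_nat p * \<kappa> x) (plus \<gamma> (times p \<delta>)))"
      unfolding y F by (rule id_plus_mu_twist[OF deep s d(1)])
    then show "y \<in> {clA (n + d) (twist \<beta> F (plus \<gamma> (times p \<delta>))) | \<beta> F. compatible (n + d) \<beta> F}"
      using split_pair_compatible[OF split_pair_scale[OF deep s]] by blast
  next
    fix y assume "y \<in> {clA (n + d) (twist \<beta> F (plus \<gamma> (times p \<delta>))) | \<beta> F. compatible (n + d) \<beta> F}"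
    then obtain \<beta> F where c: "compatible (n + d) \<beta> F"
      and y: "y = clA (n + d) (twist \<beta> F (plus \<gamma> (times p \<delta>)))"
      by blast
    obtain \<epsilon> \<kappa>' where s': "split_pair (n + d) \<beta> \<epsilon> \<kappa>'" and F: "F = (\<lambda>x. \<epsilon> x + \<kappa>' x)"
      using compatible_split[OF deep' c] by blast
    obtain \<kappa> where s: "split_pair n \<beta> \<epsilon> \<kappa>" and \<kappa>: "\<And>x. x \<in> V \<Longrightarrow> \<kappa>' x = of_nat p * \<kappa> x"
      using split_pair_unscale[OF deep s'] by blast
    have "lift_cochain R (red (n + d)) 2 (twist \<beta> F (plus \<gamma> (times p \<delta>))) =
        lift_cochain R (red (n + d)) 2 (twist \<beta> (\<lambda>x. \<epsilon> x + of_nat p * \<kappa> x) (plus \<gamma> (times p \<delta>)))"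
      unfolding lift_cochain_def F
      by (rule restrict_ext, subst twist_cong[OF split_pairD(1)[OF s] V2(6)]) (simp_all add: \<kappa>)
    then have "y = ?f (clA n (twist \<beta> (\<lambda>x. \<epsilon> x + \<kappa> x) (plus \<gamma> \<delta>)))"
      unfolding y id_plus_mu_twist[OF deep s d(1)] by (simp add: lift_class_def)
    then show "y \<in> ?f ` {clA n (twist \<beta> F (plus \<gamma> \<delta>)) | \<beta> F. compatible n \<beta> F}"
      using split_pair_compatible[OF s] by blast
  qed
  then show ?thesis
    unfolding d(2) orbit_clA[OF n V1(6,7)] unfolding d(2)[symmetric] fx orbit_clA[OF n' V2(6,7)] .
qed

lemma orbit_subset_carrier:
  assumes deep: "deep n" and n: "n \<ge> 1" and x: "x \<in> carrier (H2_quot R T act n)"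
  shows "orbit (Comp R (quot_term R T act n) (quot_act act))
      (comp_action R (quot_term R T act n) (quot_act act)) x \<subseteq> carrier (H2_quot R T act n)"
proof -
  obtain f where f: "val 2 V f" "val 3 (Vs n) (D 2 f)" "x = clA n f"
    using x unfolding carrier_H2_A by blast
  show ?thesis
    unfolding f(3) orbit_clA[OF n f(1,2)] carrier_H2_A
    using twist_valued[OF _ f(1)] twist_cocycle[OF _ f(1,2)] by blast
qed

text \<open>A bijection that sends orbits onto orbits induces a bijection of the sets of orbits.
  Injectivity uses that orbits are subsets of the carrier, where the map is injective.\<close>

theorem id_plus_mu_orbits:
  assumes deep: "deep n" and n: "n \<ge> 1"
  shows "bij_betw (\<lambda>orb. id_plus_mu p d R T act n ` orb)
    (comp_orbits R (quot_term R T act n) (quot_act act))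
    (comp_orbits R (quot_term R T act (n + d)) (quot_act act))"
proof -
  let ?f = "id_plus_mu p d R T act n"
  let ?o = "\<lambda>n. orbit (Comp R (quot_term R T act n) (quot_act act))
      (comp_action R (quot_term R T act n) (quot_act act))"
  have orbits: "comp_orbits R (quot_term R T act m) (quot_act act) = ?o m ` carrier (H2_quot R T act m)"
    for m
    unfolding comp_orbits_def orbits_def by blast
  have bij: "bij_betw ?f (carrier (H2_quot R T act n)) (carrier (H2_quot R T act (n + d)))"
    using id_plus_mu_iso[OF deep] by (simp add: iso_def)
  have "inj_on (\<lambda>orb. ?f ` orb) (?o n ` carrier (H2_quot R T act n))"
  proof (rule inj_onI)
    fix P Q assume "P \<in> ?o n ` carrier (H2_quot R T act n)" "Q \<in> ?o n ` carrier (H2_quot R T act n)"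
      and eq: "?f ` P = ?f ` Q"
    then have "P \<subseteq> carrier (H2_quot R T act n)" "Q \<subseteq> carrier (H2_quot R T act n)"
      using orbit_subset_carrier[OF deep n] by blast+
    then show "P = Q" using inj_on_image_eq_iff[OF bij_betw_imp_inj_on[OF bij]] eq by blast
  qed
  moreover have "(\<lambda>orb. ?f ` orb) ` ?o n ` carrier (H2_quot R T act n) =
      ?o (n + d) ` carrier (H2_quot R T act (n + d))"
  proof -
    have "(\<lambda>orb. ?f ` orb) ` ?o n ` carrier (H2_quot R T act n) =
        (\<lambda>x. ?o (n + d) (?f x)) ` carrier (H2_quot R T act n)"
      unfolding image_image by (rule image_cong[OF refl]) (rule id_plus_mu_orbit[OF deep n])
    also have "\<dots> = ?o (n + d) ` ?f ` carrier (H2_quot R T act n)" by (simp only: image_image)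
    also have "?f ` carrier (H2_quot R T act n) = carrier (H2_quot R T act (n + d))"
      by (rule bij_betw_imp_surj_on[OF bij])
    finally show ?thesis .
  qed
  ultimately show ?thesis unfolding orbits bij_betw_def by blast
qed

corollary id_plus_mu_correspondence:
  "\<exists>N. \<forall>n\<ge>N. id_plus_mu p d R T act n \<in> iso (H2_quot R T act n) (H2_quot R T act (n + d)) \<and>
     bij_betw (\<lambda>orb. id_plus_mu p d R T act n ` orb)
       (comp_orbits R (quot_term R T act n) (quot_act act))
       (comp_orbits R (quot_term R T act (n + d)) (quot_act act))"
proof -
  obtain N where "\<And>n. n \<ge> N \<Longrightarrow> deep n" using eventually_deep by blast
  then show ?thesis
    \<comment> \<open>The maximum with 1 provides n \<ge> 1 for the surjectivity condition of
      \<open>compatible_of_Comp\<close>.\<close>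
    using id_plus_mu_iso id_plus_mu_orbits by (intro exI[of _ "max N 1"]) simp
qed

end

section \<open>Free modules over the p-adic integers\<close>

text \<open>The index i numbers coordinates, m is the base and n the exponent; the entry at (i, m,
  n) counts modulo m^n.\<close>

definition residues_eq :: "(nat \<Rightarrow> nat \<Rightarrow> nat \<Rightarrow> int) \<Rightarrow> (nat \<Rightarrow> nat \<Rightarrow> nat \<Rightarrow> int) \<Rightarrow> bool" where
  "residues_eq z w \<longleftrightarrow> (\<forall>i m n. int m ^ n dvd z i m n - w i m n)"

text \<open>The product of copies of all rings \<open>\<int>/m\<^sup>n\<close> is a type that does not depend on \<open>p\<close> and \<open>d\<close> and
  contains the additive group \<open>\<int>\<^sub>p\<^sup>d\<close>. Embedding \<open>T\<close> into it makes type class algebra available for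
  cochains.\<close>

quotient_type residue_product = "nat \<Rightarrow> nat \<Rightarrow> nat \<Rightarrow> int" / residues_eq
proof (rule equivpI)
  show "reflp residues_eq" by (simp add: reflp_def residues_eq_def)
  show "symp residues_eq" by (simp add: symp_def residues_eq_def dvd_diff_commute)
  show "transp residues_eq"
    unfolding transp_def residues_eq_def
  proof (intro allI impI)
    fix x y z :: "nat \<Rightarrow> nat \<Rightarrow> nat \<Rightarrow> int" and i m n
    assume "\<forall>i m n. int m ^ n dvd x i m n - y i m n" "\<forall>i m n. int m ^ n dvd y i m n - z i m n"
    then have "int m ^ n dvd (x i m n - y i m n) + (y i m n - z i m n)" by (intro dvd_add) blast+
    then show "int m ^ n dvd x i m n - z i m n" by simp
  qed
qed

instantiation residue_product :: comm_ring_1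
begin

lift_definition zero_residue_product :: residue_product is "\<lambda>i m n. 0" .

lift_definition one_residue_product :: residue_product is "\<lambda>i m n. 1" .

lift_definition plus_residue_product :: "residue_product \<Rightarrow> residue_product \<Rightarrow> residue_product"
  is "\<lambda>z w i m n. z i m n + w i m n"
  unfolding residues_eq_def by (simp add: add_diff_add)

lift_definition uminus_residue_product :: "residue_product \<Rightarrow> residue_product"
  is "\<lambda>z i m n. - z i m n"
  unfolding residues_eq_def by (simp add: dvd_diff_commute)

lift_definition minus_residue_product :: "residue_product \<Rightarrow> residue_product \<Rightarrow> residue_product"
  is "\<lambda>z w i m n. z i m n - w i m n"
  unfolding residues_eq_def
proof (intro allI)
  fix a b c e :: "nat \<Rightarrow> nat \<Rightarrow> nat \<Rightarrow> int" and i m n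
  assume ab: "\<forall>i m n. int m ^ n dvd a i m n - b i m n" and ce: "\<forall>i m n. int m ^ n dvd c i m n - e i m n"
  have "int m ^ n dvd (a i m n - b i m n) - (c i m n - e i m n)"
    by (rule dvd_diff[OF ab[rule_format] ce[rule_format]])
  then show "int m ^ n dvd a i m n - c i m n - (b i m n - e i m n)" by (simp add: algebra_simps)
qed

lift_definition times_residue_product :: "residue_product \<Rightarrow> residue_product \<Rightarrow> residue_product"
  is "\<lambda>z w i m n. z i m n * w i m n"
  unfolding residues_eq_def
proof (intro allI)
  fix a b c e :: "nat \<Rightarrow> nat \<Rightarrow> nat \<Rightarrow> int" and i m n
  assume "\<forall>i m n. int m ^ n dvd a i m n - b i m n" "\<forall>i m n. int m ^ n dvd c i m n - e i m n"
  then have "int m ^ n dvd (a i m n - b i m n) * c i m n + b i m n * (c i m n - e i m n)"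
    by (intro dvd_add) (auto intro: dvd_mult dvd_mult2)
  then show "int m ^ n dvd a i m n * c i m n - b i m n * e i m n" by (simp add: algebra_simps)
qed

instance
proof
  \<comment> \<open>The component with base 0 and exponent 1 has modulus 0 and separates 0 from
    1.\<close>
  show "(0 :: residue_product) \<noteq> 1"
    by transfer (simp add: residues_eq_def, rule exI[of _ 0], rule exI[of _ 1], simp)
qed (transfer; simp add: residues_eq_def algebra_simps)+

end

section \<open>Arithmetic in the p-adic integers\<close>

definition padic_of_nat :: "nat \<Rightarrow> nat \<Rightarrow> nat \<Rightarrow> int" where
  "padic_of_nat p k = (\<lambda>n. int k mod int p ^ n)"

context
  fixes p :: nat
  assumes p: "p > 1"
begin

lemma padic_of_nat_closed: "padic_of_nat p k \<in> carrier (padic_integers p)"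
  using p by (auto simp: padic_of_nat_def padic_integers_def mod_mod_cancel le_imp_power_dvd)

lemma padic_of_nat_0: "padic_of_nat p 0 = \<zero>\<^bsub>padic_integers p\<^esub>"
  by (simp add: padic_of_nat_def padic_integers_def)

lemma padic_of_nat_Suc:
  "padic_of_nat p (Suc k) = padic_of_nat p k \<oplus>\<^bsub>padic_integers p\<^esub> \<one>\<^bsub>padic_integers p\<^esub>"
  by (simp add: padic_of_nat_def padic_integers_def mod_simps add.commute)

lemma padic_coherent:
  assumes "z \<in> carrier (padic_integers p)"
  shows "z (n + j) mod int p ^ n = z n"
proof (induction j)
  case 0
  then show ?case using assms by (simp add: padic_integers_def)
next
  case (Suc j)
  have "z (n + Suc j) mod int p ^ n = z (Suc (n + j)) mod int p ^ (n + j) mod int p ^ n"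
    by (simp add: mod_mod_cancel le_imp_power_dvd)
  also have "z (Suc (n + j)) mod int p ^ (n + j) = z (n + j)"
    using assms by (simp add: padic_integers_def)
  finally show ?case using Suc by simp
qed

text \<open>Division with remainder by p^m: the remainder is the residue \<open>z m\<close>, taken
  as a natural number.\<close>

lemma padic_division:
  assumes z: "z \<in> carrier (padic_integers p)"
  shows "\<exists>w\<in>carrier (padic_integers p). z = padic_of_nat p (nat (z m))
    \<oplus>\<^bsub>padic_integers p\<^esub> (padic_of_nat p (p ^ m) \<otimes>\<^bsub>padic_integers p\<^esub> w)"
proof
  have pos: "int p ^ k > 0" for k using p by simp
  have z': "0 \<le> z n" "z n < int p ^ n" for n using z by (auto simp: padic_integers_def)
  \<comment> \<open>Dividing by p^m costs m digits, so the residue of w modulo p^n is read off from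
    z modulo p^(n+m).\<close>
  define w where "w n = z (n + m) div int p ^ m" for n
  have w_eq: "int p ^ m * w n = z (n + m) - z m" for n
    using padic_coherent[OF z, of m n] unfolding w_def
    by (simp add: minus_mod_eq_mult_div[symmetric] add.commute)
  show "w \<in> carrier (padic_integers p)"
  proof -
    have "0 \<le> w n" for n unfolding w_def using z' pos by (simp add: pos_imp_zdiv_nonneg_iff)
    moreover have "w n < int p ^ n" for n
    proof -
      have "int p ^ m * w n < int p ^ m * int p ^ n"
        using w_eq[of n] z'(1)[of m] z'(2)[of "n + m"] by (simp add: power_add mult.commute)
      then show ?thesis using pos[of m] by simp
    qed
    moreover have "int p ^ n dvd w (Suc n) - w n" for n
    proof -
      have "z (n + m + 1) mod int p ^ (n + m) = z (n + m) mod int p ^ (n + m)"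
        using padic_coherent[OF z, of "n + m" 1] padic_coherent[OF z, of "n + m" 0] by simp
      then have "int p ^ (n + m) dvd z (n + m + 1) - z (n + m)" by (simp add: mod_eq_dvd_iff)
      also have "z (n + m + 1) - z (n + m) = int p ^ m * (w (Suc n) - w n)"
        using w_eq[of n] w_eq[of "Suc n"] by (simp add: right_diff_distrib)
      finally have "int p ^ m * int p ^ n dvd int p ^ m * (w (Suc n) - w n)"
        by (simp add: power_add mult.commute)
      then show ?thesis using p by auto
    qed
    ultimately show ?thesis
      by (auto simp: padic_integers_def mod_eq_dvd_iff[symmetric])
  qed
  show "z = padic_of_nat p (nat (z m))
    \<oplus>\<^bsub>padic_integers p\<^esub> (padic_of_nat p (p ^ m) \<otimes>\<^bsub>padic_integers p\<^esub> w)"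
  proof
    fix n
    have "z n = (z m + int p ^ m * w n) mod int p ^ n"
      using padic_coherent[OF z, of n m] w_eq[of n] by simp
    then show "z n = (padic_of_nat p (nat (z m))
        \<oplus>\<^bsub>padic_integers p\<^esub> (padic_of_nat p (p ^ m) \<otimes>\<^bsub>padic_integers p\<^esub> w)) n"
      using z'(1)[of m] by (simp add: padic_of_nat_def padic_integers_def mod_simps)
  qed
qed

end

locale free_padic_module =
  T: comm_group T + M: Module.module "padic_integers p" M
  for T :: "'w monoid" and p d :: nat and M :: "(nat \<Rightarrow> int, 'w) module" and e :: "nat \<Rightarrow> 'w" +
  assumes p: "p > 1"
    and M_simps: "carrier M = carrier T" "add M = mult T" "zero M = one T"
    and e_closed: "e \<in> {..<d} \<rightarrow> carrier M"
    and free: "x \<in> carrier M \<Longrightarrow> \<exists>!c. c \<in> {..<d} \<rightarrow>\<^sub>E carrier (padic_integers p) \<and>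
      x = (\<Oplus>\<^bsub>M\<^esub>i\<in>{..<d}. c i \<odot>\<^bsub>M\<^esub> e i)"
begin

abbreviation Z :: "(nat \<Rightarrow> int) ring" where "Z \<equiv> padic_integers p"

section \<open>Coordinates with respect to a basis\<close>

definition lincomb :: "(nat \<Rightarrow> 'w) \<Rightarrow> (nat \<Rightarrow> nat \<Rightarrow> int) \<Rightarrow> 'w" where
  "lincomb b c = (\<Oplus>\<^bsub>M\<^esub>i\<in>{..<d}. c i \<odot>\<^bsub>M\<^esub> b i)"

definition coord :: "'w \<Rightarrow> nat \<Rightarrow> nat \<Rightarrow> int" where
  "coord x = (THE c. c \<in> {..<d} \<rightarrow>\<^sub>E carrier Z \<and> x = lincomb e c)"

lemma coord:
  assumes "x \<in> carrier T"
  shows "coord x \<in> {..<d} \<rightarrow>\<^sub>E carrier Z" "x = lincomb e (coord x)"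
  using theI'[OF free[of x]] assms unfolding coord_def lincomb_def M_simps by auto

lemma coord_closed: "x \<in> carrier T \<Longrightarrow> i < d \<Longrightarrow> coord x i \<in> carrier Z"
  using coord(1) by auto

lemma coord_unique:
  assumes "x \<in> carrier T" "c \<in> {..<d} \<rightarrow>\<^sub>E carrier Z" "x = lincomb e c"
  shows "coord x = c"
  using free[of x] coord[OF assms(1)] assms unfolding M_simps lincomb_def[symmetric] by blast

lemma smult_closed: "z \<in> carrier Z \<Longrightarrow> x \<in> carrier T \<Longrightarrow> z \<odot>\<^bsub>M\<^esub> x \<in> carrier T"
  using M.smult_closed by (simp add: M_simps)

lemma lincomb_closed:
  assumes "b \<in> {..<d} \<rightarrow> carrier T" "c \<in> {..<d} \<rightarrow> carrier Z"
  shows "lincomb b c \<in> carrier T"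
  unfolding lincomb_def M_simps(1)[symmetric]
  using assms by (intro M.finsum_closed Pi_I M.smult_closed) (auto simp: M_simps)

lemma lincomb_add:
  assumes "b \<in> {..<d} \<rightarrow> carrier T" "c \<in> {..<d} \<rightarrow> carrier Z" "c' \<in> {..<d} \<rightarrow> carrier Z"
  shows "lincomb b (\<lambda>i\<in>{..<d}. c i \<oplus>\<^bsub>Z\<^esub> c' i) = lincomb b c \<otimes>\<^bsub>T\<^esub> lincomb b c'"
proof -
  have "lincomb b (\<lambda>i\<in>{..<d}. c i \<oplus>\<^bsub>Z\<^esub> c' i) =
      (\<Oplus>\<^bsub>M\<^esub>i\<in>{..<d}. c i \<odot>\<^bsub>M\<^esub> b i \<oplus>\<^bsub>M\<^esub> c' i \<odot>\<^bsub>M\<^esub> b i)"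
    unfolding lincomb_def using assms
    by (intro M.finsum_cong') (auto simp: M.smult_l_distr M_simps Pi_iff intro!: smult_closed)
  also have "\<dots> = lincomb b c \<oplus>\<^bsub>M\<^esub> lincomb b c'"
    unfolding lincomb_def using assms
    by (intro M.finsum_addf) (auto simp: Pi_iff M_simps intro!: smult_closed)
  finally show ?thesis by (simp add: M_simps)
qed

lemma coord_add:
  assumes "x \<in> carrier T" "y \<in> carrier T"
  shows "coord (x \<otimes>\<^bsub>T\<^esub> y) = (\<lambda>i\<in>{..<d}. coord x i \<oplus>\<^bsub>Z\<^esub> coord y i)"
proof (rule coord_unique)
  have e': "e \<in> {..<d} \<rightarrow> carrier T" using e_closed by (simp add: M_simps)
  have c: "coord x \<in> {..<d} \<rightarrow> carrier Z" "coord y \<in> {..<d} \<rightarrow> carrier Z"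
    using coord(1)[OF assms(1)] coord(1)[OF assms(2)] by auto
  show "x \<otimes>\<^bsub>T\<^esub> y \<in> carrier T" using assms by simp
  show "(\<lambda>i\<in>{..<d}. coord x i \<oplus>\<^bsub>Z\<^esub> coord y i) \<in> {..<d} \<rightarrow>\<^sub>E carrier Z"
    using c by (auto simp: Pi_iff intro!: M.R.add.m_closed)
  show "x \<otimes>\<^bsub>T\<^esub> y = lincomb e (\<lambda>i\<in>{..<d}. coord x i \<oplus>\<^bsub>Z\<^esub> coord y i)"
    using lincomb_add[OF e' c] coord(2)[OF assms(1)] coord(2)[OF assms(2)] by simp
qed

lemma coord_add_at:
  assumes "x \<in> carrier T" "y \<in> carrier T" "i < d"
  shows "coord (x \<otimes>\<^bsub>T\<^esub> y) i n = (coord x i n + coord y i n) mod int p ^ n"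
  using coord_add[OF assms(1,2)] assms(3) by (simp add: padic_integers_def)

lemma coord_range:
  assumes "x \<in> carrier T" "i < d"
  shows "0 \<le> coord x i n" "coord x i n < int p ^ n" "coord x i (Suc n) mod int p ^ n = coord x i n"
  using coord_closed[OF assms] by (auto simp: padic_integers_def)

definition \<phi> :: "'w \<Rightarrow> residue_product" where
  "\<phi> x = abs_residue_product (\<lambda>i m n. if i < d \<and> m = p then coord x i n else 0)"

lemma \<phi>_add:
  assumes "x \<in> carrier T" "y \<in> carrier T"
  shows "\<phi> (x \<otimes>\<^bsub>T\<^esub> y) = \<phi> x + \<phi> y"
  unfolding \<phi>_def plus_residue_product.abs_eq residue_product.abs_eq_iff residues_eq_def
  using coord_add_at[OF assms] by (auto simp: mod_eq_dvd_iff[symmetric])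

text \<open>Coordinates are stored as least non-negative residues, so congruence modulo p^n in every
  component is equality.\<close>

lemma \<phi>_inj: "inj_on \<phi> (carrier T)"
proof (rule inj_onI)
  fix x y assume xy: "x \<in> carrier T" "y \<in> carrier T" and eq: "\<phi> x = \<phi> y"
  have "coord x i n = coord y i n" if i: "i < d" for i n
  proof -
    have *: "\<forall>i m n. int m ^ n dvd (if i < d \<and> m = p then coord x i n else 0) -
        (if i < d \<and> m = p then coord y i n else 0)"
      using eq unfolding \<phi>_def residue_product.abs_eq_iff residues_eq_def .
    have "int p ^ n dvd coord x i n - coord y i n"
      using spec[OF spec[OF spec[OF *, of i], of p], of n] i by simp
    then have "coord x i n mod int p ^ n = coord y i n mod int p ^ n" by (simp add: mod_eq_dvd_iff)
    then show ?thesis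
      using coord_range(1,2)[OF xy(1) i, of n] coord_range(1,2)[OF xy(2) i, of n] by simp
  qed
  then have "coord x = coord y"
    using coord(1)[OF xy(1)] coord(1)[OF xy(2)] by (intro PiE_ext) (auto intro!: ext)
  then show "x = y" using coord(2) xy by metis
qed

lemma \<phi>_one: "\<phi> \<one>\<^bsub>T\<^esub> = 0"
  using \<phi>_add[of "\<one>\<^bsub>T\<^esub>" "\<one>\<^bsub>T\<^esub>"] by simp

lemma \<phi>_eq_0_iff: "x \<in> carrier T \<Longrightarrow> \<phi> x = 0 \<longleftrightarrow> x = \<one>\<^bsub>T\<^esub>"
  using inj_onD[OF \<phi>_inj, of x "\<one>\<^bsub>T\<^esub>"] \<phi>_one by auto

lemma \<phi>_inv: "x \<in> carrier T \<Longrightarrow> \<phi> (inv\<^bsub>T\<^esub> x) = - \<phi> x"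
  using \<phi>_add[of x "inv\<^bsub>T\<^esub> x"] by (simp add: \<phi>_one eq_neg_iff_add_eq_0 add.commute)

lemma \<phi>_pow: "x \<in> carrier T \<Longrightarrow> \<phi> (x [^]\<^bsub>T\<^esub> (k::nat)) = of_nat k * \<phi> x"
  by (induction k) (auto simp: \<phi>_one \<phi>_add algebra_simps)

lemma \<phi>_subgroup: "add_subgroup (\<phi> ` carrier T)"
  unfolding add_subgroup_def
proof (intro conjI ballI)
  show "0 \<in> \<phi> ` carrier T" using \<phi>_one T.one_closed by (metis imageI)
  fix x y assume "x \<in> \<phi> ` carrier T" "y \<in> \<phi> ` carrier T"
  then obtain a b where ab: "a \<in> carrier T" "b \<in> carrier T" "x = \<phi> a" "y = \<phi> b" by blast
  then have "x - y = \<phi> (a \<otimes>\<^bsub>T\<^esub> inv\<^bsub>T\<^esub> b)" by (simp add: \<phi>_add \<phi>_inv)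
  then show "x - y \<in> \<phi> ` carrier T" using ab by simp
qed


lemma smult_of_nat: "x \<in> carrier T \<Longrightarrow> padic_of_nat p k \<odot>\<^bsub>M\<^esub> x = x [^]\<^bsub>T\<^esub> k"
proof (induction k)
  case 0
  then show ?case using M.smult_l_null[of x] by (simp add: padic_of_nat_0[OF p] M_simps)
next
  case (Suc k)
  have "padic_of_nat p (Suc k) \<odot>\<^bsub>M\<^esub> x = padic_of_nat p k \<odot>\<^bsub>M\<^esub> x \<oplus>\<^bsub>M\<^esub> \<one>\<^bsub>Z\<^esub> \<odot>\<^bsub>M\<^esub> x"
    unfolding padic_of_nat_Suc[OF p]
    using Suc.prems by (intro M.smult_l_distr) (auto simp: padic_of_nat_closed[OF p] M_simps)
  then show ?case using Suc M.smult_one[of x] by (simp add: M_simps)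
qed

lemma \<phi>_lincomb:
  assumes "b \<in> {..<d} \<rightarrow> carrier T" "c \<in> {..<d} \<rightarrow> carrier Z"
  shows "\<phi> (lincomb b c) = (\<Sum>i<d. \<phi> (c i \<odot>\<^bsub>M\<^esub> b i))"
proof -
  have "\<phi> (\<Oplus>\<^bsub>M\<^esub>i\<in>I. c i \<odot>\<^bsub>M\<^esub> b i) = (\<Sum>i\<in>I. \<phi> (c i \<odot>\<^bsub>M\<^esub> b i))" if "finite I" "I \<subseteq> {..<d}" for I
    using that
  proof (induction I rule: finite_induct)
    case empty
    then show ?case by (simp add: M_simps \<phi>_one)
  next
    case (insert i I)
    have cl: "c j \<odot>\<^bsub>M\<^esub> b j \<in> carrier T" if "j \<in> insert i I" for j
      using that insert.prems assms by (intro smult_closed) auto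
    have "(\<Oplus>\<^bsub>M\<^esub>j\<in>I. c j \<odot>\<^bsub>M\<^esub> b j) \<in> carrier T"
      using M.finsum_closed[of "\<lambda>j. c j \<odot>\<^bsub>M\<^esub> b j" I] cl by (simp add: M_simps)
    moreover have "(\<Oplus>\<^bsub>M\<^esub>j\<in>insert i I. c j \<odot>\<^bsub>M\<^esub> b j) =
        c i \<odot>\<^bsub>M\<^esub> b i \<otimes>\<^bsub>T\<^esub> (\<Oplus>\<^bsub>M\<^esub>j\<in>I. c j \<odot>\<^bsub>M\<^esub> b j)"
      using M.finsum_insert[OF insert.hyps, of "\<lambda>j. c j \<odot>\<^bsub>M\<^esub> b j"] cl by (simp add: M_simps)
    ultimately show ?case using insert cl by (simp add: \<phi>_add)
  qed
  then show ?thesis unfolding lincomb_def by simp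
qed

text \<open>The residues of c and the quotients w do not depend on b. In \<open>lifting\<close> the
  same w thus serves both the basis and the family of prescribed images.\<close>

lemma \<phi>_lincomb_division:
  assumes c: "c \<in> {..<d} \<rightarrow> carrier Z"
  shows "\<exists>w. w \<in> {..<d} \<rightarrow> carrier Z \<and> (\<forall>b\<in>{..<d} \<rightarrow> carrier T. \<phi> (lincomb b c) =
    (\<Sum>i<d. of_nat (nat (c i m)) * \<phi> (b i)) + of_nat (p ^ m) * \<phi> (lincomb b w))"
proof -
  have "\<forall>i\<in>{..<d}. \<exists>w\<in>carrier Z. c i = padic_of_nat p (nat (c i m)) \<oplus>\<^bsub>Z\<^esub> (padic_of_nat p (p ^ m) \<otimes>\<^bsub>Z\<^esub> w)"
    using padic_division[OF p] c by blast
  then obtain w where w: "\<And>i. i < d \<Longrightarrow> w i \<in> carrier Z"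
    "\<And>i. i < d \<Longrightarrow> c i = padic_of_nat p (nat (c i m)) \<oplus>\<^bsub>Z\<^esub> (padic_of_nat p (p ^ m) \<otimes>\<^bsub>Z\<^esub> w i)"
    by (metis lessThan_iff)
  have wZ: "w \<in> {..<d} \<rightarrow> carrier Z" using w(1) by auto
  have "\<phi> (lincomb b c) = (\<Sum>i<d. of_nat (nat (c i m)) * \<phi> (b i)) + of_nat (p ^ m) * \<phi> (lincomb b w)"
    if b: "b \<in> {..<d} \<rightarrow> carrier T" for b
  proof -
    have "\<phi> (c i \<odot>\<^bsub>M\<^esub> b i) = of_nat (nat (c i m)) * \<phi> (b i) + of_nat (p ^ m) * \<phi> (w i \<odot>\<^bsub>M\<^esub> b i)"
      if i: "i < d" for i
    proof -
      have bi: "b i \<in> carrier T" "b i \<in> carrier M" using b i by (auto simp: M_simps)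
      note cl = padic_of_nat_closed[OF p] w(1)[OF i] bi(2)
      have "c i \<odot>\<^bsub>M\<^esub> b i = (padic_of_nat p (nat (c i m)) \<odot>\<^bsub>M\<^esub> b i) \<oplus>\<^bsub>M\<^esub>
          (padic_of_nat p (p ^ m) \<odot>\<^bsub>M\<^esub> (w i \<odot>\<^bsub>M\<^esub> b i))"
        by (subst w(2)[OF i]) (simp add: M.smult_l_distr M.smult_assoc1 cl)
      also have "\<dots> = b i [^]\<^bsub>T\<^esub> nat (c i m) \<otimes>\<^bsub>T\<^esub> (w i \<odot>\<^bsub>M\<^esub> b i) [^]\<^bsub>T\<^esub> (p ^ m)"
        using smult_closed[OF w(1)[OF i] bi(1)] by (simp add: smult_of_nat bi(1) M_simps)
      finally show ?thesis
        using smult_closed[OF w(1)[OF i] bi(1)] bi(1) by (simp only: \<phi>_add \<phi>_pow T.nat_pow_closed)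
    qed
    then show ?thesis
      unfolding \<phi>_lincomb[OF b c] \<phi>_lincomb[OF b wZ] by (simp add: sum.distrib sum_distrib_left)
  qed
  then show ?thesis using wZ by blast
qed

section \<open>Torsion, the index of pT and the lifting of maps\<close>

lemma coord_pow:
  assumes x: "x \<in> carrier T" and i: "i < d"
  shows "coord (x [^]\<^bsub>T\<^esub> k) i n = (int k * coord x i n) mod int p ^ n"
proof (induction k)
  case 0
  let ?a = "coord \<one>\<^bsub>T\<^esub> i n"
  note r = coord_range(1,2)[OF T.one_closed i, of n]
  have "?a = (?a + ?a) mod int p ^ n"
    using coord_add_at[of "\<one>\<^bsub>T\<^esub>" "\<one>\<^bsub>T\<^esub>" i n] i by simp
  then have "(?a + ?a) mod int p ^ n = ?a mod int p ^ n" using r by simp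
  then have "int p ^ n dvd ?a" unfolding mod_eq_dvd_iff by simp
  then have "?a mod int p ^ n = 0" by simp
  then show ?case using r by simp
next
  case (Suc k)
  have "coord (x [^]\<^bsub>T\<^esub> Suc k) i n = ((int k * coord x i n) mod int p ^ n + coord x i n) mod int p ^ n"
    using coord_add_at[of "x [^]\<^bsub>T\<^esub> k" x i n] i x Suc by simp
  also have "\<dots> = (int k * coord x i n + coord x i n) mod int p ^ n" by (simp add: mod_simps)
  finally show ?case by (simp add: algebra_simps)
qed

text \<open>One more digit is inspected than is to be determined: p times the residue modulo p^(n+1)
  being 0 there forces the residue modulo p^n to be 0.\<close>

lemma torsion_free:
  assumes "v \<in> \<phi> ` carrier T" "of_nat p * v = 0" shows "v = 0"
proof -
  obtain x where x: "x \<in> carrier T" "v = \<phi> x" using assms by blast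
  have px: "x [^]\<^bsub>T\<^esub> p = \<one>\<^bsub>T\<^esub>"
    using assms(2) x \<phi>_pow[of x p] \<phi>_eq_0_iff[of "x [^]\<^bsub>T\<^esub> p"] by simp
  have one: "coord \<one>\<^bsub>T\<^esub> i n = 0" if "i < d" for i n
    using coord_pow[OF x(1) that, of 0 n] by simp
  have "coord x i n = 0" if i: "i < d" for i n
  proof -
    have "(int p * coord x i (Suc n)) mod int p ^ Suc n = 0"
      using coord_pow[OF x(1) i, of p "Suc n"] one[OF i] px by simp
    then have "int p * int p ^ n dvd int p * coord x i (Suc n)" by auto
    then have "int p ^ n dvd coord x i (Suc n)" using p by simp
    then show ?thesis using coord_range(3)[OF x(1) i, of n] by simp
  qed
  then have "coord x i = coord \<one>\<^bsub>T\<^esub> i" if "i < d" for i using one that by auto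
  then have "coord x = coord \<one>\<^bsub>T\<^esub>"
    using coord(1)[OF x(1)] coord(1)[OF T.one_closed] by (intro PiE_ext) auto
  then have "x = \<one>\<^bsub>T\<^esub>" using coord(2)[OF x(1)] coord(2)[OF T.one_closed] by simp
  then show ?thesis using x \<phi>_one by simp
qed

text \<open>The coset of x modulo pT is determined by the residues modulo p of its d coordinates,
  and every d-tuple of residues occurs.\<close>

lemma index_multiples_p: "add_index (\<phi> ` carrier T) (multiples p (\<phi> ` carrier T)) = p ^ d"
proof -
  let ?V = "\<phi> ` carrier T"
  define \<kappa> where "\<kappa> x = (\<lambda>i\<in>{..<d}. coord x i 1)" for x
  have e': "e \<in> {..<d} \<rightarrow> carrier T" using e_closed by (simp add: M_simps)
  have coordZ: "coord x \<in> {..<d} \<rightarrow> carrier Z" if "x \<in> carrier T" for x using coord(1)[OF that] by auto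
  have division: "\<exists>w\<in>?V. \<phi> x = (\<Sum>i<d. of_nat (nat (coord x i 1)) * \<phi> (e i)) + of_nat p * w"
    if x: "x \<in> carrier T" for x
  proof -
    obtain w where w: "w \<in> {..<d} \<rightarrow> carrier Z"
      "\<forall>b\<in>{..<d} \<rightarrow> carrier T. \<phi> (lincomb b (coord x)) =
        (\<Sum>i<d. of_nat (nat (coord x i 1)) * \<phi> (b i)) + of_nat (p ^ 1) * \<phi> (lincomb b w)"
      using \<phi>_lincomb_division[OF coordZ[OF x], of 1] by blast
    have "\<phi> x = (\<Sum>i<d. of_nat (nat (coord x i 1)) * \<phi> (e i)) + of_nat p * \<phi> (lincomb e w)"
      using bspec[OF w(2) e'] coord(2)[OF x, symmetric] by simp
    then show ?thesis using lincomb_closed[OF e' w(1)] by blast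
  qed
  have \<kappa>: "\<kappa> x = \<kappa> y \<longleftrightarrow> \<phi> x - \<phi> y \<in> multiples p ?V"
    if x: "x \<in> carrier T" and y: "y \<in> carrier T" for x y
  proof
    assume k: "\<kappa> x = \<kappa> y"
    have eq: "coord x i 1 = coord y i 1" if "i < d" for i
      using fun_cong[OF k, of i] that by (simp add: \<kappa>_def)
    obtain w where w: "w \<in> ?V" "\<phi> x = (\<Sum>i<d. of_nat (nat (coord x i 1)) * \<phi> (e i)) + of_nat p * w"
      using division[OF x] by blast
    obtain w' where w': "w' \<in> ?V" "\<phi> y = (\<Sum>i<d. of_nat (nat (coord y i 1)) * \<phi> (e i)) + of_nat p * w'"
      using division[OF y] by blast
    have "(\<Sum>i<d. of_nat (nat (coord x i 1)) * \<phi> (e i)) = (\<Sum>i<d. of_nat (nat (coord y i 1)) * \<phi> (e i))"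
      by (rule sum.cong) (simp_all only: eq lessThan_iff)
    then have "\<phi> x - \<phi> y = of_nat p * (w - w')"
      unfolding w(2) w'(2) by (simp add: right_diff_distrib)
    then show "\<phi> x - \<phi> y \<in> multiples p ?V"
      using multiplesI[OF add_subgroup_diff[OF \<phi>_subgroup w(1) w'(1)]] by simp
  next
    assume "\<phi> x - \<phi> y \<in> multiples p ?V"
    then obtain z where z: "z \<in> carrier T" "\<phi> x - \<phi> y = of_nat p * \<phi> z"
      by (blast elim: multiplesE)
    have "\<phi> x = \<phi> y + of_nat p * \<phi> z" using z(2) by (simp add: algebra_simps)
    also have "\<dots> = \<phi> (y \<otimes>\<^bsub>T\<^esub> z [^]\<^bsub>T\<^esub> p)" using y z(1) by (simp add: \<phi>_add \<phi>_pow)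
    finally have xy: "x = y \<otimes>\<^bsub>T\<^esub> z [^]\<^bsub>T\<^esub> p" using inj_onD[OF \<phi>_inj] x y z(1) by simp
    have "coord x i 1 = coord y i 1" if i: "i < d" for i
      using coord_add_at[OF y T.nat_pow_closed[OF z(1)] i, of p 1] coord_pow[OF z(1) i, of p 1]
        coord_range(1,2)[OF y i, of 1] xy by simp
    then show "\<kappa> x = \<kappa> y" by (auto simp: \<kappa>_def intro!: restrict_ext)
  qed
  let ?\<psi> = "inv_into (carrier T) \<phi>"
  have \<psi>: "?\<psi> (\<phi> x) = x" if "x \<in> carrier T" for x using inv_into_f_f[OF \<phi>_inj that] .
  have "add_index ?V (multiples p ?V) = card ((\<lambda>v. \<kappa> (?\<psi> v)) ` ?V)"
    by (rule add_index_eq_card_image[OF add_subgroup_multiples[OF \<phi>_subgroup]]) (auto simp: \<psi> \<kappa>)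
  also have "(\<lambda>v. \<kappa> (?\<psi> v)) ` ?V = \<kappa> ` carrier T" by (auto simp: image_image \<psi>)
  also have "\<kappa> ` carrier T = {..<d} \<rightarrow>\<^sub>E {0..<int p}"
  proof (intro equalityI subsetI)
    fix k assume "k \<in> \<kappa> ` carrier T"
    then obtain x where x: "x \<in> carrier T" "k = \<kappa> x" by blast
    show "k \<in> {..<d} \<rightarrow>\<^sub>E {0..<int p}"
      unfolding x(2) \<kappa>_def restrict_PiE_iff using coord_range(1,2)[OF x(1), of _ 1] by simp
  next
    fix k assume k: "k \<in> {..<d} \<rightarrow>\<^sub>E {0..<int p}"
    define c where "c = (\<lambda>i\<in>{..<d}. padic_of_nat p (nat (k i)))"
    have c: "c \<in> {..<d} \<rightarrow>\<^sub>E carrier Z" by (simp add: c_def padic_of_nat_closed[OF p])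
    then have cT: "lincomb e c \<in> carrier T" by (intro lincomb_closed e') auto
    have "\<kappa> (lincomb e c) = k"
      unfolding \<kappa>_def coord_unique[OF cT c refl] using k
      by (intro ext) (auto simp: c_def padic_of_nat_def PiE_def extensional_def Pi_def)
    then show "k \<in> \<kappa> ` carrier T" using cT by blast
  qed
  also have "card ({..<d} \<rightarrow>\<^sub>E {0..<int p}) = p ^ d" by (simp add: card_PiE)
  finally show ?thesis .
qed

lemma lifting:
  assumes U: "add_subgroup U" "U \<subseteq> \<phi> ` carrier T" "multiples (p ^ m) (\<phi> ` carrier T) \<subseteq> U"
    and h: "\<And>x. x \<in> \<phi> ` carrier T \<Longrightarrow> h x \<in> \<phi> ` carrier T"
    and h_add: "\<And>x y. x \<in> \<phi> ` carrier T \<Longrightarrow> y \<in> \<phi> ` carrier T \<Longrightarrow> h (x + y) - (h x + h y) \<in> U"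
  shows "\<exists>F. additive_on (\<phi> ` carrier T) F \<and> (\<forall>x\<in>\<phi> ` carrier T. F x \<in> \<phi> ` carrier T \<and> F x - h x \<in> U)"
proof -
  let ?V = "\<phi> ` carrier T"
  note V = \<phi>_subgroup
  let ?\<psi> = "inv_into (carrier T) \<phi>"
  have \<psi>: "?\<psi> (\<phi> x) = x" if "x \<in> carrier T" for x using inv_into_f_f[OF \<phi>_inj that] .
  have e': "e \<in> {..<d} \<rightarrow> carrier T" using e_closed by (simp add: M_simps)
  have coordZ: "coord x \<in> {..<d} \<rightarrow> carrier Z" if "x \<in> carrier T" for x using coord(1)[OF that] by auto
  have h0: "h 0 \<in> U"
    using h_add[of 0 0] add_subgroup_uminus[OF U(1), of "- h 0"] add_subgroup_zero[OF V] by simp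
  have h_mult: "h (of_nat k * x) - of_nat k * h x \<in> U" if x: "x \<in> ?V" for k x
  proof (induction k)
    case (Suc k)
    have kx: "of_nat k * x \<in> ?V" by (rule add_subgroup_of_nat_mult[OF V x])
    have "h (of_nat k * x + x) - (h (of_nat k * x) + h x) + (h (of_nat k * x) - of_nat k * h x) \<in> U"
      by (rule add_subgroup_add[OF U(1) h_add[OF kx x] Suc])
    then show ?case by (simp add: algebra_simps)
  qed (simp add: h0)
  have h_sum: "h (\<Sum>i\<in>I. f i) - (\<Sum>i\<in>I. h (f i)) \<in> U" if "finite I" "\<And>i. i \<in> I \<Longrightarrow> f i \<in> ?V" for I :: "nat set" and f
    using that
  proof (induction I rule: finite_induct)
    case (insert i I)
    have fi: "f i \<in> ?V" and fI: "(\<Sum>i\<in>I. f i) \<in> ?V" using insert.prems by (auto intro!: add_subgroup_sum V)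
    have "h (f i + (\<Sum>i\<in>I. f i)) - (h (f i) + h (\<Sum>i\<in>I. f i)) + (h (\<Sum>i\<in>I. f i) - (\<Sum>i\<in>I. h (f i))) \<in> U"
      using insert by (intro add_subgroup_add[OF U(1) h_add[OF fi fI]]) auto
    then show ?case using insert.hyps by (simp add: algebra_simps)
  qed (simp add: h0)
  define b where "b i = ?\<psi> (h (\<phi> (e i)))" for i
  have hV: "h (\<phi> (e i)) \<in> ?V" if "i < d" for i using h e' that by auto
  have \<phi>b: "\<phi> (b i) = h (\<phi> (e i))" if "i < d" for i
    unfolding b_def by (rule f_inv_into_f[OF hV[OF that]])
  have b: "b \<in> {..<d} \<rightarrow> carrier T"
    unfolding b_def using inv_into_into[OF hV] by auto
  define F where "F v = \<phi> (lincomb b (coord (?\<psi> v)))" for v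
  have F: "F (\<phi> x) = \<phi> (lincomb b (coord x))" if "x \<in> carrier T" for x
    by (simp add: F_def \<psi>[OF that])
  have "additive_on ?V F"
    unfolding additive_on_def
  proof (intro ballI)
    fix v w assume "v \<in> ?V" "w \<in> ?V"
    then obtain x y where xy: "x \<in> carrier T" "y \<in> carrier T" "v = \<phi> x" "w = \<phi> y" by blast
    have "F (v + w) = \<phi> (lincomb b (coord (x \<otimes>\<^bsub>T\<^esub> y)))"
      using F[of "x \<otimes>\<^bsub>T\<^esub> y"] xy by (simp add: \<phi>_add)
    also have "\<dots> = F v + F w"
      unfolding coord_add[OF xy(1,2)] lincomb_add[OF b coordZ[OF xy(1)] coordZ[OF xy(2)]]
      using lincomb_closed[OF b coordZ[OF xy(1)]] lincomb_closed[OF b coordZ[OF xy(2)]] F xy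
      by (simp add: \<phi>_add)
    finally show "F (v + w) = F v + F w" .
  qed
  moreover have "F v \<in> ?V \<and> F v - h v \<in> U" if v: "v \<in> ?V" for v
  proof -
    obtain x where x: "x \<in> carrier T" "v = \<phi> x" using v by blast
    have Fv: "F v = \<phi> (lincomb b (coord x))" using F[OF x(1)] x(2) by simp
    then have FV: "F v \<in> ?V" using lincomb_closed[OF b coordZ[OF x(1)]] by blast
    obtain w where w: "w \<in> {..<d} \<rightarrow> carrier Z"
      "\<forall>b\<in>{..<d} \<rightarrow> carrier T. \<phi> (lincomb b (coord x)) =
        (\<Sum>i<d. of_nat (nat (coord x i m)) * \<phi> (b i)) + of_nat (p ^ m) * \<phi> (lincomb b w)"
      using \<phi>_lincomb_division[OF coordZ[OF x(1)], of m] by blast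
    define k where "k i = nat (coord x i m)" for i
    define u where "u = \<phi> (lincomb e w)"
    have u: "u \<in> ?V" unfolding u_def using lincomb_closed[OF e' w(1)] by blast
    have eV: "\<phi> (e i) \<in> ?V" if "i < d" for i using e' that by auto
    have keV: "of_nat (k i) * \<phi> (e i) \<in> ?V" if "i < d" for i
      by (rule add_subgroup_of_nat_mult[OF V eV[OF that]])
    let ?s = "\<Sum>i<d. of_nat (k i) * \<phi> (e i)" and ?t = "\<Sum>i<d. of_nat (k i) * h (\<phi> (e i))"
    have s: "?s \<in> ?V" using keV by (intro add_subgroup_sum[OF V]) auto
    have v_eq: "v = ?s + of_nat (p ^ m) * u"
      using bspec[OF w(2) e'] coord(2)[OF x(1), symmetric] x(2) by (simp add: k_def u_def)
    have F': "F v = ?t + of_nat (p ^ m) * \<phi> (lincomb b w)"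
      unfolding Fv bspec[OF w(2) b] by (simp add: k_def \<phi>b)
    have "of_nat (p ^ m) * \<phi> (lincomb b w) \<in> U"
      using U(3) multiplesI[of "\<phi> (lincomb b w)" ?V "p ^ m"] lincomb_closed[OF b w(1)] by blast
    then have 1: "F v - ?t \<in> U" by (simp only: F' add_diff_cancel_left')
    have 2: "h v - (h ?s + h (of_nat (p ^ m) * u)) \<in> U"
      unfolding v_eq by (rule h_add[OF s add_subgroup_of_nat_mult[OF V u]])
    have "of_nat (p ^ m) * h u \<in> U" using U(3) multiplesI[OF h[OF u], of "p ^ m"] by blast
    then have 3: "h (of_nat (p ^ m) * u) \<in> U"
      using add_subgroup_cong[OF U(1) h_mult[OF u, of "p ^ m"]] by blast
    have 4: "h ?s - (\<Sum>i<d. h (of_nat (k i) * \<phi> (e i))) \<in> U"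
      using keV by (intro h_sum) auto
    have "(\<Sum>i<d. h (of_nat (k i) * \<phi> (e i)) - of_nat (k i) * h (\<phi> (e i))) \<in> U"
      using h_mult eV by (intro add_subgroup_sum[OF U(1)]) auto
    then have 5: "(\<Sum>i<d. h (of_nat (k i) * \<phi> (e i))) - ?t \<in> U" by (simp only: sum_subtractf)
    \<comment> \<open>The errors 1 to 5 telescope to F v - h v.\<close>
    have "(F v - ?t) - ((h v - (h ?s + h (of_nat (p ^ m) * u))) + h (of_nat (p ^ m) * u) +
        ((h ?s - (\<Sum>i<d. h (of_nat (k i) * \<phi> (e i)))) + ((\<Sum>i<d. h (of_nat (k i) * \<phi> (e i))) - ?t))) \<in> U"
      by (rule add_subgroup_diff[OF U(1) 1 add_subgroup_add[OF U(1) add_subgroup_add[OF U(1) 2 3]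
            add_subgroup_add[OF U(1) 4 5]]])
    also have "(F v - ?t) - ((h v - (h ?s + h (of_nat (p ^ m) * u))) + h (of_nat (p ^ m) * u) +
        ((h ?s - (\<Sum>i<d. h (of_nat (k i) * \<phi> (e i)))) + ((\<Sum>i<d. h (of_nat (k i) * \<phi> (e i))) - ?t))) =
        F v - h v"
      by (simp add: algebra_simps)
    finally show ?thesis using FV by blast
  qed
  ultimately show ?thesis by blast
qed

end

section \<open>Uniserial modules\<close>

text \<open>The basis is called b, as e is the exponent of the order of R. \<open>infinite_T\<close>
  guards against a trivial term of the series, after which \<open>uniserial\<close> says nothing
  about the layers.\<close>

locale free_uniserial_module = R: group R + free_padic_module T p d M b
  for R :: "'g monoid" and T :: "'w monoid" and p d M b +
  fixes act :: "'w \<Rightarrow> 'g \<Rightarrow> 'w" and e :: nat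
  assumes prime: "prime p" and order_R: "order R = p ^ e"
    and act_closed: "t \<in> carrier T \<Longrightarrow> g \<in> carrier R \<Longrightarrow> act t g \<in> carrier T"
    and act_mult: "s \<in> carrier T \<Longrightarrow> t \<in> carrier T \<Longrightarrow> g \<in> carrier R \<Longrightarrow>
      act (s \<otimes>\<^bsub>T\<^esub> t) g = act s g \<otimes>\<^bsub>T\<^esub> act t g"
    and act_comp: "t \<in> carrier T \<Longrightarrow> g \<in> carrier R \<Longrightarrow> h \<in> carrier R \<Longrightarrow>
      act t (g \<otimes>\<^bsub>R\<^esub> h) = act (act t g) h"
    and act_one: "t \<in> carrier T \<Longrightarrow> act t \<one>\<^bsub>R\<^esub> = t"
    and uniserial: "uniserial p R T act"
    and infinite_T: "infinite (carrier T)"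
begin

section \<open>Transport of T and its series into the ring\<close>

abbreviation V :: "residue_product set" where "V \<equiv> \<phi> ` carrier T"

definition \<psi> :: "residue_product \<Rightarrow> 'w" where "\<psi> = inv_into (carrier T) \<phi>"

definition A :: "residue_product \<Rightarrow> 'g \<Rightarrow> residue_product" where "A v g = \<phi> (act (\<psi> v) g)"

definition Vs :: "nat \<Rightarrow> residue_product set" where "Vs i = {v \<in> V. \<psi> v \<in> action_series R T act i}"

lemma \<psi>_\<phi>: "x \<in> carrier T \<Longrightarrow> \<psi> (\<phi> x) = x"
  unfolding \<psi>_def by (rule inv_into_f_f[OF \<phi>_inj])

lemma A_\<phi>: "x \<in> carrier T \<Longrightarrow> A (\<phi> x) g = \<phi> (act x g)"
  by (simp add: A_def \<psi>_\<phi>)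

lemma embedded: "embedded_module R V A T act \<psi>"
proof (intro embedded_module.intro additive_rep.intro additive_rep_axioms.intro embedded_module_axioms.intro)
  show "group R" by (rule R.is_group)
  show "add_subgroup V" by (rule \<phi>_subgroup)
  show "comm_group T" by (rule T.comm_group_axioms)
qed (auto simp: A_\<phi> \<psi>_\<phi> act_closed additive_on_def \<phi>_add[symmetric] act_mult act_comp act_one \<phi>_eq_0_iff
  intro!: bexI[of _ "\<phi> _"])

interpretation E: embedded_module R V A T act \<psi> by (rule embedded)

lemma series_subgroup: "subgroup (action_series R T act i) T"
proof (induction i)
  case 0
  show ?case by (simp add: T.subgroup_self)
next
  case (Suc i)
  have "{act v g \<otimes>\<^bsub>T\<^esub> inv\<^bsub>T\<^esub> v | v g. v \<in> action_series R T act i \<and> g \<in> carrier R} \<subseteq> carrier T"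
    using subgroup.mem_carrier[OF Suc] act_closed by auto
  then show ?case unfolding action_series.simps by (rule T.generate_is_subgroup)
qed

lemma series_Suc_subset: "action_series R T act (Suc i) \<subseteq> action_series R T act i"
proof (induction i)
  case 0
  then show ?case using subgroup.subset[OF series_subgroup[of "Suc 0"]] by simp
next
  case (Suc i)
  have "{act v g \<otimes>\<^bsub>T\<^esub> inv\<^bsub>T\<^esub> v | v g. v \<in> action_series R T act (Suc i) \<and> g \<in> carrier R} \<subseteq>
      action_series R T act (Suc i)"
  proof clarify
    fix v g assume "v \<in> action_series R T act (Suc i)" and g: "g \<in> carrier R"
    then have "v \<in> action_series R T act i" using Suc by blast
    then show "act v g \<otimes>\<^bsub>T\<^esub> inv\<^bsub>T\<^esub> v \<in> action_series R T act (Suc i)"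
      unfolding action_series.simps(2) using g by (intro generate.incl) blast
  qed
  then show ?case
    unfolding action_series.simps(2)[of R T act "Suc i"]
    by (rule T.generate_subgroup_incl[OF _ series_subgroup])
qed

lemma \<psi>_Vs: "\<psi> ` Vs i = action_series R T act i"
  unfolding Vs_def using subgroup.mem_carrier[OF series_subgroup] by (force simp: \<psi>_\<phi> image_iff)

lemma Vs_subgroup: "add_subgroup (Vs i)"
proof -
  interpret S: subgroup "action_series R T act i" T by (rule series_subgroup)
  show ?thesis
    unfolding add_subgroup_def
  proof (intro conjI ballI)
    show "0 \<in> Vs i"
      using \<phi>_one \<psi>_\<phi>[OF T.one_closed] T.one_closed by (auto simp: Vs_def image_iff intro: bexI[of _ "\<one>\<^bsub>T\<^esub>"])
    fix v w assume "v \<in> Vs i" "w \<in> Vs i"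
    then obtain x y where xy: "x \<in> carrier T" "v = \<phi> x" "x \<in> action_series R T act i"
        "y \<in> carrier T" "w = \<phi> y" "y \<in> action_series R T act i"
      by (auto simp: Vs_def \<psi>_\<phi>)
    then have "v - w = \<phi> (x \<otimes>\<^bsub>T\<^esub> inv\<^bsub>T\<^esub> y)" by (simp add: \<phi>_add \<phi>_inv)
    then show "v - w \<in> Vs i" using xy by (simp add: Vs_def \<psi>_\<phi>)
  qed
qed

lemma Vs_commutator:
  assumes "v \<in> Vs i" and g: "g \<in> carrier R" shows "A v g - v \<in> Vs (Suc i)"
proof -
  obtain x where x: "x \<in> carrier T" "v = \<phi> x" "x \<in> action_series R T act i"
    using assms by (auto simp: Vs_def \<psi>_\<phi>)
  have "A v g - v = \<phi> (act x g \<otimes>\<^bsub>T\<^esub> inv\<^bsub>T\<^esub> x)"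
    using x g by (simp add: A_\<phi> \<phi>_add \<phi>_inv act_closed)
  moreover have "act x g \<otimes>\<^bsub>T\<^esub> inv\<^bsub>T\<^esub> x \<in> action_series R T act (Suc i)"
    unfolding action_series.simps(2) using g x by (intro generate.incl) blast
  ultimately show ?thesis using x g act_closed by (simp add: Vs_def \<psi>_\<phi> del: action_series.simps)
qed

lemma Vs_least:
  assumes U: "add_subgroup U" and comm: "\<And>v g. v \<in> Vs i \<Longrightarrow> g \<in> carrier R \<Longrightarrow> A v g - v \<in> U"
  shows "Vs (Suc i) \<subseteq> U"
proof -
  \<comment> \<open>U may contain ring elements outside V, on which \<psi> has no meaning; the
    intersection corresponds to a subgroup of T.\<close>
  have UV: "add_subgroup (U \<inter> V)" using U \<phi>_subgroup by (auto simp: add_subgroup_def)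
  have "action_series R T act (Suc i) \<subseteq> \<psi> ` (U \<inter> V)"
    unfolding action_series.simps(2)
  proof (rule T.generate_subgroup_incl[OF _ E.subgroup_image[OF UV]])
    show "{act v g \<otimes>\<^bsub>T\<^esub> inv\<^bsub>T\<^esub> v | v g. v \<in> action_series R T act i \<and> g \<in> carrier R} \<subseteq> \<psi> ` (U \<inter> V)"
    proof clarify
      fix x g assume x: "x \<in> action_series R T act i" and g: "g \<in> carrier R"
      have xT: "x \<in> carrier T" by (rule subgroup.mem_carrier[OF series_subgroup x])
      have "\<phi> x \<in> Vs i" using x xT by (simp add: Vs_def \<psi>_\<phi>)
      then have "A (\<phi> x) g - \<phi> x \<in> U" using comm g by blast
      moreover have eq: "A (\<phi> x) g - \<phi> x = \<phi> (act x g \<otimes>\<^bsub>T\<^esub> inv\<^bsub>T\<^esub> x)"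
        using xT g by (simp add: A_\<phi> \<phi>_add \<phi>_inv act_closed)
      ultimately have "\<phi> (act x g \<otimes>\<^bsub>T\<^esub> inv\<^bsub>T\<^esub> x) \<in> U \<inter> V" using xT g act_closed by simp
      then show "act x g \<otimes>\<^bsub>T\<^esub> inv\<^bsub>T\<^esub> x \<in> \<psi> ` (U \<inter> V)"
        using \<psi>_\<phi>[of "act x g \<otimes>\<^bsub>T\<^esub> inv\<^bsub>T\<^esub> x"] xT g act_closed by (metis T.inv_closed T.m_closed imageI)
    qed
  qed simp
  then show ?thesis
    using E.\<psi>_mem_image_iff[of _ "U \<inter> V"] by (auto simp: Vs_def simp del: action_series.simps)
qed

text \<open>A subgroup of index p in an infinite group is infinite. Hence the side condition in
  \<open>uniserial\<close> always holds and every layer has order p.\<close>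

lemma series_infinite: "infinite (action_series R T act i)"
proof (induction i)
  case 0
  then show ?case using infinite_T by simp
next
  case (Suc i)
  let ?S = "action_series R T act i" and ?S' = "action_series R T act (Suc i)"
  let ?TS = "T\<lparr>carrier := ?S\<rparr>"
  interpret TS: group ?TS by (rule subgroup.subgroup_is_group[OF series_subgroup T.is_group])
  have sub: "subgroup ?S' ?TS"
    by (rule T.subgroup_incl[OF series_subgroup series_subgroup series_Suc_subset])
  show ?case
  proof
    assume fin: "finite ?S'"
    have "?S \<noteq> {\<one>\<^bsub>T\<^esub>}" using Suc by auto
    then have "order (?TS Mod ?S') = p" using uniserial by (simp add: uniserial_def)
    then have "card (rcosets\<^bsub>?TS\<^esub> ?S') > 0"
      using p by (simp add: order_def FactGroup_def)
    then have "finite (rcosets\<^bsub>?TS\<^esub> ?S')" by (rule card_ge_0_finite)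
    moreover have "finite C" if "C \<in> rcosets\<^bsub>?TS\<^esub> ?S'" for C
      using that fin by (auto simp: RCOSETS_def r_coset_def)
    ultimately have "finite (\<Union>(rcosets\<^bsub>?TS\<^esub> ?S'))" by blast
    then show False using TS.rcosets_part_G[OF sub] Suc by simp
  qed
qed

lemma order_quotient: "order (sub_term R T act i Mod action_series R T act (Suc i)) = p"
proof -
  have "action_series R T act i \<noteq> {\<one>\<^bsub>T\<^esub>}" using series_infinite[of i] by auto
  then show ?thesis using uniserial by (simp add: uniserial_def del: action_series.simps)
qed

lemma Vs_subset: "Vs i \<subseteq> V"
  by (auto simp: Vs_def)

lemma Vs_Suc_subset: "Vs (Suc i) \<subseteq> Vs i"
  unfolding Vs_def using series_Suc_subset by blast

lemma Vs_invariant: "E.invariant (Vs i)"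
  unfolding E.invariant_def
proof (intro ballI)
  fix v g assume v: "v \<in> Vs i" and g: "g \<in> carrier R"
  have "A v g - v \<in> Vs i" using Vs_commutator[OF v g] Vs_Suc_subset by blast
  then show "A v g \<in> Vs i" using add_subgroup_add[OF Vs_subgroup, of "A v g - v" i v] v by simp
qed

lemma presented_layer:
  "presented_module R V A (sub_term R T act i Mod action_series R T act (Suc i)) (quot_act act)
     (Vs i) (Vs (Suc i)) (\<lambda>x. action_series R T act (Suc i) #>\<^bsub>T\<^esub> \<psi> x)"
  using E.presented_quot[OF Vs_subgroup Vs_subset Vs_invariant Vs_subgroup Vs_Suc_subset Vs_invariant, of i]
  unfolding \<psi>_Vs .

lemma Vs_index: "add_index (Vs i) (Vs (Suc i)) = p"
proof -
  let ?W = "sub_term R T act i Mod action_series R T act (Suc i)"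
  let ?\<rho> = "\<lambda>x. action_series R T act (Suc i) #>\<^bsub>T\<^esub> \<psi> x"
  interpret P: presented_module R V A ?W "quot_act act" "Vs i" "Vs (Suc i)" ?\<rho> by (rule presented_layer)
  have "add_index (Vs i) (Vs (Suc i)) = card (?\<rho> ` Vs i)"
    by (rule add_index_eq_card_image[OF Vs_subgroup]) (rule P.\<rho>_eq_iff)
  also have "?\<rho> ` Vs i = carrier ?W" using P.\<rho>_closed P.\<rho>_surj by blast
  finally show ?thesis using order_quotient[of i] by (simp only: order_def)
qed

text \<open>The layer is a group of order p, so p-th powers in it are trivial.\<close>

lemma p_mult_Vs:
  assumes v: "v \<in> Vs i" shows "of_nat p * v \<in> Vs (Suc i)"
proof -
  let ?W = "sub_term R T act i Mod action_series R T act (Suc i)"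
  let ?\<rho> = "\<lambda>x. action_series R T act (Suc i) #>\<^bsub>T\<^esub> \<psi> x"
  interpret P: presented_module R V A ?W "quot_act act" "Vs i" "Vs (Suc i)" ?\<rho> by (rule presented_layer)
  interpret W: comm_group ?W by (rule P.W)
  have "?\<rho> v [^]\<^bsub>?W\<^esub> p = \<one>\<^bsub>?W\<^esub>"
    using W.pow_order_eq_1[OF P.\<rho>_closed[OF v]] unfolding order_quotient .
  then have "?\<rho> (of_nat p * v) = \<one>\<^bsub>?W\<^esub>" using P.\<rho>_pow[OF v, of p] by simp
  then show ?thesis
    using P.\<rho>_kernel[OF add_subgroup_of_nat_mult[OF Vs_subgroup v, of p]] by blast
qed

lemma projective_lattice: "projective_lattice R V A p e d Vs T act \<psi>"
proof (intro projective_lattice.intro embedded_lattice.intro uniserial_lattice.intro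
    uniserial_lattice_axioms.intro embedded_lattice_axioms.intro projective_lattice_axioms.intro)
  show "Vs 0 = V" by (auto simp: Vs_def \<psi>_\<phi>)
qed (fact embedded E.additive_rep_axioms prime order_R Vs_subgroup Vs_commutator Vs_least Vs_index
    p_mult_Vs torsion_free index_multiples_p \<psi>_Vs lifting)+

end


section \<open>Conjugation on an abelian normal subgroup\<close>

text \<open>If the cosets of H are closed under products, then (Hx)(H inv x) is a single coset. It
  contains 1, so it is H, and it contains x h (inv x). This obtains normality from the group
  property of the quotient, without an argument about closures of commutator subgroups.\<close>

lemma (in group) normal_if_group_Mod:
  assumes H: "subgroup H G" and Mod: "group (G Mod H)"
  shows "H \<lhd> G"
  unfolding normal_inv_iff
proof (intro conjI ballI H)
  fix x h assume x: "x \<in> carrier G" and h: "h \<in> H"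
  interpret Q: group "G Mod H" by (rule Mod)
  have HG: "H \<subseteq> carrier G" by (rule subgroup.subset[OF H])
  have "(H #> x) \<otimes>\<^bsub>G Mod H\<^esub> (H #> inv x) \<in> carrier (G Mod H)"
    using x by (intro Q.m_closed) (auto simp: FactGroup_def RCOSETS_def)
  then obtain y where y: "y \<in> carrier G" "(H #> x) <#> (H #> inv x) = H #> y"
    by (auto simp: FactGroup_def RCOSETS_def)
  have one: "\<one> \<in> H" by (rule subgroup.one_closed[OF H])
  have mem: "(\<one> \<otimes> x) \<otimes> (k \<otimes> inv x) \<in> H #> y" if "k \<in> H" for k
  proof -
    have "\<one> \<otimes> x \<in> H #> x" "k \<otimes> inv x \<in> H #> inv x"
      using one that unfolding r_coset_def by blast+
    then show ?thesis unfolding y(2)[symmetric] set_mult_def by blast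
  qed
  have "\<one> \<in> H #> y" using mem[OF one] x by simp
  then have "H #> y = H" using repr_independence[OF _ y(1) H, of \<one>] HG by simp
  then show "x \<otimes> h \<otimes> inv x \<in> H" using mem[OF h] x h HG by (simp add: m_assoc subset_iff)
qed

locale abelian_normal_subgroup = normal H G
  for H and G :: "'a monoid" (structure) +
  assumes comm: "s \<in> H \<Longrightarrow> t \<in> H \<Longrightarrow> s \<otimes> t = t \<otimes> s"
begin

text \<open>Two representatives of g differ by a factor in H, and H is abelian, so the choice made
  by \<open>SOME\<close> in \<open>conj_act\<close> has no influence.\<close>

lemma conj_act_eq:
  assumes t: "t \<in> H" and g: "g \<in> carrier (G Mod H)" and s: "s \<in> g"
  shows "conj_act G t g = inv s \<otimes> t \<otimes> s"
proof -
  obtain x where x: "x \<in> carrier G" "g = H #> x" using g by (auto simp: FactGroup_def RCOSETS_def)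
  have HG: "H \<subseteq> carrier G" by (rule subset)
  have eq: "inv s \<otimes> t \<otimes> s = inv x \<otimes> t \<otimes> x" if "s \<in> g" for s
  proof -
    have "s \<in> H #> x" using \<open>s \<in> g\<close> x(2) by simp
    then obtain u where u: "u \<in> H" "s = u \<otimes> x" unfolding r_coset_def by blast
    have uG: "u \<in> carrier G" "t \<in> carrier G" using u t HG by auto
    have "inv s \<otimes> t \<otimes> s = inv x \<otimes> (inv u \<otimes> (t \<otimes> u)) \<otimes> x"
      using u uG x by (simp add: inv_mult_group m_assoc)
    also have "inv u \<otimes> (t \<otimes> u) = t" using comm[OF t u(1)] uG by (simp add: m_assoc[symmetric])
    finally show ?thesis .
  qed
  have "(SOME s. s \<in> g) \<in> g" using s by (rule someI)
  then show ?thesis using eq s by (simp add: conj_act_def Let_def)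
qed

lemma conj_act_coset:
  assumes "t \<in> H" "x \<in> carrier G"
  shows "conj_act G t (H #> x) = inv x \<otimes> t \<otimes> x"
  using assms rcos_self[OF assms(2)] subgroup_axioms
  by (intro conj_act_eq) (auto simp: FactGroup_def RCOSETS_def)

lemma conj_act_closed: "t \<in> H \<Longrightarrow> g \<in> carrier (G Mod H) \<Longrightarrow> conj_act G t g \<in> H"
  by (auto simp: FactGroup_def RCOSETS_def conj_act_coset inv_op_closed1)

lemma conj_act_mult:
  assumes "s \<in> H" "t \<in> H" "g \<in> carrier (G Mod H)"
  shows "conj_act G (s \<otimes> t) g = conj_act G s g \<otimes> conj_act G t g"
proof -
  obtain x where x: "x \<in> carrier G" "g = H #> x" using assms by (auto simp: FactGroup_def RCOSETS_def)
  have "inv x \<otimes> (s \<otimes> t) \<otimes> x = inv x \<otimes> s \<otimes> x \<otimes> (inv x \<otimes> t \<otimes> x)"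
    using x(1) assms by (simp add: m_assoc) (simp add: m_assoc[symmetric])
  then show ?thesis using x assms by (simp add: conj_act_coset)
qed

lemma conj_act_comp:
  assumes "t \<in> H" "g \<in> carrier (G Mod H)" "h \<in> carrier (G Mod H)"
  shows "conj_act G t (g \<otimes>\<^bsub>G Mod H\<^esub> h) = conj_act G (conj_act G t g) h"
proof -
  obtain x where x: "x \<in> carrier G" "g = H #> x" using assms by (auto simp: FactGroup_def RCOSETS_def)
  obtain y where y: "y \<in> carrier G" "h = H #> y" using assms by (auto simp: FactGroup_def RCOSETS_def)
  have "g \<otimes>\<^bsub>G Mod H\<^esub> h = H #> (x \<otimes> y)" using x y by (simp add: FactGroup_def rcos_sum)
  then show ?thesis
    using x y assms inv_op_closed1[OF x(1) assms(1)] by (simp add: conj_act_coset inv_mult_group m_assoc)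
qed

lemma conj_act_one: "t \<in> H \<Longrightarrow> conj_act G t \<one>\<^bsub>G Mod H\<^esub> = t"
  using conj_act_coset[of t \<one>] by (simp add: FactGroup_def subset)

end


section \<open>The orbit correspondence\<close>

theorem theorem6:
  fixes S :: "'a monoid" and \<tau> :: "'a topology"
    and R :: "'a set monoid" and T :: "'a monoid"
    and p r k l d :: nat
  assumes "prime p"
    and "infinite_pro_p_of_coclass p r S \<tau>"
    and "1 \<le> l"
    and R_def: "R = S Mod lower_central S \<tau> l"
    and T_def: "T = S\<lparr>carrier := lower_central S \<tau> l\<rparr>"
    and "shaved_coclass_tree p r k S \<tau> R"
    and "free_module_of_rank (padic_integers p) (padic_module \<tau> T) d"
    and "uniserial p R T (conj_act S)"
    and "\<And>(G :: nat monoid) n.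
           \<lbrakk>shaved_coclass_tree p r k S \<tau> G; descendant p r G R; order G = order R * p ^ n\<rbrakk>
           \<Longrightarrow> is_extension G R (quot_term R T (conj_act S) n) (quot_act (conj_act S))"
  shows "\<exists>N. \<forall>n\<ge>N.
     id_plus_mu p d R T (conj_act S) n
       \<in> iso (H2_quot R T (conj_act S) n) (H2_quot R T (conj_act S) (n + d)) \<and>
     bij_betw (\<lambda>orb. id_plus_mu p d R T (conj_act S) n ` orb)
       (comp_orbits R (quot_term R T (conj_act S) n) (quot_act (conj_act S)))
       (comp_orbits R (quot_term R T (conj_act S) (n + d)) (quot_act (conj_act S)))"
proof -
  let ?H = "lower_central S \<tau> l"
  let ?M = "padic_module \<tau> T"
  have "pro_p_group p S \<tau>" and inf_S: "infinite (carrier S)"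
    using assms(2) by (auto simp: infinite_pro_p_of_coclass_def)
  then have top: "topological_group S \<tau>" by (simp add: pro_p_group_def)
  interpret S: group S using top by (simp add: topological_group_def)
  have HS: "?H \<subseteq> carrier S"
  proof -
    have "topspace \<tau> = carrier S" using top by (simp add: topological_group_def)
    then show ?thesis using closure_of_subset_topspace[of \<tau>] by (cases "(S, \<tau>, l)" rule: lower_central.cases) auto
  qed
  have "finite_p_group p R"
    using assms(6) by (simp add: shaved_coclass_tree_def coclass_tree_def descendant_def p_group_of_coclass_def)
  then obtain e where group_R: "group R" and e: "order R = p ^ e" by (auto simp: finite_p_group_def)
  have M: "Module.module (padic_integers p) ?M"
    using assms(7) by (simp add: free_module_of_rank_def)
  obtain b where b: "b \<in> {..<d} \<rightarrow> carrier ?M"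
    and free': "\<forall>x\<in>carrier ?M. \<exists>!c. c \<in> {..<d} \<rightarrow>\<^sub>E carrier (padic_integers p) \<and>
      x = (\<Oplus>\<^bsub>?M\<^esub>i\<in>{..<d}. c i \<odot>\<^bsub>?M\<^esub> b i)"
    using assms(7) unfolding free_module_of_rank_def by (elim conjE bexE) (rule that)
  note free = bspec[OF free']
  have M_simps: "carrier ?M = carrier T" "add ?M = mult T" "zero ?M = one T"
    by (simp_all add: padic_module_def)
  \<comment> \<open>The addition of \<open>padic_module\<close> is the multiplication of T, so the
    module axioms contain the axioms of a commutative group.\<close>
  have comm_T: "comm_group T"
  proof -
    interpret M: Module.module "padic_integers p" ?M by (rule M)
    show ?thesis
    proof (rule comm_groupI)
      fix x y z assume x: "x \<in> carrier T" and y: "y \<in> carrier T" and z: "z \<in> carrier T"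
      show "x \<otimes>\<^bsub>T\<^esub> y \<in> carrier T" "x \<otimes>\<^bsub>T\<^esub> y \<otimes>\<^bsub>T\<^esub> z = x \<otimes>\<^bsub>T\<^esub> (y \<otimes>\<^bsub>T\<^esub> z)"
        "x \<otimes>\<^bsub>T\<^esub> y = y \<otimes>\<^bsub>T\<^esub> x" "\<one>\<^bsub>T\<^esub> \<otimes>\<^bsub>T\<^esub> x = x"
        using M.add.m_closed[of x y] M.add.m_assoc[of x y z] M.add.m_comm[of x y] M.add.l_one[of x] x y z
        by (simp_all add: M_simps)
      show "\<exists>y\<in>carrier T. y \<otimes>\<^bsub>T\<^esub> x = \<one>\<^bsub>T\<^esub>"
        using M.add.l_inv_ex[of x] x by (simp add: M_simps)
    qed (use M.add.one_closed in \<open>simp add: M_simps\<close>)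
  qed
  interpret T: comm_group T by (rule comm_T)
  have sub: "subgroup ?H S"
    by (rule S.group_incl_imp_subgroup[OF HS]) (use T.is_group in \<open>simp add: T_def\<close>)
  \<comment> \<open>Membership of R in the tree makes R a finite p-group, in particular a
    group.\<close>
  have normal: "?H \<lhd> S" by (rule S.normal_if_group_Mod[OF sub]) (use group_R in \<open>simp add: R_def\<close>)
  interpret H: abelian_normal_subgroup ?H S
  proof (intro abelian_normal_subgroup.intro abelian_normal_subgroup_axioms.intro normal)
    show "s \<otimes>\<^bsub>S\<^esub> t = t \<otimes>\<^bsub>S\<^esub> s" if "s \<in> ?H" "t \<in> ?H" for s t
      using T.m_comm[of s t] that by (simp add: T_def)
  qed
  \<comment> \<open>Otherwise S would be a union of finitely many finite cosets, since R is
    finite.\<close>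
  have inf_T: "infinite (carrier T)"
  proof
    assume "finite (carrier T)"
    then have fin: "finite ?H" by (simp add: T_def)
    have "card (rcosets\<^bsub>S\<^esub> ?H) > 0"
      using e prime_gt_0_nat[OF assms(1)] by (simp add: R_def order_def FactGroup_def)
    then have "finite (rcosets\<^bsub>S\<^esub> ?H)" by (rule card_ge_0_finite)
    moreover have "finite C" if "C \<in> rcosets\<^bsub>S\<^esub> ?H" for C
      using that fin by (auto simp: RCOSETS_def r_coset_def)
    ultimately have "finite (\<Union>(rcosets\<^bsub>S\<^esub> ?H))" by blast
    then show False using S.rcosets_part_G[OF sub] inf_S by simp
  qed
  interpret free_uniserial_module R T p d ?M b "conj_act S" e
  proof (intro free_uniserial_module.intro free_padic_module.intro free_padic_module_axioms.intro
      free_uniserial_module_axioms.intro group_R comm_T M M_simps b free assms(1) e assms(8) inf_T)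
    show "p > 1" using prime_gt_1_nat[OF assms(1)] .
  qed (simp_all add: R_def T_def H.conj_act_closed H.conj_act_mult H.conj_act_comp[simplified]
      H.conj_act_one[simplified])
  interpret projective_lattice R V A p e d Vs T "conj_act S" \<psi> by (rule projective_lattice)
  show ?thesis by (rule id_plus_mu_correspondence)
qed

end
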